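(* Let $(P_t)_{t\ge0}$ be a Markov transition semi-group on $\mathbb R^d$ having a unique stationary distribution $\nu$, with $M_\nu(q)=\int|x|^q\nu(dx)<+\infty$ for some $q>1$. Assume that there exists $e\in\mathbb L^1([0,+\infty))$ such that $$\forall\,t\in[0,+\infty),\ \forall\,f\in\mathbb L^2(\nu),\qquad \mathrm{Var}_\nu(P_tf)\le e(t)\,\mathrm{Var}_\nu(f).$$ Let $(X_t)_{t\ge0}$ be a right continuous Markov process with transition semi-group $(P_t)_{t\ge0}$ and $X_0\sim\nu$ (i.e. under its stationary regime), with occupation measure $\nu_t$. Then for every $t_0>0$, Property $\mathbf A_{\frac12,q,\frac12}$ (see context) holds true with $\pi_t=\nu$ and $\mathsf M_{\pi,q}=1\vee M_\nu(q)$. Consequently, for every $p\in(0,q)$ and $t_0>0$ there exists a real constant $K>0$ such that for every $t\ge t_0$, $\mathbb E\,\mathcal W_p^p(\nu_t,\nu)\le K\,r(t)$, where - if $p<\frac d2$: $r(t)=t^{-\frac pd}$ when $\frac pq<\frac d{d+q}$, and $r(t)=t^{-(1-\frac pq)}$ when $\frac d{d+q}<\frac pq<1$; - if $p=\frac d2$: $r(t)=t^{-\frac12}\log(1+t)$ when $\frac pq<\frac12$, and $r(t)=t^{-(1-\frac pq)}$ when $\frac12<\frac pq<1$; - if $p>\frac d2$: $r(t)=t^{-\frac12}$ when $\frac pq<\frac12$, and $r(t)=t^{-(1-\frac pq)}$ when $\frac12<\frac pq<1$.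
   Context: $\nu_t(\omega,d\xi)=\frac1t\int_0^t\delta_{X_s(\omega)}(d\xi)\,ds$. $\mathrm{Var}_\nu(f)=\int(f-\nu(f))^2d\nu$. $|\cdot|$ is the Euclidean norm, $M_\mu(q)=\int|\xi|^q\mu(d\xi)$; for $p>0$, $\mathcal W_p(\mu,\nu)=\inf_\varpi(\int|x-y|^p\varpi(dx,dy))^{1/p}$ over couplings $\varpi$ of $\mu$ and $\nu$; $a\vee b=\max(a,b)$. Property $\mathbf A_{\beta,q,\gamma}$ (for a given $t_0>0$ and a family $(\pi_t)_{t\ge t_0}$ of probability measures): there is a constant $C_0\in(0,\infty)$ with $\mathbb E|\nu_t(A)-\nu(A)|\le C_0\min\big(\pi_t(A),\pi_t(A)^\beta t^{-\gamma}\big)$ for every $t\ge t_0$ and every Borel $A$, and $\mathsf M_{\pi,q}:=1\vee\sup_{t\ge t_0}M_{\pi_t}(q)<+\infty$. *)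

theory Defs
  imports "HOL-Probability.Probability"
begin

text \<open>Time is the half-line of nonnegative reals; families indexed by \<^typ>\<open>real\<close> are
  constrained (and used) at nonnegative times only.\<close>

definition markov_semigroup :: "(real \<Rightarrow> 'a::euclidean_space \<Rightarrow> 'a measure) \<Rightarrow> bool" where
  "markov_semigroup P \<longleftrightarrow>
     (\<forall>t\<ge>0. P t \<in> borel \<rightarrow>\<^sub>M prob_algebra borel) \<and>
     (\<forall>x. P 0 x = return borel x) \<and>
     (\<forall>s\<ge>0. \<forall>t\<ge>0. \<forall>x. P (s + t) x = P s x \<bind> P t)"

definition kernel_op :: "('a \<Rightarrow> 'a measure) \<Rightarrow> ('a \<Rightarrow> real) \<Rightarrow> 'a \<Rightarrow> real" where
  "kernel_op \<kappa> f x = (\<integral>y. f y \<partial>\<kappa> x)"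

definition stationary_distribution ::
    "(real \<Rightarrow> 'a::euclidean_space \<Rightarrow> 'a measure) \<Rightarrow> 'a measure \<Rightarrow> bool" where
  "stationary_distribution P \<nu> \<longleftrightarrow>
     prob_space \<nu> \<and> sets \<nu> = sets borel \<and> (\<forall>t\<ge>0. \<nu> \<bind> P t = \<nu>)"

definition natural_filtration ::
    "'w measure \<Rightarrow> (real \<Rightarrow> 'w \<Rightarrow> 'a::euclidean_space) \<Rightarrow> real \<Rightarrow> 'w measure" where
  "natural_filtration M X s =
     sigma (space M) {X u -` A \<inter> space M | u A. 0 \<le> u \<and> u \<le> s \<and> A \<in> sets borel}"

definition markov_process ::
    "'w measure \<Rightarrow> (real \<Rightarrow> 'a::euclidean_space \<Rightarrow> 'a measure) \<Rightarrow>
      (real \<Rightarrow> 'w \<Rightarrow> 'a) \<Rightarrow> bool" where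
  "markov_process M P X \<longleftrightarrow>
     prob_space M \<and>
     (\<forall>t\<ge>0. X t \<in> borel_measurable M) \<and>
     (\<forall>s\<ge>0. \<forall>t\<ge>0. \<forall>f\<in>borel_measurable borel. bounded (range f) \<longrightarrow>
        (AE \<omega> in M. real_cond_exp M (natural_filtration M X s) (\<lambda>\<omega>'. f (X (s + t) \<omega>')) \<omega>
                     = kernel_op (P t) f (X s \<omega>)))"

definition right_continuous_paths ::
    "'w measure \<Rightarrow> (real \<Rightarrow> 'w \<Rightarrow> 'a::euclidean_space) \<Rightarrow> bool" where
  "right_continuous_paths M X \<longleftrightarrow>
     (\<forall>\<omega>\<in>space M. \<forall>t\<ge>0. continuous (at_right t) (\<lambda>s. X s \<omega>))"

definition occupation_measure ::
    "(real \<Rightarrow> 'w \<Rightarrow> 'a::euclidean_space) \<Rightarrow> real \<Rightarrow> 'w \<Rightarrow> 'a measure" where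
  "occupation_measure X t \<omega> =
     measure_of UNIV (sets borel)
       (\<lambda>A. ennreal (1 / t) * (\<integral>\<^sup>+s\<in>{0..t}. emeasure (return borel (X s \<omega>)) A \<partial>lborel))"

definition variance_wrt :: "'a measure \<Rightarrow> ('a \<Rightarrow> real) \<Rightarrow> real" where
  "variance_wrt \<nu> f = (\<integral>x. (f x - (\<integral>y. f y \<partial>\<nu>))\<^sup>2 \<partial>\<nu>)"

definition L2 :: "'a measure \<Rightarrow> ('a \<Rightarrow> real) set" where
  "L2 \<nu> = {f \<in> borel_measurable \<nu>. integrable \<nu> (\<lambda>x. (f x)\<^sup>2)}"

definition moment :: "'a::euclidean_space measure \<Rightarrow> real \<Rightarrow> ennreal" where
  "moment \<mu> q = (\<integral>\<^sup>+x. ennreal (norm x powr q) \<partial>\<mu>)"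

definition epowr :: "ennreal \<Rightarrow> real \<Rightarrow> ennreal" where
  \<comment> \<open>only used with a positive exponent\<close>
  "epowr x a = (if x = \<infinity> then \<infinity> else ennreal (enn2real x powr a))"

definition couplings ::
    "'a::euclidean_space measure \<Rightarrow> 'a measure \<Rightarrow> ('a \<times> 'a) measure set" where
  "couplings \<mu> \<nu> =
     {\<pi>. prob_space \<pi> \<and> sets \<pi> = sets (borel \<Otimes>\<^sub>M borel) \<and>
         distr \<pi> borel fst = \<mu> \<and> distr \<pi> borel snd = \<nu>}"

definition wasserstein ::
    "real \<Rightarrow> 'a::euclidean_space measure \<Rightarrow> 'a measure \<Rightarrow> ennreal" where
  "wasserstein p \<mu> \<nu> =
     (INF \<pi>\<in>couplings \<mu> \<nu>. epowr (\<integral>\<^sup>+(x, y). ennreal (norm (x - y) powr p) \<partial>\<pi>) (1 / p))"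

definition sup_moment ::
    "real \<Rightarrow> (real \<Rightarrow> 'a::euclidean_space measure) \<Rightarrow> real \<Rightarrow> ennreal" where
  "sup_moment t\<^sub>0 \<pi> q = max 1 (SUP t\<in>{t\<^sub>0..}. moment (\<pi> t) q)"

text \<open>Expectations of nonnegative random variables are written as nonnegative integrals, so that
  they cannot be zero merely because of a failing integrability condition.\<close>

definition property_A ::
    "'w measure \<Rightarrow> (real \<Rightarrow> 'w \<Rightarrow> 'a::euclidean_space measure) \<Rightarrow> 'a measure \<Rightarrow>
      real \<Rightarrow> (real \<Rightarrow> 'a measure) \<Rightarrow> real \<Rightarrow> real \<Rightarrow> real \<Rightarrow> bool" where
  "property_A M N \<nu> t\<^sub>0 \<pi> \<beta> q \<gamma> \<longleftrightarrow>
     (\<forall>t\<ge>t\<^sub>0. prob_space (\<pi> t) \<and> sets (\<pi> t) = sets borel) \<and>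
     (\<exists>C\<^sub>0>0. \<forall>t\<ge>t\<^sub>0. \<forall>A\<in>sets borel.
        (\<integral>\<^sup>+\<omega>. ennreal \<bar>measure (N t \<omega>) A - measure \<nu> A\<bar> \<partial>M)
          \<le> ennreal (C\<^sub>0 * min (measure (\<pi> t) A) (measure (\<pi> t) A powr \<beta> * t powr (- \<gamma>)))) \<and>
     sup_moment t\<^sub>0 \<pi> q < \<infinity>"

end

theory Submission
  imports Defs
begin

text \<open>Two independent facts combine: correlations of the stationary process decay exponentially,
  and the transport cost between two measures is controlled by the differences of their masses on
  a countable tree of cells.

  For property A, an integrable \<open>e\<close> is at most \<open>1/2\<close> at some positive time, so iterating the variance
  inequality along the semigroup gives \<open>Var (P\<^sub>t f) \<le> 2 exp (- \<theta> t) Var f\<close>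
  (\<open>variance_exponential_decay\<close>). This passage to an exponential is essential: by Cauchy--Schwarz
  the covariance of \<open>f (X\<^sub>s)\<close> and \<open>f (X\<^bsub>s+u\<^esub>)\<close> is bounded by \<open>Var f\<close> times the square root of the decay
  factor, and the square root of an integrable function need not be integrable. Integrating the
  covariances over \<open>[0,t]\<^sup>2\<close> bounds the second moment of \<open>\<nu>\<^sub>t(A) - \<nu>(A)\<close> by a multiple
  of \<open>\<nu>(A) / t\<close>. Together with the trivial first-moment bound \<open>2 \<nu>(A)\<close> this is
  \<open>occupation_property_A\<close>.

  For the transport cost, space is cut into the shells where the norm is about \<open>2\<^sup>n\<close>, and shell \<open>n\<close> into
  about \<open>2\<^bsup>dj\<^esup>\<close> boxes of side \<open>2\<^bsup>n-j\<^esup>\<close> at level \<open>j\<close>. Starting from the finest level, the two measures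
  are matched as far as possible inside each cell and the remainder is passed on to the coarser
  level. Within a cell \<open>F\<close> only the excess of one measure over the other remains, so at most the mass
  \<open>|\<mu>(F) - \<nu>(F)|\<close> leaves a cell of level \<open>j\<close>, at a cost of order \<open>2\<^bsup>p(n-j)\<^esup>\<close> per unit
  (\<open>wasserstein_le_multilevel\<close>). For \<open>\<mu> = \<nu>\<^sub>t\<close>, property A, Cauchy--Schwarz over the boxes of
  a shell and the moment bound \<open>\<nu>(shell n) \<lesssim> 2\<^bsup>-qn\<^esup>\<close> turn the expected cost into a double
  sum with terms \<open>2\<^bsup>-pj\<^esup> 2\<^bsup>-(q-p)n\<^esup> min (1, 2\<^bsup>dj/2\<^esup> 2\<^bsup>qn/2\<^esup> t\<^bsup>-1/2\<^esup>)\<close>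
  (\<open>expected_wasserstein_dyadic\<close>).

  The rates are read off from this sum. Summing over the scales \<open>j\<close> leaves \<open>y\<close> or \<open>y\<^bsup>2p/d\<^esup>\<close>, truncated at 1, with \<open>y = 2\<^bsup>qn/2\<^esup> t\<^bsup>-1/2\<^esup>\<close>,
  according to whether \<open>p > d/2\<close> or \<open>p < d/2\<close>, and the sum over the shells is again of the same kind: it
  is dominated by its first term or by the shell where the truncation sets in, and the latter
  always gives \<open>t\<^bsup>-(1-p/q)\<^esup>\<close>. When \<open>p = d/2\<close> every scale contributes equally up to the
  truncation. If the first shell dominates, this costs a logarithm, since the tree may be cut at the depth of order \<open>log t\<close> at which
  the diameter of the cells reaches the target rate; if it does not, an exponent slightly below
  \<open>2p/d = 1\<close> leads to the same sum over the shells (\<open>dyadic_sum_rate\<close>).\<close>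

section \<open>Multi-level greedy couplings\<close>

text \<open>A partially built coupling of \<open>\<mu>\<close> and \<open>\<nu>\<close>: \<open>w\<close> is the density, with respect to the product
  measure, of the mass matched so far, and \<open>u\<close>, \<open>v\<close> are the unmatched fractions. Working with
  densities makes it possible to add up the plans of several stages, and the mass balance is
  required at every point because the construction provides it there, so that no
  exceptional null sets have to be carried along.\<close>

definition partial_plan ::
  "'a measure \<Rightarrow> 'a measure \<Rightarrow> ('a \<Rightarrow> 'i) \<Rightarrow> ('a \<times> 'a \<Rightarrow> ennreal) \<Rightarrow>
    ('a \<Rightarrow> ennreal) \<Rightarrow> ('a \<Rightarrow> ennreal) \<Rightarrow> bool" where
  "partial_plan \<mu> \<nu> c w u v \<longleftrightarrow>
     w \<in> borel_measurable (\<mu> \<Otimes>\<^sub>M \<nu>) \<and> u \<in> borel_measurable \<mu> \<and> v \<in> borel_measurable \<nu> \<and>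
     (\<forall>x. (\<integral>\<^sup>+y. w (x, y) \<partial>\<nu>) + u x = 1) \<and> (\<forall>y. (\<integral>\<^sup>+x. w (x, y) \<partial>\<mu>) + v y = 1) \<and>
     (\<forall>x y. w (x, y) \<noteq> 0 \<longrightarrow> c x = c y)"

lemma ennreal_ratio_max: fixes a b :: ennreal assumes "a < \<infinity>" "b < \<infinity>" 
  shows "b / max a b \<le> 1" "a * (1 - b / max a b) = a - b"
proof -
  show le: "b / max a b \<le> 1"
  proof (cases "max a b = 0")
    case True
    then have "b = 0" by (auto simp: max_def split: if_splits)
    then show ?thesis by simp
  next
    case False
    then show ?thesis by (intro divide_le_posI_ennreal) (auto simp: zero_less_iff_neq_zero)
  qed
  show "a * (1 - b / max a b) = a - b"
  proof (cases "a \<le> b")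
    case True
    then have mx: "max a b = b" by simp
    show ?thesis
    proof (cases "b = 0")
      case True with \<open>a \<le> b\<close> show ?thesis by simp
    next
      case False
      then have "b / b = 1" using assms by (simp add: ennreal_divide_self)
      then show ?thesis using True mx assms by (simp add: diff_eq_0_ennreal)
    qed
  next
    case False
    then have mx: "max a b = a" "a \<noteq> 0" by (auto simp: max_def)
    then have ab: "a * (b / a) = b" using assms
      by (metis False ennreal_mult_divide_eq ennreal_times_divide less_irrefl infinity_ennreal_def mult.commute)
    moreover have "b/a \<le> 1" using le mx by simp
    ultimately show ?thesis using mx assms
      by (simp add: ennreal_right_diff_distrib)
  qed
qed
lemma ennreal_diff_eq_diffI:
  fixes a b c d :: ennreal
  assumes "a + d = b + c" "a < \<infinity>" "b < \<infinity>" "c < \<infinity>" "d < \<infinity>"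
  shows "a - b = c - d"
proof -
  obtain a' b' c' d' where "a = ennreal a'" "b = ennreal b'" "c = ennreal c'" "d = ennreal d'" "0 \<le> a'" "0 \<le> b'" "0 \<le> c'" "0 \<le> d'"
    using assms(2-5) by (cases a; cases b; cases c; cases d) auto
  moreover from this assms(1) have "a' - b' = c' - d'" by (simp flip: ennreal_plus)
  ultimately show ?thesis by (simp add: ennreal_minus)
qed
text \<open>Inside each cell the leftovers of the two measures are matched by their product, normalised by
  the larger of the two leftover masses. This uses up the side with the smaller mass completely,
  so the other side keeps exactly the excess; truncated subtraction in \<^typ>\<open>ennreal\<close> expresses
  both cases at once. All mass matched earlier stayed inside the cells, so the excess of the
  leftovers is the excess of the original measures. A unit of mass moved
  from \<open>x\<close> to \<open>y\<close> is charged \<open>a x + a y\<close>, which separates the cost into two marginal integrals.\<close>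

lemma greedy_matching_step:
  fixes \<mu> \<nu> :: "'a::topological_space measure" and c :: "'a \<Rightarrow> 'i::countable"
  assumes "prob_space \<mu>" "prob_space \<nu>" 
    and S[measurable_cong]: "sets \<mu> = sets borel" "sets \<nu> = sets borel"
    and c[measurable]: "c \<in> borel \<rightarrow>\<^sub>M count_space UNIV"
    and plan: "partial_plan \<mu> \<nu> c w u v"
    and k[measurable]: "k \<in> borel_measurable (borel \<Otimes>\<^sub>M borel)" 
    and a[measurable]: "a \<in> borel_measurable borel"
    and ka: "\<And>x y. c x = c y \<Longrightarrow> k (x, y) \<le> a x + (a y :: ennreal)"
  obtains w' u' v' where "partial_plan \<mu> \<nu> c w' u' v'"
    "\<And>i. (\<integral>\<^sup>+x. u' x * indicator {x. c x = i} x \<partial>\<mu>) = emeasure \<mu> {x. c x = i} - emeasure \<nu> {x. c x = i}"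
    "\<And>i. (\<integral>\<^sup>+y. v' y * indicator {x. c x = i} y \<partial>\<nu>) = emeasure \<nu> {x. c x = i} - emeasure \<mu> {x. c x = i}"
    "(\<integral>\<^sup>+z. k z * w' z \<partial>(\<mu> \<Otimes>\<^sub>M \<nu>)) \<le> (\<integral>\<^sup>+z. k z * w z \<partial>(\<mu> \<Otimes>\<^sub>M \<nu>)) + (\<integral>\<^sup>+x. a x * u x \<partial>\<mu>) + (\<integral>\<^sup>+y. a y * v y \<partial>\<nu>)"
proof -
  interpret \<mu>: prob_space \<mu> by fact
  interpret \<nu>: prob_space \<nu> by fact
  interpret pair_sigma_finite \<mu> \<nu> ..
  have sp[simp]: "space \<mu> = UNIV" "space \<nu> = UNIV"
    using S sets_eq_imp_space_eq[of _ borel] by auto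
  from plan have [measurable]: "w \<in> borel_measurable (borel \<Otimes>\<^sub>M borel)" "u \<in> borel_measurable borel" "v \<in> borel_measurable borel"
    and W1: "\<And>x. (\<integral>\<^sup>+y. w (x, y) \<partial>\<nu>) + u x = 1" and W2: "\<And>y. (\<integral>\<^sup>+x. w (x, y) \<partial>\<mu>) + v y = 1"
    and W3: "\<And>x y. w (x, y) \<noteq> 0 \<Longrightarrow> c x = c y"
    unfolding partial_plan_def by (auto simp: measurable_cong_sets[OF sets_pair_measure_cong[OF S] refl] measurable_cong_sets[OF S(1) refl] measurable_cong_sets[OF S(2) refl])
  have u1: "u x \<le> 1" for x by (subst W1[of x, symmetric]) (intro add_increasing; simp)
  have v1: "v x \<le> 1" for x by (subst W2[of x, symmetric]) (intro add_increasing; simp)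
  define I where "I i = {x. c x = i}" for i
  have [measurable]: "I i \<in> sets borel" for i unfolding I_def by measurable
  define m where "m i = (\<integral>\<^sup>+x. u x * indicator (I i) x \<partial>\<mu>)" for i
  define n where "n i = (\<integral>\<^sup>+x. v x * indicator (I i) x \<partial>\<nu>)" for i
  have mle: "m i \<le> emeasure \<mu> (I i)" for i
  proof -
    have "m i \<le> (\<integral>\<^sup>+x. 1 * indicator (I i) x \<partial>\<mu>)" unfolding m_def 
      by (intro nn_integral_mono mult_right_mono u1) auto
    then show ?thesis by simp
  qed
  have nle: "n i \<le> emeasure \<nu> (I i)" for i
  proof -
    have "n i \<le> (\<integral>\<^sup>+x. 1 * indicator (I i) x \<partial>\<nu>)" unfolding n_def 
      by (intro nn_integral_mono mult_right_mono v1) auto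
    then show ?thesis by simp
  qed
  have mfin: "m i < \<infinity>" and nfin: "n i < \<infinity>" for i
    using le_less_trans[OF mle[of i], of top] le_less_trans[OF nle[of i], of top] by (simp_all add: less_top[symmetric])
  \<comment> \<open>The mass already matched stays in its cell, hence is removed from both measures equally.\<close>
  have cons: "m i + emeasure \<nu> (I i) = n i + emeasure \<mu> (I i)" for i
  proof -
    have "emeasure \<mu> (I i) = (\<integral>\<^sup>+x. ((\<integral>\<^sup>+y. w (x, y) \<partial>\<nu>) + u x) * indicator (I i) x \<partial>\<mu>)"
      unfolding W1 by simp
    also have "\<dots> = (\<integral>\<^sup>+x. (\<integral>\<^sup>+y. w (x, y) \<partial>\<nu>) * indicator (I i) x + u x * indicator (I i) x \<partial>\<mu>)"
      by (simp add: distrib_right)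
    also have "\<dots> = (\<integral>\<^sup>+x. (\<integral>\<^sup>+y. w (x, y) \<partial>\<nu>) * indicator (I i) x \<partial>\<mu>) + m i"
      unfolding m_def by (intro nn_integral_add) measurable
    also have "(\<integral>\<^sup>+x. (\<integral>\<^sup>+y. w (x, y) \<partial>\<nu>) * indicator (I i) x \<partial>\<mu>) = (\<integral>\<^sup>+x. (\<integral>\<^sup>+y. w (x, y) * indicator (I i) x \<partial>\<nu>) \<partial>\<mu>)"
      by (intro nn_integral_cong nn_integral_multc[symmetric]) measurable
    also have "\<dots> = (\<integral>\<^sup>+x. (\<integral>\<^sup>+y. w (x, y) * indicator (I i) y \<partial>\<nu>) \<partial>\<mu>)"
    proof (intro nn_integral_cong)
      fix x y
      show "w (x,y) * indicator (I i) x = w (x,y) * indicator (I i) y"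
        using W3[of x y] by (cases "w (x,y) = 0") (auto simp: I_def indicator_def)
    qed
    also have "\<dots> = (\<integral>\<^sup>+y. (\<integral>\<^sup>+x. w (x, y) * indicator (I i) y \<partial>\<mu>) \<partial>\<nu>)"
      by (rule Fubini'[symmetric]) measurable
    also have "\<dots> = (\<integral>\<^sup>+y. (\<integral>\<^sup>+x. w (x, y) \<partial>\<mu>) * indicator (I i) y \<partial>\<nu>)"
      by (intro nn_integral_cong nn_integral_multc) measurable
    finally have 1: "emeasure \<mu> (I i) = (\<integral>\<^sup>+y. (\<integral>\<^sup>+x. w (x, y) \<partial>\<mu>) * indicator (I i) y \<partial>\<nu>) + m i" .
    have "emeasure \<nu> (I i) = (\<integral>\<^sup>+y. ((\<integral>\<^sup>+x. w (x, y) \<partial>\<mu>) + v y) * indicator (I i) y \<partial>\<nu>)"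
      unfolding W2 by simp
    also have "\<dots> = (\<integral>\<^sup>+y. (\<integral>\<^sup>+x. w (x, y) \<partial>\<mu>) * indicator (I i) y + v y * indicator (I i) y \<partial>\<nu>)"
      by (simp add: distrib_right)
    also have "\<dots> = (\<integral>\<^sup>+y. (\<integral>\<^sup>+x. w (x, y) \<partial>\<mu>) * indicator (I i) y \<partial>\<nu>) + n i"
      unfolding n_def by (intro nn_integral_add) measurable
    finally have 2: "emeasure \<nu> (I i) = (\<integral>\<^sup>+y. (\<integral>\<^sup>+x. w (x, y) \<partial>\<mu>) * indicator (I i) y \<partial>\<nu>) + n i" .
    show ?thesis unfolding 1 2 by (simp add: ac_simps)
  qed
  have mn: "m i - n i = emeasure \<mu> (I i) - emeasure \<nu> (I i)" "n i - m i = emeasure \<nu> (I i) - emeasure \<mu> (I i)" for i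
  proof -
    show "m i - n i = emeasure \<mu> (I i) - emeasure \<nu> (I i)"
      by (rule ennreal_diff_eq_diffI) (use cons[of i] mfin[of i] nfin[of i] in \<open>auto simp: less_top[symmetric]\<close>)
    show "n i - m i = emeasure \<nu> (I i) - emeasure \<mu> (I i)"
      by (rule ennreal_diff_eq_diffI) (use cons[of i] mfin[of i] nfin[of i] in \<open>auto simp: less_top[symmetric]\<close>)
  qed
  \<comment> \<open>The product matching inside each cell; division gives 0 where both leftovers vanish.\<close>
  define h where "h = (\<lambda>(x, y). u x * v y * indicator (I (c x)) y / max (m (c x)) (n (c x)))"
  define u' where "u' x = u x * (1 - n (c x) / max (m (c x)) (n (c x)))" for x
  define v' where "v' y = v y * (1 - m (c y) / max (n (c y)) (m (c y)))" for y
  have [measurable]: "(\<lambda>x. m (c x)) \<in> borel_measurable borel" "(\<lambda>x. n (c x)) \<in> borel_measurable borel"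
    by (auto intro!: measurable_compose[OF c])
  have eq: "h = (\<lambda>(x, y). u x * v y * (if c x = c y then 1 else 0) / max (m (c x)) (n (c x)))"
    by (auto simp: h_def I_def fun_eq_iff)
  have [measurable]: "h \<in> borel_measurable (borel \<Otimes>\<^sub>M borel)"
    unfolding eq by measurable
  have [measurable]: "u' \<in> borel_measurable borel" "v' \<in> borel_measurable borel"
    unfolding u'_def v'_def by measurable
  have h1: "(\<integral>\<^sup>+y. h (x, y) \<partial>\<nu>) = u x * (n (c x) / max (m (c x)) (n (c x)))" for x
  proof -
    have "(\<integral>\<^sup>+y. h (x, y) \<partial>\<nu>) = (\<integral>\<^sup>+y. u x * ((v y * indicator (I (c x)) y) / max (m (c x)) (n (c x))) \<partial>\<nu>)"
      unfolding h_def by (simp add: ennreal_times_divide mult.assoc)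
    also have "\<dots> = u x * (n (c x) / max (m (c x)) (n (c x)))"
      unfolding n_def by (subst nn_integral_cmult, measurable) (subst nn_integral_divide, measurable)
    finally show ?thesis .
  qed
  have h2: "(\<integral>\<^sup>+x. h (x, y) \<partial>\<mu>) = v y * (m (c y) / max (n (c y)) (m (c y)))" for y
  proof -
    have "(\<integral>\<^sup>+x. h (x, y) \<partial>\<mu>) = (\<integral>\<^sup>+x. v y * ((u x * indicator (I (c y)) x) / max (n (c y)) (m (c y))) \<partial>\<mu>)"
      unfolding h_def by (intro nn_integral_cong) (auto simp add: ennreal_times_divide ac_simps I_def max.commute indicator_def)
    also have "\<dots> = v y * (m (c y) / max (n (c y)) (m (c y)))"
      unfolding m_def by (subst nn_integral_cmult, measurable) (subst nn_integral_divide, measurable)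
    finally show ?thesis .
  qed
  have hu: "(\<integral>\<^sup>+y. h (x, y) \<partial>\<nu>) + u' x = u x" for x
    unfolding h1 u'_def distrib_left[symmetric] using ennreal_ratio_max(1)[OF mfin nfin, of "c x" "c x"]
    by (simp add: add_diff_inverse_ennreal)
  have hv: "(\<integral>\<^sup>+x. h (x, y) \<partial>\<mu>) + v' y = v y" for y
    unfolding h2 v'_def distrib_left[symmetric] using ennreal_ratio_max(1)[OF nfin mfin, of "c y" "c y"]
    by (simp add: add_diff_inverse_ennreal)
  let ?w = "\<lambda>z. w z + h z"
  show thesis
  proof (rule that[of ?w u' v'])
    show "partial_plan \<mu> \<nu> c ?w u' v'"
      unfolding partial_plan_def
    proof (intro conjI allI impI)
      fix x show "(\<integral>\<^sup>+y. w (x, y) + h (x, y) \<partial>\<nu>) + u' x = 1"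
        by (subst nn_integral_add, measurable) (simp add: add.assoc hu W1)
    next
      fix y show "(\<integral>\<^sup>+x. w (x, y) + h (x, y) \<partial>\<mu>) + v' y = 1"
        by (subst nn_integral_add, measurable) (simp add: add.assoc hv W2)
    next
      fix x y assume "w (x, y) + h (x, y) \<noteq> 0"
      then show "c x = c y" using W3[of x y] by (cases "c x = c y") (auto simp: eq)
    qed measurable
    fix i
    have "(\<integral>\<^sup>+x. u' x * indicator {x. c x = i} x \<partial>\<mu>) = (\<integral>\<^sup>+x. (u x * indicator (I i) x) * (1 - n i / max (m i) (n i)) \<partial>\<mu>)"
      unfolding u'_def by (intro nn_integral_cong) (auto simp: I_def indicator_def)
    also have "\<dots> = m i * (1 - n i / max (m i) (n i))"
      unfolding m_def by (intro nn_integral_multc) measurable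
    also have "\<dots> = m i - n i" by (rule ennreal_ratio_max(2)[OF mfin nfin])
    finally show "(\<integral>\<^sup>+x. u' x * indicator {x. c x = i} x \<partial>\<mu>) = emeasure \<mu> {x. c x = i} - emeasure \<nu> {x. c x = i}"
      unfolding mn I_def .
    have "(\<integral>\<^sup>+x. v' x * indicator {x. c x = i} x \<partial>\<nu>) = (\<integral>\<^sup>+x. (v x * indicator (I i) x) * (1 - m i / max (n i) (m i)) \<partial>\<nu>)"
      unfolding v'_def by (intro nn_integral_cong) (auto simp: I_def indicator_def)
    also have "\<dots> = n i * (1 - m i / max (n i) (m i))"
      unfolding n_def by (intro nn_integral_multc) measurable
    also have "\<dots> = n i - m i" by (rule ennreal_ratio_max(2)[OF nfin mfin])
    finally show "(\<integral>\<^sup>+x. v' x * indicator {x. c x = i} x \<partial>\<nu>) = emeasure \<nu> {x. c x = i} - emeasure \<mu> {x. c x = i}"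
      unfolding mn I_def .
  next
    have "(\<integral>\<^sup>+z. k z * h z \<partial>(\<mu> \<Otimes>\<^sub>M \<nu>)) \<le> (\<integral>\<^sup>+z. a (fst z) * h z + a (snd z) * h z \<partial>(\<mu> \<Otimes>\<^sub>M \<nu>))"
    proof (intro nn_integral_mono)
      fix z :: "'a \<times> 'a"
      obtain x y where z: "z = (x, y)" by (cases z)
      show "k z * h z \<le> a (fst z) * h z + a (snd z) * h z"
      proof (cases "c x = c y")
        case True
        then show ?thesis unfolding z fst_conv snd_conv distrib_right[symmetric] by (intro mult_right_mono ka) auto
      qed (auto simp: eq z)
    qed
    also have "\<dots> = (\<integral>\<^sup>+z. a (fst z) * h z \<partial>(\<mu> \<Otimes>\<^sub>M \<nu>)) + (\<integral>\<^sup>+z. a (snd z) * h z \<partial>(\<mu> \<Otimes>\<^sub>M \<nu>))"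
      by (intro nn_integral_add) measurable
    also have "(\<integral>\<^sup>+z. a (fst z) * h z \<partial>(\<mu> \<Otimes>\<^sub>M \<nu>)) = (\<integral>\<^sup>+x. \<integral>\<^sup>+y. a x * h (x, y) \<partial>\<nu> \<partial>\<mu>)"
      by (subst \<nu>.nn_integral_fst[symmetric]) (auto, measurable)
    also have "\<dots> = (\<integral>\<^sup>+x. a x * (\<integral>\<^sup>+y. h (x, y) \<partial>\<nu>) \<partial>\<mu>)"
      by (intro nn_integral_cong nn_integral_cmult) measurable
    also have "\<dots> \<le> (\<integral>\<^sup>+x. a x * u x \<partial>\<mu>)"
      by (intro nn_integral_mono mult_left_mono) (auto simp: hu[symmetric])
    also have "(\<integral>\<^sup>+z. a (snd z) * h z \<partial>(\<mu> \<Otimes>\<^sub>M \<nu>)) = (\<integral>\<^sup>+y. \<integral>\<^sup>+x. a y * h (x, y) \<partial>\<mu> \<partial>\<nu>)"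
      by (subst nn_integral_snd[symmetric]) (auto, measurable)
    also have "\<dots> = (\<integral>\<^sup>+y. a y * (\<integral>\<^sup>+x. h (x, y) \<partial>\<mu>) \<partial>\<nu>)"
      by (intro nn_integral_cong nn_integral_cmult) measurable
    also have "\<dots> \<le> (\<integral>\<^sup>+y. a y * v y \<partial>\<nu>)"
      by (intro nn_integral_mono mult_left_mono) (auto simp: hv[symmetric])
    finally have "(\<integral>\<^sup>+z. k z * h z \<partial>(\<mu> \<Otimes>\<^sub>M \<nu>)) \<le> (\<integral>\<^sup>+x. a x * u x \<partial>\<mu>) + (\<integral>\<^sup>+y. a y * v y \<partial>\<nu>)"
      by (simp add: add_mono)
    moreover have "(\<integral>\<^sup>+z. k z * ?w z \<partial>(\<mu> \<Otimes>\<^sub>M \<nu>)) = (\<integral>\<^sup>+z. k z * w z \<partial>(\<mu> \<Otimes>\<^sub>M \<nu>)) + (\<integral>\<^sup>+z. k z * h z \<partial>(\<mu> \<Otimes>\<^sub>M \<nu>))"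
      unfolding distrib_left by (intro nn_integral_add) measurable
    ultimately show "(\<integral>\<^sup>+z. k z * ?w z \<partial>(\<mu> \<Otimes>\<^sub>M \<nu>)) \<le> (\<integral>\<^sup>+z. k z * w z \<partial>(\<mu> \<Otimes>\<^sub>M \<nu>)) + (\<integral>\<^sup>+x. a x * u x \<partial>\<mu>) + (\<integral>\<^sup>+y. a y * v y \<partial>\<nu>)"
      by (simp add: add.assoc)
  qed
qed


lemma nn_integral_countable_partition:
  fixes c :: "'a \<Rightarrow> 'i::countable"
  assumes [measurable]: "c \<in> M \<rightarrow>\<^sub>M count_space UNIV" "u \<in> borel_measurable M"
  shows "(\<integral>\<^sup>+x. \<alpha> (c x) * u x \<partial>M) = (\<integral>\<^sup>+i. \<alpha> i * (\<integral>\<^sup>+x. u x * indicator {x. c x = i} x \<partial>M) \<partial>count_space UNIV)"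
proof -
  have m[measurable]: "(\<lambda>x. indicator {x. c x = i} x :: ennreal) \<in> borel_measurable M" for i
    unfolding indicator_def by measurable
  have "(\<integral>\<^sup>+x. \<alpha> (c x) * u x \<partial>M) = (\<integral>\<^sup>+x. (\<integral>\<^sup>+i. \<alpha> i * (u x * indicator {x. c x = i} x) \<partial>count_space UNIV) \<partial>M)"
  proof (intro nn_integral_cong)
    fix x
    have "(\<integral>\<^sup>+i. \<alpha> i * (u x * indicator {x. c x = i} x) \<partial>count_space UNIV) = (\<integral>\<^sup>+i. (\<alpha> (c x) * u x) * indicator {c x} i \<partial>count_space UNIV)"
      by (intro nn_integral_cong) (auto simp: indicator_def)
    also have "\<dots> = \<alpha> (c x) * u x"
      by (subst nn_integral_cmult_indicator) auto
    finally show "\<alpha> (c x) * u x = (\<integral>\<^sup>+i. \<alpha> i * (u x * indicator {x. c x = i} x) \<partial>count_space UNIV)" ..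
  qed
  also have "\<dots> = (\<integral>\<^sup>+i. (\<integral>\<^sup>+x. \<alpha> i * (u x * indicator {x. c x = i} x) \<partial>M) \<partial>count_space UNIV)"
    by (rule nn_integral_count_space_nn_integral) (auto, measurable)
  also have "\<dots> = (\<integral>\<^sup>+i. \<alpha> i * (\<integral>\<^sup>+x. u x * indicator {x. c x = i} x \<partial>M) \<partial>count_space UNIV)"
    by (intro nn_integral_cong nn_integral_cmult) measurable
  finally show ?thesis .
qed

text \<open>Matching level by level, from \<open>L\<close> down to \<open>l\<close>. At level \<open>L\<close> all the mass has to be charged; at
  a coarser level \<open>j\<close> only what the finer level left over is moved, which is the mass difference
  in each cell of level \<open>Suc j\<close>. The charge \<open>\<alpha> j\<close> is a function of the finer cell, because the
  leftovers are known only cell by cell.\<close>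

lemma multilevel_plan:
  fixes \<mu> \<nu> :: "'a::topological_space measure" and c :: "nat \<Rightarrow> 'a \<Rightarrow> 'i::countable"
  assumes "prob_space \<mu>" "prob_space \<nu>" 
    and S[measurable_cong]: "sets \<mu> = sets borel" "sets \<nu> = sets borel"
    and c[measurable]: "\<And>l. c l \<in> borel \<rightarrow>\<^sub>M count_space UNIV"
    and nested: "\<And>l x y. c (Suc l) x = c (Suc l) y \<Longrightarrow> c l x = c l y"
    and k[measurable]: "k \<in> borel_measurable (borel \<Otimes>\<^sub>M borel)" 
    and kc: "\<And>l x y. c l x = c l y \<Longrightarrow> k (x, y) \<le> \<alpha> l (c (Suc l) x) + (\<alpha> l (c (Suc l) y) :: ennreal)"
    and "l \<le> L"
  shows "\<exists>w u v. partial_plan \<mu> \<nu> (c l) w u v \<and>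
    (\<forall>i. (\<integral>\<^sup>+x. u x * indicator {x. c l x = i} x \<partial>\<mu>) = emeasure \<mu> {x. c l x = i} - emeasure \<nu> {x. c l x = i}) \<and>
    (\<forall>i. (\<integral>\<^sup>+y. v y * indicator {x. c l x = i} y \<partial>\<nu>) = emeasure \<nu> {x. c l x = i} - emeasure \<mu> {x. c l x = i}) \<and>
    (\<integral>\<^sup>+z. k z * w z \<partial>(\<mu> \<Otimes>\<^sub>M \<nu>)) \<le> 
      (\<integral>\<^sup>+i. \<alpha> L i * (emeasure \<mu> {x. c (Suc L) x = i} + emeasure \<nu> {x. c (Suc L) x = i}) \<partial>count_space UNIV) +
      (\<Sum>j\<in>{l..<L}. \<integral>\<^sup>+i. \<alpha> j i * ennreal \<bar>measure \<mu> {x. c (Suc j) x = i} - measure \<nu> {x. c (Suc j) x = i}\<bar> \<partial>count_space UNIV)"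
  using \<open>l \<le> L\<close>
proof (induction rule: inc_induct)
  interpret \<mu>: prob_space \<mu> by fact
  interpret \<nu>: prob_space \<nu> by fact
  have sp[simp]: "space \<mu> = UNIV" "space \<nu> = UNIV"
    using S sets_eq_imp_space_eq[of _ borel] by auto
  have [measurable]: "(\<lambda>x. \<alpha> l (c j x)) \<in> borel_measurable borel" for l j
    by (rule measurable_compose[OF c]) simp
  have cm: "c l \<in> \<mu> \<rightarrow>\<^sub>M count_space UNIV" "c l \<in> \<nu> \<rightarrow>\<^sub>M count_space UNIV" for l
    by measurable
  {
    case base
    have "partial_plan \<mu> \<nu> (c L) (\<lambda>_. 0) (\<lambda>_. 1) (\<lambda>_. 1)"
      unfolding partial_plan_def by auto
    note plan = this
    obtain w u v where *: "partial_plan \<mu> \<nu> (c L) w u v"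
     "\<And>i. (\<integral>\<^sup>+x. u x * indicator {x. c L x = i} x \<partial>\<mu>) = emeasure \<mu> {x. c L x = i} - emeasure \<nu> {x. c L x = i}"
     "\<And>i. (\<integral>\<^sup>+y. v y * indicator {x. c L x = i} y \<partial>\<nu>) = emeasure \<nu> {x. c L x = i} - emeasure \<mu> {x. c L x = i}"
     "(\<integral>\<^sup>+z. k z * w z \<partial>(\<mu> \<Otimes>\<^sub>M \<nu>)) \<le> (\<integral>\<^sup>+x. \<alpha> L (c (Suc L) x) * 1 \<partial>\<mu>) + (\<integral>\<^sup>+y. \<alpha> L (c (Suc L) y) * 1 \<partial>\<nu>)"
      by (rule greedy_matching_step[OF assms(1,2) S c plan k, of "\<lambda>x. \<alpha> L (c (Suc L) x)"])
         (measurable, (erule kc), rule that, simp_all)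
    have I[measurable]: "{x. c l x = i} \<in> sets borel" for i l by measurable
    have "(\<integral>\<^sup>+x. \<alpha> L (c (Suc L) x) * 1 \<partial>\<mu>) + (\<integral>\<^sup>+y. \<alpha> L (c (Suc L) y) * 1 \<partial>\<nu>)
        = (\<integral>\<^sup>+i. \<alpha> L i * (emeasure \<mu> {x. c (Suc L) x = i} + emeasure \<nu> {x. c (Suc L) x = i}) \<partial>count_space UNIV)"
      unfolding nn_integral_countable_partition[OF cm(1) borel_measurable_const] nn_integral_countable_partition[OF cm(2) borel_measurable_const]
      by (simp add: distrib_left nn_integral_add)
    with * show ?case by auto
  next
    case (step l)
    then obtain w u v where *: "partial_plan \<mu> \<nu> (c (Suc l)) w u v"
     and 2: "\<And>i. (\<integral>\<^sup>+x. u x * indicator {x. c (Suc l) x = i} x \<partial>\<mu>) = emeasure \<mu> {x. c (Suc l) x = i} - emeasure \<nu> {x. c (Suc l) x = i}"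
     and 3: "\<And>i. (\<integral>\<^sup>+y. v y * indicator {x. c (Suc l) x = i} y \<partial>\<nu>) = emeasure \<nu> {x. c (Suc l) x = i} - emeasure \<mu> {x. c (Suc l) x = i}"
     and 4: "(\<integral>\<^sup>+z. k z * w z \<partial>(\<mu> \<Otimes>\<^sub>M \<nu>)) \<le> 
      (\<integral>\<^sup>+i. \<alpha> L i * (emeasure \<mu> {x. c (Suc L) x = i} + emeasure \<nu> {x. c (Suc L) x = i}) \<partial>count_space UNIV) +
      (\<Sum>j\<in>{Suc l..<L}. \<integral>\<^sup>+i. \<alpha> j i * ennreal \<bar>measure \<mu> {x. c (Suc j) x = i} - measure \<nu> {x. c (Suc j) x = i}\<bar> \<partial>count_space UNIV)" (is "_ \<le> ?A + ?B")
      by blast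
    have um: "u \<in> borel_measurable \<mu>" "v \<in> borel_measurable \<nu>"
      using * by (auto simp: partial_plan_def)
    from * have plan: "partial_plan \<mu> \<nu> (c l) w u v"
      using nested unfolding partial_plan_def by blast
    obtain w' u' v' where **: "partial_plan \<mu> \<nu> (c l) w' u' v'"
     "\<And>i. (\<integral>\<^sup>+x. u' x * indicator {x. c l x = i} x \<partial>\<mu>) = emeasure \<mu> {x. c l x = i} - emeasure \<nu> {x. c l x = i}"
     "\<And>i. (\<integral>\<^sup>+y. v' y * indicator {x. c l x = i} y \<partial>\<nu>) = emeasure \<nu> {x. c l x = i} - emeasure \<mu> {x. c l x = i}"
     and le: "(\<integral>\<^sup>+z. k z * w' z \<partial>(\<mu> \<Otimes>\<^sub>M \<nu>)) \<le> (\<integral>\<^sup>+z. k z * w z \<partial>(\<mu> \<Otimes>\<^sub>M \<nu>)) + 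
        (\<integral>\<^sup>+x. \<alpha> l (c (Suc l) x) * u x \<partial>\<mu>) + (\<integral>\<^sup>+y. \<alpha> l (c (Suc l) y) * v y \<partial>\<nu>)"
      by (rule greedy_matching_step[OF assms(1,2) S c plan k, of "\<lambda>x. \<alpha> l (c (Suc l) x)"])
         (measurable, (erule kc), (rule that))
    have "(\<integral>\<^sup>+x. \<alpha> l (c (Suc l) x) * u x \<partial>\<mu>) + (\<integral>\<^sup>+y. \<alpha> l (c (Suc l) y) * v y \<partial>\<nu>)
      = (\<integral>\<^sup>+i. \<alpha> l i * ((emeasure \<mu> {x. c (Suc l) x = i} - emeasure \<nu> {x. c (Suc l) x = i}) +
           (emeasure \<nu> {x. c (Suc l) x = i} - emeasure \<mu> {x. c (Suc l) x = i})) \<partial>count_space UNIV)"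
      unfolding nn_integral_countable_partition[OF cm(1) um(1)] nn_integral_countable_partition[OF cm(2) um(2)] 2 3
      by (simp add: distrib_left nn_integral_add)
    also have "\<dots> = (\<integral>\<^sup>+i. \<alpha> l i * ennreal \<bar>measure \<mu> {x. c (Suc l) x = i} - measure \<nu> {x. c (Suc l) x = i}\<bar> \<partial>count_space UNIV)" (is "_ = ?C")
    proof (intro nn_integral_cong arg_cong2[where f="(*)"] refl)
      fix i
      show "emeasure \<mu> {x. c (Suc l) x = i} - emeasure \<nu> {x. c (Suc l) x = i} +
           (emeasure \<nu> {x. c (Suc l) x = i} - emeasure \<mu> {x. c (Suc l) x = i}) =
           ennreal \<bar>measure \<mu> {x. c (Suc l) x = i} - measure \<nu> {x. c (Suc l) x = i}\<bar>"
        unfolding \<mu>.emeasure_eq_measure \<nu>.emeasure_eq_measure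
        by (cases "measure \<mu> {x. c (Suc l) x = i} \<le> measure \<nu> {x. c (Suc l) x = i}")
           (auto simp: ennreal_minus ennreal_neg)
    qed
    finally have "(\<integral>\<^sup>+x. \<alpha> l (c (Suc l) x) * u x \<partial>\<mu>) + (\<integral>\<^sup>+y. \<alpha> l (c (Suc l) y) * v y \<partial>\<nu>) = ?C" .
    with le have "(\<integral>\<^sup>+z. k z * w' z \<partial>(\<mu> \<Otimes>\<^sub>M \<nu>)) \<le> (\<integral>\<^sup>+z. k z * w z \<partial>(\<mu> \<Otimes>\<^sub>M \<nu>)) + ?C"
      by (simp add: add.assoc)
    also have "\<dots> \<le> ?A + ?B + ?C" using 4 by (rule add_right_mono)
    also have "?B + ?C = (\<Sum>j\<in>{l..<L}. \<integral>\<^sup>+i. \<alpha> j i * ennreal \<bar>measure \<mu> {x. c (Suc j) x = i} - measure \<nu> {x. c (Suc j) x = i}\<bar> \<partial>count_space UNIV)"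
      using step(2) by (simp add: sum.atLeast_Suc_lessThan add.commute)
    then have "?A + ?B + ?C = ?A + (\<Sum>j\<in>{l..<L}. \<integral>\<^sup>+i. \<alpha> j i * ennreal \<bar>measure \<mu> {x. c (Suc j) x = i} - measure \<nu> {x. c (Suc j) x = i}\<bar> \<partial>count_space UNIV)"
      by (simp only: add.assoc)
    finally show ?case using ** by blast
  }
qed


text \<open>An upper bound needs just one coupling: no optimal plan has to exist.\<close>

lemma epowr_wasserstein_le:
  assumes "\<pi> \<in> couplings \<mu> \<nu>" "p > 0"
  shows "epowr (wasserstein p \<mu> \<nu>) p \<le> (\<integral>\<^sup>+(x, y). ennreal (norm (x - y) powr p) \<partial>\<pi>)" (is "_ \<le> ?I")
proof -
  have mono: "epowr x p \<le> epowr y p" if "x \<le> y" for x y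
    using that assms(2) unfolding epowr_def
    by (auto intro!: ennreal_leI powr_mono2 enn2real_mono simp: top_unique less_top[symmetric])
  have inv: "epowr (epowr x (1 / p)) p = x" for x
    using assms(2) unfolding epowr_def by (cases x) (auto simp: powr_powr)
  have "wasserstein p \<mu> \<nu> \<le> epowr ?I (1 / p)"
    unfolding wasserstein_def by (rule INF_lower) fact
  then have "epowr (wasserstein p \<mu> \<nu>) p \<le> epowr (epowr ?I (1 / p)) p" by (rule mono)
  then show ?thesis unfolding inv .
qed

lemma coupling_of_total_plan:
  fixes \<mu> \<nu> :: "'a::euclidean_space measure"
  assumes "prob_space \<mu>" "prob_space \<nu>" 
    and S[measurable_cong]: "sets \<mu> = sets borel" "sets \<nu> = sets borel"
    and plan: "partial_plan \<mu> \<nu> c w u v"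
    and u0: "(\<integral>\<^sup>+x. u x \<partial>\<mu>) = 0" and v0: "(\<integral>\<^sup>+x. v x \<partial>\<nu>) = 0"
  shows "density (\<mu> \<Otimes>\<^sub>M \<nu>) w \<in> couplings \<mu> \<nu>"
proof -
  interpret \<mu>: prob_space \<mu> by fact
  interpret \<nu>: prob_space \<nu> by fact
  interpret pair_sigma_finite \<mu> \<nu> ..
  have sp[simp]: "space \<mu> = UNIV" "space \<nu> = UNIV"
    using S sets_eq_imp_space_eq[of _ borel] by auto
  from plan have [measurable]: "w \<in> borel_measurable (\<mu> \<Otimes>\<^sub>M \<nu>)" "u \<in> borel_measurable \<mu>" "v \<in> borel_measurable \<nu>"
    and W1: "\<And>x. (\<integral>\<^sup>+y. w (x, y) \<partial>\<nu>) + u x = 1" and W2: "\<And>y. (\<integral>\<^sup>+x. w (x, y) \<partial>\<mu>) + v y = 1"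
    unfolding partial_plan_def by auto
  have "AE x in \<mu>. u x = 0" using u0 by (simp add: nn_integral_0_iff_AE)
  then have W1': "AE x in \<mu>. (\<integral>\<^sup>+y. w (x, y) \<partial>\<nu>) = 1"
    by eventually_elim (metis W1 add.right_neutral)
  have "AE x in \<nu>. v x = 0" using v0 by (simp add: nn_integral_0_iff_AE)
  then have W2': "AE y in \<nu>. (\<integral>\<^sup>+x. w (x, y) \<partial>\<mu>) = 1"
    by eventually_elim (metis W2 add.right_neutral)
  let ?\<pi> = "density (\<mu> \<Otimes>\<^sub>M \<nu>) w"
  have 1: "distr ?\<pi> borel fst = \<mu>"
  proof (rule measure_eqI)
    fix A assume "A \<in> sets (distr ?\<pi> borel fst)"
    then have [measurable]: "A \<in> sets borel" by simp
    have "emeasure (distr ?\<pi> borel fst) A = (\<integral>\<^sup>+z. w z * indicator A (fst z) \<partial>(\<mu> \<Otimes>\<^sub>M \<nu>))"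
      by (subst emeasure_distr, measurable, subst emeasure_density, measurable)
         (auto intro!: nn_integral_cong simp: indicator_def space_pair_measure)
    also have "\<dots> = (\<integral>\<^sup>+x. \<integral>\<^sup>+y. w (x, y) * indicator A x \<partial>\<nu> \<partial>\<mu>)"
      by (subst \<nu>.nn_integral_fst[symmetric]) auto
    also have "\<dots> = (\<integral>\<^sup>+x. (\<integral>\<^sup>+y. w (x, y) \<partial>\<nu>) * indicator A x \<partial>\<mu>)"
      by (intro nn_integral_cong nn_integral_multc) measurable
    also have "\<dots> = (\<integral>\<^sup>+x. indicator A x \<partial>\<mu>)"
      by (rule nn_integral_cong_AE) (use W1' in eventually_elim, simp)
    finally show "emeasure (distr ?\<pi> borel fst) A = emeasure \<mu> A" by simp
  qed (simp add: S)
  have 2: "distr ?\<pi> borel snd = \<nu>"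
  proof (rule measure_eqI)
    fix A assume "A \<in> sets (distr ?\<pi> borel snd)"
    then have [measurable]: "A \<in> sets borel" by simp
    have "emeasure (distr ?\<pi> borel snd) A = (\<integral>\<^sup>+z. w z * indicator A (snd z) \<partial>(\<mu> \<Otimes>\<^sub>M \<nu>))"
      by (subst emeasure_distr, measurable, subst emeasure_density, measurable)
         (auto intro!: nn_integral_cong simp: indicator_def space_pair_measure)
    also have "\<dots> = (\<integral>\<^sup>+y. \<integral>\<^sup>+x. w (x, y) * indicator A y \<partial>\<mu> \<partial>\<nu>)"
      by (subst nn_integral_snd[symmetric]) auto
    also have "\<dots> = (\<integral>\<^sup>+y. (\<integral>\<^sup>+x. w (x, y) \<partial>\<mu>) * indicator A y \<partial>\<nu>)"
      by (intro nn_integral_cong nn_integral_multc) measurable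
    also have "\<dots> = (\<integral>\<^sup>+y. indicator A y \<partial>\<nu>)"
      by (rule nn_integral_cong_AE) (use W2' in eventually_elim, simp)
    finally show "emeasure (distr ?\<pi> borel snd) A = emeasure \<nu> A" by simp
  qed (simp add: S)
  have "emeasure (distr ?\<pi> borel fst) UNIV = 1" unfolding 1 using \<mu>.emeasure_space_1 by simp
  then have "emeasure ?\<pi> (space ?\<pi>) = 1"
    by (subst (asm) emeasure_distr) (auto simp: space_pair_measure)
  then have "prob_space ?\<pi>" by (rule prob_spaceI)
  moreover have "sets ?\<pi> = sets (borel \<Otimes>\<^sub>M borel)"
    by (simp add: sets_pair_measure_cong[OF S])
  ultimately show ?thesis using 1 2 unfolding couplings_def by simp
qed

text \<open>With a single cell at level 0 the excess of either probability measure over the other in that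
  cell is zero, so the plan is complete there and is a coupling.\<close>

lemma wasserstein_le_multilevel:
  fixes \<mu> \<nu> :: "'a::euclidean_space measure" and c :: "nat \<Rightarrow> 'a \<Rightarrow> 'i::countable"
  assumes "prob_space \<mu>" "prob_space \<nu>" 
    and S[measurable_cong]: "sets \<mu> = sets borel" "sets \<nu> = sets borel"
    and c[measurable]: "\<And>l. c l \<in> borel \<rightarrow>\<^sub>M count_space UNIV"
    and nested: "\<And>l x y. c (Suc l) x = c (Suc l) y \<Longrightarrow> c l x = c l y"
    and root: "\<And>x y. c 0 x = c 0 y"
    and "p > 0"
    and kc: "\<And>l x y. c l x = c l y \<Longrightarrow> ennreal (norm (x - y) powr p) \<le> \<alpha> l (c (Suc l) x) + \<alpha> l (c (Suc l) y)"
  shows "epowr (wasserstein p \<mu> \<nu>) p \<le> 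
      (\<integral>\<^sup>+i. \<alpha> L i * (emeasure \<mu> {x. c (Suc L) x = i} + emeasure \<nu> {x. c (Suc L) x = i}) \<partial>count_space UNIV) +
      (\<Sum>j<L. \<integral>\<^sup>+i. \<alpha> j i * ennreal \<bar>measure \<mu> {x. c (Suc j) x = i} - measure \<nu> {x. c (Suc j) x = i}\<bar> \<partial>count_space UNIV)"
    (is "_ \<le> ?R")
proof -
  let ?k = "\<lambda>z::'a\<times>'a. ennreal (norm (fst z - snd z) powr p)"
  have sp[simp]: "space \<mu> = UNIV" "space \<nu> = UNIV"
    using S sets_eq_imp_space_eq[of _ borel] by auto
  have k: "?k \<in> borel_measurable (borel \<Otimes>\<^sub>M borel)" by measurable
  have kc': "?k (x, y) \<le> \<alpha> l (c (Suc l) x) + \<alpha> l (c (Suc l) y)" if "c l x = c l y" for l x y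
    using kc[OF that] by simp
  obtain w u v where *: "partial_plan \<mu> \<nu> (c 0) w u v"
    and u: "\<And>i. (\<integral>\<^sup>+x. u x * indicator {x. c 0 x = i} x \<partial>\<mu>) = emeasure \<mu> {x. c 0 x = i} - emeasure \<nu> {x. c 0 x = i}"
    and v: "\<And>i. (\<integral>\<^sup>+y. v y * indicator {x. c 0 x = i} y \<partial>\<nu>) = emeasure \<nu> {x. c 0 x = i} - emeasure \<mu> {x. c 0 x = i}"
    and le: "(\<integral>\<^sup>+z. ?k z * w z \<partial>(\<mu> \<Otimes>\<^sub>M \<nu>)) \<le> ?R"
    using multilevel_plan[where k="?k" and \<alpha>=\<alpha> and c=c and l=0 and L=L, OF assms(1,2) S c nested k kc'] unfolding atLeast0LessThan by blast
  have UN: "{x. c 0 x = c 0 undefined} = UNIV" using root by auto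
  have one: "emeasure \<mu> UNIV = 1" "emeasure \<nu> UNIV = 1"
    using prob_space.emeasure_space_1[OF assms(1)] prob_space.emeasure_space_1[OF assms(2)] by auto
  have "density (\<mu> \<Otimes>\<^sub>M \<nu>) w \<in> couplings \<mu> \<nu>"
    by (rule coupling_of_total_plan[OF assms(1,2) S *])
       (use u[of "c 0 undefined"] v[of "c 0 undefined"] in \<open>simp_all add: UN one\<close>)
  note epowr_wasserstein_le[OF this \<open>p > 0\<close>]
  also have "(\<integral>\<^sup>+(x, y). ennreal (norm (x - y) powr p) \<partial>density (\<mu> \<Otimes>\<^sub>M \<nu>) w) = (\<integral>\<^sup>+z. ?k z * w z \<partial>(\<mu> \<Otimes>\<^sub>M \<nu>))"
  proof -
    have [measurable]: "w \<in> borel_measurable (\<mu> \<Otimes>\<^sub>M \<nu>)" using * by (simp add: partial_plan_def)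
    show ?thesis
      by (subst nn_integral_density) (auto simp: case_prod_beta mult.commute)
  qed
  finally show ?thesis using le by (rule order_trans)
qed

section \<open>Sums over shells and dyadic scales\<close>

lemma one_less_two_powr: "a > 0 \<Longrightarrow> 1 < (2::real) powr a"
  using powr_less_mono[of 0 a "2::real"] by simp

lemma two_powr_less_one: "a < 0 \<Longrightarrow> (2::real) powr a < 1"
  using powr_less_mono[of a 0 "2::real"] by simp

lemma geometric_sum_le:
  fixes r :: real assumes "0 \<le> r" "r < 1" shows "(\<Sum>n<N. r ^ n) \<le> 1 / (1 - r)"
proof -
  have "(\<Sum>n<N. r ^ n) = (1 - r ^ N) / (1 - r)" using assms by (simp add: sum_gp_strict)
  also have "\<dots> \<le> 1 / (1 - r)" using assms by (intro divide_right_mono) auto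
  finally show ?thesis .
qed

lemma truncated_geometric_linear:
  fixes x z y :: real
  assumes "0 \<le> x" "0 \<le> z" "x * z < 1" "0 \<le> y"
  shows "(\<Sum>n<N. x ^ n * min 1 (z ^ n * y)) \<le> y / (1 - x * z)"
proof -
  have "(\<Sum>n<N. x ^ n * min 1 (z ^ n * y)) \<le> (\<Sum>n<N. (x * z) ^ n * y)"
    by (intro sum_mono) (use assms in \<open>auto simp: power_mult_distrib mult.assoc intro!: mult_left_mono\<close>)
  also have "\<dots> = (\<Sum>n<N. (x * z) ^ n) * y" by (simp add: sum_distrib_right)
  also have "\<dots> \<le> 1 / (1 - x * z) * y"
    by (intro mult_right_mono geometric_sum_le) (use assms in auto)
  finally show ?thesis by simp
qed

lemma truncated_geometric_bounded:
  fixes x z y :: real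
  assumes "0 \<le> x" "x < 1"
  shows "(\<Sum>n<N. x ^ n * min 1 (z ^ n * y)) \<le> 1 / (1 - x)"
proof -
  have "(\<Sum>n<N. x ^ n * min 1 (z ^ n * y)) \<le> (\<Sum>n<N. x ^ n * 1)"
    by (intro sum_mono mult_left_mono) (use assms in auto)
  also have "\<dots> \<le> 1 / (1 - x)" using geometric_sum_le[OF assms] by simp
  finally show ?thesis .
qed

text \<open>Terms with \<open>z ^ n * y \<le> 1\<close> grow geometrically, later ones decay geometrically, so the sum is of the
  size of the term at the turning point, where \<open>x ^ n = y powr \<theta>\<close>. A proof by induction avoids
  locating that point: the sum satisfies \<open>H (Suc N) y = min 1 y + x * H N (z * y)\<close>.
  The bound \<open>C * y powr \<theta>\<close> reproduces itself exactly under \<open>y \<mapsto> z * y\<close>, which leaves no room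
  for the summand \<open>min 1 y\<close>; subtracting \<open>D * y\<close> creates that room, since \<open>x * z > 1\<close>.\<close>

lemma truncated_geometric_interpolated:
  fixes x z \<theta> :: real
  assumes "0 < x" "x < 1" "1 < z" "1 < x * z" and \<theta>: "x * z powr \<theta> = 1" "\<theta> > 0"
  shows "\<exists>C>0. \<forall>y>0. \<forall>N. (\<Sum>n<N. x ^ n * min 1 (z ^ n * y)) \<le> C * y powr \<theta>"
proof -
  \<comment> \<open>Chosen so that \<open>1 + D = D * x * z\<close>, which absorbs the new summand in the induction step.\<close>
  define D where "D = 1 / (x * z - 1)"
  define C0 where "C0 = 1 / (1 - x)"
  define C where "C = (C0 + D) / x"
  have pos: "D > 0" "C0 > 0" "C > 0" using assms by (auto simp: D_def C0_def C_def add_pos_pos)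
  have CC: "C0 + D \<le> C" unfolding C_def using assms pos mult_left_le[of x "C0 + D"] by (simp add: pos_le_divide_eq)
  have xz: "x * C * z powr \<theta> = C" using \<theta>(1) by (simp add: ac_simps)
  define H where "H N y = (\<Sum>n<N. x ^ n * min 1 (z ^ n * y))" for N y
  have HS: "H (Suc N) y = min 1 y + x * H N (z * y)" for N y
    unfolding H_def by (subst sum.lessThan_Suc_shift) (simp add: sum_distrib_left ac_simps)
  have H0: "H N y \<le> C0" for N y unfolding H_def C0_def using truncated_geometric_bounded assms by simp
  have small: "H N y \<le> C * y powr \<theta> - D * y" if "0 < y" "y \<le> 1" for N y
    using that
  proof (induction N arbitrary: y)
    case 0
    have th1: "\<theta> < 1"
    proof (rule ccontr)
      assume "\<not> \<theta> < 1"
      then have "z powr 1 \<le> z powr \<theta>" using assms by (intro powr_mono) auto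
      then have "x * z \<le> x * z powr \<theta>" using assms(1,3) by (intro mult_left_mono) auto
      then show False using assms(4) \<theta>(1) by linarith
    qed
    then have "y powr 1 \<le> y powr \<theta>" using 0 by (intro powr_mono') auto
    then have "D * y \<le> C * y powr \<theta>" using CC pos 0 by (intro mult_mono) auto
    then show ?case by (simp add: H_def)
  next
    case (Suc N)
    show ?case
    proof (cases "z * y \<le> 1")
      case True
      have "z * y > 0" using Suc.prems assms by simp
      from Suc.IH[OF this True] have "H (Suc N) y \<le> y + x * (C * (z * y) powr \<theta> - D * (z * y))"
        unfolding HS using assms by (intro add_mono mult_left_mono) auto
      also have "\<dots> = C * y powr \<theta> - D * y"
      proof -
        have "x * (C * (z * y) powr \<theta>) = C * y powr \<theta>"
          using Suc.prems assms xz by (simp add: powr_mult ac_simps)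
        moreover have "y - x * (D * (z * y)) = - D * y"
        proof -
          have "D * (x * z - 1) = 1" using assms by (simp add: D_def)
          then have "D * x * z = D + 1" by (simp add: algebra_simps)
          moreover have "x * (D * (z * y)) = (D * x * z) * y" by (simp add: ac_simps)
          ultimately show ?thesis by (simp add: algebra_simps)
        qed
        ultimately show ?thesis unfolding right_diff_distrib[of x] by linarith
      qed
      finally show ?thesis .
    next
      case False
      have "(1/z) powr \<theta> \<le> y powr \<theta>"
        using False assms Suc.prems \<theta> by (intro powr_mono2) (auto simp: field_simps)
      then have "1 / z powr \<theta> \<le> y powr \<theta>" using assms by (simp add: powr_divide)
      moreover have "x = 1 / z powr \<theta>" using \<theta> assms by (simp add: field_simps)
      ultimately have "x \<le> y powr \<theta>" by simp
      then have "(C0 + D) * x \<le> (C0 + D) * y powr \<theta>" using pos by (intro mult_left_mono) auto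
      then have "C0 + D \<le> C * y powr \<theta>" unfolding C_def using assms(1)
        by (simp add: pos_le_divide_eq)
      moreover have "D * y \<le> D" using pos Suc.prems by simp
      ultimately show ?thesis using H0[of "Suc N" y] by linarith
    qed
  qed
  have "H N y \<le> C * y powr \<theta>" if "y > 0" for N y
  proof (cases "y \<le> 1")
    case True
    have "0 < D * y" using pos that by simp
    then show ?thesis using small[OF that True, of N] by linarith
  next
    case False
    then have "y powr \<theta> \<ge> 1" using \<theta> by (intro ge_one_powr_ge_zero) auto
    then have "C * 1 \<le> C * y powr \<theta>" using pos by (intro mult_left_mono) auto
    then show ?thesis using H0[of N y] CC pos by linarith
  qed
  then show ?thesis using pos unfolding H_def by blast
qed

text \<open>Here \<open>n\<close> counts the shells, \<open>j\<close> the levels inside a shell, and \<open>s\<close> stands for \<open>t powr (- (1/2))\<close>. The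
  minimum reflects the two bounds of property A on a shell of mass \<open>2 powr (- q * n)\<close> that is cut
  into \<open>2 powr (d * j)\<close> boxes.\<close>

definition dyadic_sum :: "real \<Rightarrow> real \<Rightarrow> real \<Rightarrow> nat \<Rightarrow> nat \<Rightarrow> real \<Rightarrow> real" where
  "dyadic_sum p q d L N s = (\<Sum>n<N. (2 powr (- (q - p))) ^ n *
     (\<Sum>j<L. (2 powr (- p)) ^ j * min 1 ((2 powr (d / 2)) ^ j * ((2 powr (q / 2)) ^ n * s))))"

text \<open>Bounding the sum over the levels by \<open>min 1 (y powr \<theta>)\<close> leaves a sum over the shells that is again a
  truncated geometric sum, now with argument \<open>s powr \<theta>\<close>. It is dominated by the shell \<open>n = 0\<close>
  when \<open>q - p > \<theta> * q / 2\<close>, and otherwise by the turning point, where \<open>\<theta>\<close> cancels from the exponent.\<close>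

lemma dyadic_sum_from_scale_bound:
  assumes "0 < p" "p < q" "0 < \<theta>" "C > 0"
    and G: "\<And>y L. y > 0 \<Longrightarrow> (\<Sum>j<L. (2 powr (- p)) ^ j * min 1 ((2 powr (d / 2)) ^ j * y)) \<le> C * y powr \<theta>"
    and gap: "q - p \<noteq> \<theta> * q / 2"
  shows "\<exists>K>0. \<forall>s>0. \<forall>L N. dyadic_sum p q d L N s \<le> K * (if q - p > \<theta> * q / 2 then s powr \<theta> else s powr (2 * (q - p) / q))"
proof -
  define x where "x = (2::real) powr (- (q - p))"
  define z where "z = (2::real) powr (\<theta> * q / 2)"
  have x: "0 < x" "x < 1" unfolding x_def using assms by (auto simp: two_powr_less_one)
  have z: "1 < z" unfolding z_def using assms by (auto simp: one_less_two_powr)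
  have xz: "x * z = 2 powr (\<theta> * q / 2 - (q - p))" unfolding x_def z_def by (simp add: powr_add[symmetric] algebra_simps)
  define C' where "C' = max C (1 / (1 - 2 powr (-p)))"
  have C': "C' > 0" using assms by (simp add: C'_def)
  have le: "dyadic_sum p q d L N s \<le> C' * (\<Sum>n<N. x ^ n * min 1 (z ^ n * s powr \<theta>))" if "s > 0" for L N s
  proof -
    have zn: "(2 powr (q / 2)) ^ n * s > 0" for n using that by simp
    have pw: "((2 powr (q / 2)) ^ n * s) powr \<theta> = z ^ n * s powr \<theta>" for n
      using that by (simp add: powr_mult z_def powr_powr powr_power ac_simps)
    have "(\<Sum>j<L. (2 powr (- p)) ^ j * min 1 ((2 powr (d / 2)) ^ j * ((2 powr (q / 2)) ^ n * s))) \<le> C' * min 1 (z ^ n * s powr \<theta>)" (is "?l \<le> _") for n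
    proof -
      have "?l \<le> 1 / (1 - 2 powr (-p))" by (rule truncated_geometric_bounded) (use assms in \<open>auto simp: two_powr_less_one\<close>)
      also have "\<dots> \<le> C'" by (simp add: C'_def)
      finally have 1: "?l \<le> C'" .
      have "?l \<le> C * (z ^ n * s powr \<theta>)" using G[OF zn] unfolding pw .
      also have "\<dots> \<le> C' * (z ^ n * s powr \<theta>)" using z by (intro mult_right_mono) (auto simp: C'_def)
      finally show ?thesis using 1 by (auto simp: min_def)
    qed
    then have "dyadic_sum p q d L N s \<le> (\<Sum>n<N. x ^ n * (C' * min 1 (z ^ n * s powr \<theta>)))"
      unfolding dyadic_sum_def x_def[symmetric] using x by (intro sum_mono mult_left_mono) auto
    then show ?thesis by (simp add: sum_distrib_left ac_simps)
  qed
  show ?thesis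
  proof (cases "q - p > \<theta> * q / 2")
    case True
    then have xz1: "x * z < 1" unfolding xz by (auto simp: two_powr_less_one)
    show ?thesis
    proof (intro exI[of _ "C' / (1 - x * z)"] conjI allI impI)
      show "C' / (1 - x * z) > 0" using C' xz1 by simp
      fix s :: real and L N assume s: "s > 0"
      note le[OF s, of L N]
      also have "C' * (\<Sum>n<N. x ^ n * min 1 (z ^ n * s powr \<theta>)) \<le> C' * (s powr \<theta> / (1 - x * z))"
        using C' x z xz1 by (intro mult_left_mono truncated_geometric_linear) auto
      finally show "dyadic_sum p q d L N s \<le> C' / (1 - x * z) * (if q - p > \<theta> * q / 2 then s powr \<theta> else s powr (2 * (q - p) / q))"
        using True by simp
    qed
  next
    case False
    then have xz1: "x * z > 1" unfolding xz using gap by (auto simp: one_less_two_powr)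
    define \<eta> where "\<eta> = (q - p) / (\<theta> * q / 2)"
    have e: "\<theta> * q / 2 * \<eta> = q - p" using assms by (simp add: \<eta>_def)
    have \<eta>: "\<eta> > 0" "x * z powr \<eta> = 1"
      unfolding x_def z_def powr_powr e using assms by (simp_all add: \<eta>_def powr_add[symmetric])
    from truncated_geometric_interpolated[OF x z xz1 \<eta>(2,1)] obtain D where D: "D > 0"
      "\<And>y N. y > 0 \<Longrightarrow> (\<Sum>n<N. x ^ n * min 1 (z ^ n * y)) \<le> D * y powr \<eta>" by blast
    show ?thesis
    proof (intro exI[of _ "C' * D"] conjI allI impI)
      show "C' * D > 0" using C' D by simp
      fix s :: real and L N assume s: "s > 0"
      note le[OF s, of L N]
      also have "C' * (\<Sum>n<N. x ^ n * min 1 (z ^ n * s powr \<theta>)) \<le> C' * (D * (s powr \<theta>) powr \<eta>)"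
        using C' s by (intro mult_left_mono D) auto
      also have "(s powr \<theta>) powr \<eta> = s powr (2 * (q - p) / q)"
      proof -
        have "\<theta> * \<eta> = 2 * (q - p) / q" using assms by (simp add: \<eta>_def field_simps)
        then show ?thesis by (simp only: powr_powr)
      qed
      finally show "dyadic_sum p q d L N s \<le> C' * D * (if q - p > \<theta> * q / 2 then s powr \<theta> else s powr (2 * (q - p) / q))"
        using False by (simp add: mult.assoc)
    qed
  qed
qed

text \<open>Replacing \<open>min 1 w\<close> by the larger \<open>min 1 (w powr \<theta>)\<close> lowers the growth rate in \<open>j\<close> to
  \<open>\<theta> * d / 2\<close>. With \<open>\<theta> = 1\<close> this covers \<open>p > d / 2\<close>; with \<open>\<theta> < 1\<close> it gives an
  almost linear bound in the critical case \<open>p = d / 2\<close>.\<close>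

lemma scale_sum_supercritical:
  assumes "0 < p" "0 < d" "0 < \<theta>" "\<theta> \<le> 1" "\<theta> * d / 2 < p"
  shows "\<exists>C>0. \<forall>y>0. \<forall>L. (\<Sum>j<L. (2 powr (- p)) ^ j * min 1 ((2 powr (d / 2)) ^ j * y)) \<le> C * y powr (\<theta>::real)"
proof -
  let ?x = "(2::real) powr (-p)" and ?z = "(2::real) powr (\<theta> * d / 2)"
  have xz: "?x * ?z = 2 powr (\<theta> * d / 2 - p)" by (simp add: powr_add[symmetric])
  have xz1: "?x * ?z < 1" unfolding xz using assms by (simp add: two_powr_less_one)
  show ?thesis
  proof (intro exI[of _ "1 / (1 - ?x * ?z)"] conjI allI impI)
    show "0 < 1 / (1 - ?x * ?z)" using xz1 by simp
    fix y :: real and L assume y: "y > 0"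
    have "min 1 w \<le> min 1 (w powr \<theta>)" if "w > 0" for w :: real
    proof (cases "w \<le> 1")
      case True
      then have "w powr 1 \<le> w powr \<theta>" using that assms by (intro powr_mono') auto
      then show ?thesis using that by auto
    next
      case False
      then have "1 \<le> w powr \<theta>" using assms by (intro ge_one_powr_ge_zero) auto
      then show ?thesis by auto
    qed
    then have "(\<Sum>j<L. ?x ^ j * min 1 ((2 powr (d / 2)) ^ j * y)) \<le> (\<Sum>j<L. ?x ^ j * min 1 (((2 powr (d / 2)) ^ j * y) powr \<theta>))"
      using y by (intro sum_mono mult_left_mono) auto
    also have "\<dots> = (\<Sum>j<L. ?x ^ j * min 1 (?z ^ j * y powr \<theta>))"
      using y by (intro sum.cong refl) (simp add: powr_mult powr_powr powr_power ac_simps)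
    also have "\<dots> \<le> y powr \<theta> / (1 - ?x * ?z)"
      using xz1 by (intro truncated_geometric_linear) auto
    finally show "(\<Sum>j<L. ?x ^ j * min 1 ((2 powr (d / 2)) ^ j * y)) \<le> 1 / (1 - ?x * ?z) * y powr \<theta>" by simp
  qed
qed

lemma scale_sum_subcritical:
  fixes p d :: real
  assumes "0 < p" "p < d / 2"
  shows "\<exists>C>0. \<forall>y>0. \<forall>L. (\<Sum>j<L. (2 powr (- p)) ^ j * min 1 ((2 powr (d / 2)) ^ j * y)) \<le> C * y powr (2 * p / d)"
proof (rule truncated_geometric_interpolated)
  show "1 < 2 powr (- p) * 2 powr (d / 2)" using assms by (simp add: powr_add[symmetric] one_less_two_powr)
  show "2 powr (- p) * (2 powr (d / 2)) powr (2 * p / d) = 1" using assms by (simp add: powr_powr powr_add[symmetric])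
qed (use assms in \<open>auto simp: two_powr_less_one one_less_two_powr\<close>)

lemma small_depth: "\<exists>L::nat. 2 powr (- p * L) \<le> r" if "p > 0" "r > (0::real)"
proof -
  obtain L :: nat where "- log 2 r / p \<le> L" using real_arch_simple by blast
  then have "- p * L \<le> log 2 r" using that by (simp add: field_simps)
  then have "2 powr (- p * L) \<le> 2 powr (log 2 r)" by (intro powr_mono) auto
  then show ?thesis using that by auto
qed

text \<open>The six cases for the rate \<open>r\<close> at time \<open>t\<close>, kept together because the existence of a constant is
  proved separately in each of them.\<close>

definition rate_regime :: "real \<Rightarrow> real \<Rightarrow> real \<Rightarrow> real \<Rightarrow> real \<Rightarrow> bool" where
  "rate_regime p q d t r \<longleftrightarrow> 
    (p < d/2 \<and> p/q < d/(d+q) \<and> r = t powr (- (p/d))) \<or>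
    (p < d/2 \<and> d/(d+q) < p/q \<and> p/q < 1 \<and> r = t powr (- (1 - p/q))) \<or>
    (p = d/2 \<and> p/q < 1/2 \<and> r = t powr (- (1/2)) * ln (1 + t)) \<or>
    (p = d/2 \<and> 1/2 < p/q \<and> p/q < 1 \<and> r = t powr (- (1 - p/q))) \<or>
    (p > d/2 \<and> p/q < 1/2 \<and> r = t powr (- (1/2))) \<or>
    (p > d/2 \<and> 1/2 < p/q \<and> p/q < 1 \<and> r = t powr (- (1 - p/q)))"

text \<open>At \<open>p = d / 2\<close> the growth in the number of boxes exactly compensates the decay of the cost, so
  each of the \<open>L\<close> levels contributes the same amount. The depth is therefore taken as small as
  the residual cost \<open>2 powr (- p * L)\<close> permits.\<close>

lemma dyadic_sum_log_case:
  assumes "0 < p" "p < q / 2" "t0 > 0"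
  shows "\<exists>K>0. \<forall>t\<ge>t0. \<exists>L. 2 powr (- p * real L) \<le> K * (t powr (- (1/2)) * ln (1 + t)) \<and>
     (\<forall>N. dyadic_sum p q (2 * p) L N (t powr (-(1/2))) \<le> K * (t powr (- (1/2)) * ln (1 + t)))"
proof -
  define g where "g = 1 / (1 - 2 powr (p - q / 2))"
  have g1: "2 powr (p - q / 2) < 1" using assms by (simp add: two_powr_less_one)
  then have g: "g > 0" by (simp add: g_def)
  define l0 where "l0 = ln (1 + t0)"
  have l0: "l0 > 0" using assms by (simp add: l0_def)
  define K1 where "K1 = 1 / (2 * p * ln 2) + 1 / l0"
  have K1: "K1 > 0" using assms l0 by (simp add: K1_def add_pos_pos)
  define K where "K = max (1 / l0) (K1 * g)"
  show ?thesis
  proof (intro exI[of _ K] conjI allI impI)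
    show "K > 0" using l0 by (simp add: K_def less_max_iff_disj)
    fix t assume t: "t \<ge> t0"
    then have t': "t > 0" using assms by simp
    have lnt: "l0 \<le> ln (1 + t)" using t assms by (simp add: l0_def)
    then have lnt1: "1 \<le> ln (1 + t) / l0" using l0 by simp
    define s where "s = t powr (- (1 / 2))"
    have s: "s > 0" using t' by (simp add: s_def)
    \<comment> \<open>Smallest depth with \<open>2 powr (- p * L) \<le> (1 + t) powr (- (1/2))\<close>; the shift by 1 keeps the logarithm positive.\<close>
    define L where "L = nat \<lceil>ln (1 + t) / (2 * p * ln 2)\<rceil>"
    have Lge: "ln (1 + t) / (2 * p * ln 2) \<le> L" unfolding L_def by linarith
    have "0 \<le> ln (1 + t) / (2 * p * ln 2)" using lnt l0 assms by simp
    then have "L \<le> ln (1 + t) / (2 * p * ln 2) + 1" unfolding L_def by linarith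
    also have "\<dots> \<le> K1 * ln (1 + t)" using lnt1 by (simp add: K1_def algebra_simps)
    finally have Lle: "L \<le> K1 * ln (1 + t)" .
    have K0: "0 \<le> ln (1 + t)" using lnt l0 by simp
    show "\<exists>L. 2 powr (- p * real L) \<le> K * (t powr (- (1/2)) * ln (1 + t)) \<and>
       (\<forall>N. dyadic_sum p q (2 * p) L N (t powr (-(1/2))) \<le> K * (t powr (- (1/2)) * ln (1 + t)))"
    proof (intro exI[of _ L] conjI allI)
      have "- p * real L \<le> - p * (ln (1 + t) / (2 * p * ln 2))" using mult_left_mono[OF Lge, of p] assms(1) by linarith
      also have "\<dots> = log 2 (1 + t) * (- (1/2))" using assms by (simp add: log_def)
      finally have "2 powr (- p * real L) \<le> 2 powr (log 2 (1 + t) * (- (1/2)))" by (intro powr_mono) auto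
      also have "\<dots> = (1 + t) powr (- (1/2))" using t' by (subst powr_powr[symmetric]) simp
      also have "\<dots> \<le> s" unfolding s_def using t' by (intro powr_mono2') auto
      also have "\<dots> \<le> s * (ln (1 + t) / l0)" using mult_left_mono[OF lnt1, of s] s by simp
      also have "\<dots> = 1 / l0 * (s * ln (1 + t))" by simp
      also have "\<dots> \<le> K * (s * ln (1 + t))" using s K0 by (intro mult_right_mono) (auto simp: K_def)
      finally show "2 powr (- p * real L) \<le> K * (t powr (- (1/2)) * ln (1 + t))" unfolding s_def .
    next
      fix N
      have "dyadic_sum p q (2 * p) L N s \<le> (\<Sum>n<N. (2 powr (- (q - p))) ^ n *
          (\<Sum>j<L. (2 powr (- p)) ^ j * ((2 powr (2 * p / 2)) ^ j * ((2 powr (q / 2)) ^ n * s))))"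
        unfolding dyadic_sum_def by (intro sum_mono mult_left_mono) auto
      also have "\<dots> = (\<Sum>n<N. (2 powr (- (q - p))) ^ n * (\<Sum>j<L. ((2 powr (q / 2)) ^ n * s)))"
      proof -
        have "(2 powr (- p)) ^ j * (2 powr (2 * p / 2)) ^ j = (1::real)" for j
          by (simp add: power_mult_distrib[symmetric] powr_add[symmetric])
        then show ?thesis by (simp only: mult.assoc[symmetric] mult_1_left)
      qed
      also have "\<dots> = (\<Sum>n<N. (2 powr (p - q / 2)) ^ n) * (L * s)"
      proof -
        have "(2 powr (- (q - p))) ^ n * (2 powr (q / 2)) ^ n = ((2::real) powr (p - q / 2)) ^ n" for n
          by (simp add: power_mult_distrib[symmetric] powr_add[symmetric])
        then show ?thesis by (simp add: sum_distrib_right sum_distrib_left ac_simps)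
      qed
      also have "\<dots> \<le> g * (L * s)" unfolding g_def using s g1 by (intro mult_right_mono geometric_sum_le) auto
      also have "\<dots> \<le> g * (K1 * ln (1 + t) * s)" using s g Lle by (intro mult_left_mono mult_right_mono) auto
      also have "\<dots> = (K1 * g) * (s * ln (1 + t))" by simp
      also have "\<dots> \<le> K * (s * ln (1 + t))" using s K0 by (intro mult_right_mono) (auto simp: K_def)
      finally show "dyadic_sum p q (2 * p) L N (t powr (-(1/2))) \<le> K * (t powr (- (1/2)) * ln (1 + t))" unfolding s_def .
    qed
  qed
qed

lemma dyadic_sum_power_case:
  assumes "0 < p" "p < q" "0 < \<theta>" "C > 0"
    and G: "\<And>y L. y > 0 \<Longrightarrow> (\<Sum>j<L. (2 powr (- p)) ^ j * min 1 ((2 powr (d / 2)) ^ j * y)) \<le> C * y powr \<theta>"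
    and \<rho>: "(q - p > \<theta> * q / 2 \<and> \<rho> = \<theta> / 2) \<or> (q - p < \<theta> * q / 2 \<and> \<rho> = 1 - p / q)"
  shows "\<exists>K>0. \<forall>t\<ge>t0. t > 0 \<longrightarrow> (\<exists>L. 2 powr (- p * real L) \<le> K * t powr (- \<rho>) \<and>
     (\<forall>N. dyadic_sum p q d L N (t powr (-(1/2))) \<le> K * t powr (- \<rho>)))"
proof -
  have "q - p \<noteq> \<theta> * q / 2" using \<rho> by auto
  from dyadic_sum_from_scale_bound[OF assms(1-4) G this] obtain K where K: "K > 0"
    "\<And>s L N. s > 0 \<Longrightarrow> dyadic_sum p q d L N s \<le> K * (if q - p > \<theta> * q / 2 then s powr \<theta> else s powr (2 * (q - p) / q))"
    by blast
  have r: "(if q - p > \<theta> * q / 2 then (t powr (-(1/2))) powr \<theta> else (t powr (-(1/2))) powr (2 * (q - p) / q)) = t powr (- \<rho>)"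
    for t :: real using \<rho> assms(1,2) by (auto simp: powr_powr diff_divide_distrib)
  show ?thesis
  proof (intro exI[of _ K] conjI allI impI)
    show "K > 0" by fact
    fix t :: real assume "t > 0"
    then have "K * t powr (- \<rho>) > 0" using K by simp
    from small_depth[OF \<open>0 < p\<close> this] obtain L :: nat where L: "2 powr (- p * L) \<le> K * t powr (- \<rho>)" by blast
    have "dyadic_sum p q d L N (t powr (-(1/2))) \<le> K * t powr (- \<rho>)" for N
      using K(2)[of "t powr (-(1/2))" L N] \<open>t > 0\<close> unfolding r by simp
    with L show "\<exists>L. 2 powr (- p * real L) \<le> K * t powr (- \<rho>) \<and>
     (\<forall>N. dyadic_sum p q d L N (t powr (-(1/2))) \<le> K * t powr (- \<rho>))" by blast
  qed
qed

text \<open>The depth \<open>L\<close> at which the tree is cut may depend on \<open>t\<close>. Except in the logarithmic case the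
  double sum is bounded uniformly in \<open>L\<close>, so that the only requirement is that the residual cost be small.\<close>

lemma dyadic_sum_rate:
  assumes "0 < p" "p < q" "0 < d" "t0 > 0"
  shows "\<exists>K>0. \<forall>t\<ge>t0. \<forall>r. rate_regime p q d t r \<longrightarrow> 
    (\<exists>L. 2 powr (- p * real L) \<le> K * r \<and> (\<forall>N. dyadic_sum p q d L N (t powr (-(1/2))) \<le> K * r))"
proof -
  have power: ?thesis if "0 < \<theta>" "\<exists>C>0. \<forall>y>0. \<forall>L. (\<Sum>j<L. (2 powr (- p)) ^ j * min 1 ((2 powr (d / 2)) ^ j * y)) \<le> C * y powr \<theta>"
    "(q - p > \<theta> * q / 2 \<and> \<rho> = \<theta> / 2) \<or> (q - p < \<theta> * q / 2 \<and> \<rho> = 1 - p / q)"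
    "\<And>t r. rate_regime p q d t r \<Longrightarrow> r = t powr (- \<rho>)" for \<theta> \<rho> :: real
  proof -
    from that(2) obtain C where "C > 0" 
      "\<And>y L. y > 0 \<Longrightarrow> (\<Sum>j<L. (2 powr (- p)) ^ j * min 1 ((2 powr (d / 2)) ^ j * y)) \<le> C * y powr \<theta>" by blast
    from dyadic_sum_power_case[OF assms(1,2) that(1) this that(3), of t0] 
    obtain K where K: "K > 0" "\<And>t. t \<ge> t0 \<Longrightarrow> t > 0 \<Longrightarrow> (\<exists>L. 2 powr (- p * real L) \<le> K * t powr (- \<rho>) \<and>
       (\<forall>N. dyadic_sum p q d L N (t powr (-(1/2))) \<le> K * t powr (- \<rho>)))" by blast
    show ?thesis
    proof (intro exI[of _ K] conjI allI impI K(1))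
      fix t r assume "t0 \<le> t" "rate_regime p q d t r"
      with K(2)[of t] that(4)[of t r] assms(4)
      show "\<exists>L. 2 powr (- p * real L) \<le> K * r \<and> (\<forall>N. dyadic_sum p q d L N (t powr (-(1/2))) \<le> K * r)" by simp
    qed
  qed
  have qpos: "q > 0" using assms by simp
  have dq: "d + q > 0" using assms by simp
  have c1: "p / q < d / (d + q) \<longleftrightarrow> q - p > (2 * p / d) * q / 2" 
    using assms qpos dq by (simp add: field_simps)
  have c2: "d / (d + q) < p / q \<longleftrightarrow> q - p < (2 * p / d) * q / 2" 
    using assms qpos dq by (simp add: field_simps)
  have c3: "p / q < 1/2 \<longleftrightarrow> q - p > 1 * q / 2" "1/2 < p / q \<longleftrightarrow> q - p < 1 * q / 2"
    using qpos by (auto simp: field_simps)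
  consider "p < d / 2" | "p > d / 2" | "p = d / 2" by linarith
  then show ?thesis
  proof cases
    case 1
    note G = scale_sum_subcritical[OF assms(1) 1]
    consider "p / q < d / (d + q)" | "d / (d + q) < p / q" | "p / q = d / (d + q)" by linarith
    then show ?thesis
    proof cases
      case a: 1 
      show ?thesis by (rule power[OF _ G, of "p / d"]) (use 1 a c1 c2 assms in \<open>auto simp: rate_regime_def\<close>)
    next
      case a: 2
      show ?thesis by (rule power[OF _ G, of "1 - p / q"]) (use 1 a c1 c2 assms in \<open>auto simp: rate_regime_def\<close>)
    next
      case 3
      then show ?thesis using 1 by (intro exI[of _ 1]) (auto simp: rate_regime_def)
    qed
  next
    case 2
    have G: "\<exists>C>0. \<forall>y>0. \<forall>L. (\<Sum>j<L. (2 powr (- p)) ^ j * min 1 ((2 powr (d / 2)) ^ j * y)) \<le> C * y powr (1::real)"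
      by (rule scale_sum_supercritical) (use assms 2 in auto)
    consider "p / q < 1 / 2" | "1 / 2 < p / q" | "p / q = 1 / 2" by linarith
    then show ?thesis
    proof cases
      case a: 1 
      show ?thesis by (rule power[OF _ G, of "1 / 2"]) (use 2 a c3 assms in \<open>auto simp: rate_regime_def\<close>)
    next
      case a: 2
      show ?thesis by (rule power[OF _ G, of "1 - p / q"]) (use 2 a c3 assms in \<open>auto simp: rate_regime_def\<close>)
    next
      case 3
      then show ?thesis using 2 by (intro exI[of _ 1]) (auto simp: rate_regime_def)
    qed
  next
    case 3
    consider "p / q < 1 / 2" | "1 / 2 < p / q" | "p / q = 1 / 2" by linarith
    then show ?thesis
    proof cases
      case a: 1 
      then have "p < q / 2" using qpos by (simp add: field_simps)
      from dyadic_sum_log_case[OF assms(1) this assms(4)] 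
      show ?thesis using 3 a by (auto simp: rate_regime_def)
    next
      case a: 2
      \<comment> \<open>At \<open>\<theta> = 1\<close> the sum over the levels diverges; \<open>u < \<theta>\<close> ensures \<open>q - p < \<theta> * q / 2\<close>, where the rate is independent of \<open>\<theta>\<close>.\<close>
      define u where "u = 2 * (q - p) / q"
      define \<theta> where "\<theta> = (u + 1) / 2"
      have "u < 1" "0 < u" using a assms by (auto simp: u_def field_simps)
      then have \<theta>: "0 < \<theta>" "\<theta> < 1" "u < \<theta>" by (auto simp: \<theta>_def)
      have G: "\<exists>C>0. \<forall>y>0. \<forall>L. (\<Sum>j<L. (2 powr (- p)) ^ j * min 1 ((2 powr (d / 2)) ^ j * y)) \<le> C * y powr \<theta>"
        by (rule scale_sum_supercritical) (use assms 3 \<theta> in auto)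
      have "q - p < \<theta> * q / 2" using \<theta>(3) qpos by (simp add: u_def field_simps)
      then show ?thesis using \<theta> 3 a by (intro power[OF _ G, of "1 - p / q"]) (auto simp: rate_regime_def)
    next
      case a: 3
      then show ?thesis using 3 by (intro exI[of _ 1]) (auto simp: rate_regime_def)
    qed
  qed
qed

section \<open>Decay of correlations under the stationary distribution\<close>

lemma square_integral_mult_le:
  fixes f g :: "'a \<Rightarrow> real"
  assumes F[simp]: "integrable M (\<lambda>x. (f x)\<^sup>2)" and G[simp]: "integrable M (\<lambda>x. (g x)\<^sup>2)" and H[simp]: "integrable M (\<lambda>x. f x * g x)"
  shows "(\<integral>x. f x * g x \<partial>M)\<^sup>2 \<le> (\<integral>x. (f x)\<^sup>2 \<partial>M) * (\<integral>x. (g x)\<^sup>2 \<partial>M)"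
proof -
  define F G c where "F = (\<integral>x. (f x)\<^sup>2 \<partial>M)" and "G = (\<integral>x. (g x)\<^sup>2 \<partial>M)" and "c = (\<integral>x. f x * g x \<partial>M)"
  have q: "0 \<le> a\<^sup>2 * F - 2 * a * b * c + b\<^sup>2 * G" for a b
  proof -
    have "0 \<le> (\<integral>x. (a * f x - b * g x)\<^sup>2 \<partial>M)" by simp
    also have "(\<lambda>x. (a * f x - b * g x)\<^sup>2) = (\<lambda>x. a\<^sup>2 * (f x)\<^sup>2 - 2 * a * b * (f x * g x) + b\<^sup>2 * (g x)\<^sup>2)"
      by (auto simp: power2_eq_square algebra_simps)
    also have "(\<integral>x. \<dots> x \<partial>M) = a\<^sup>2 * F - 2 * a * b * c + b\<^sup>2 * G"
      unfolding F_def G_def c_def by simp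
    finally show ?thesis .
  qed
  have F0: "F \<ge> 0" and G0: "G \<ge> 0" by (auto simp: F_def G_def)
  have "c\<^sup>2 \<le> F * G"
  proof (cases "G = 0")
    case True
    have "c = 0"
    proof (rule ccontr)
      assume "c \<noteq> 0"
      then show False using q[of 1 "(F + 1) / (2 * c)"] True by (simp add: field_simps)
    qed
    then show ?thesis using True by simp
  next
    case False
    then have "G > 0" using G0 by simp
    have "0 \<le> G * (F * G - c\<^sup>2)" using q[of G c] by (simp add: power2_eq_square algebra_simps)
    then show ?thesis using \<open>G > 0\<close> by (simp add: zero_le_mult_iff)
  qed
  then show ?thesis unfolding F_def G_def c_def .
qed

lemma (in prob_space) square_expectation_le:
  fixes f :: "'a \<Rightarrow> real"
  assumes [measurable]: "f \<in> borel_measurable M" and "\<And>x. x \<in> space M \<Longrightarrow> \<bar>f x\<bar> \<le> c"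
  shows "(expectation f)\<^sup>2 \<le> expectation (\<lambda>x. (f x)\<^sup>2)"
proof -
  have "integrable M f"
    by (rule integrable_const_bound[of _ c]) (use assms in auto)
  moreover have "integrable M (\<lambda>x. (f x)\<^sup>2)"
    by (rule integrable_const_bound[of _ "c\<^sup>2"]) (use assms in \<open>auto simp: abs_le_square_iff[symmetric] intro!: order_trans[OF _ abs_ge_self]\<close>)
  ultimately show ?thesis using square_integral_mult_le[of M f "\<lambda>_. 1"] by (simp add: prob_space)
qed

context
  fixes P :: "real \<Rightarrow> 'a::euclidean_space \<Rightarrow> 'a measure"
  assumes P: "markov_semigroup P"
begin

lemma semigroup_kernel [measurable]: "t \<ge> 0 \<Longrightarrow> P t \<in> borel \<rightarrow>\<^sub>M subprob_algebra borel"
  using P by (auto simp: markov_semigroup_def intro: measurable_prob_algebraD)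

lemma semigroup_prob: 
  assumes "t \<ge> 0" shows "prob_space (P t x)" "sets (P t x) = sets borel" "space (P t x) = UNIV" "emeasure (P t x) UNIV = 1"
proof -
  have "P t x \<in> space (prob_algebra borel)"
    using P assms by (auto simp: markov_semigroup_def intro: measurable_space)
  then show "prob_space (P t x)" and *: "sets (P t x) = sets borel" by (auto simp: space_prob_algebra)
  show sp: "space (P t x) = UNIV" using sets_eq_imp_space_eq[OF *] by simp
  show "emeasure (P t x) UNIV = 1" using prob_space.emeasure_space_1[OF \<open>prob_space (P t x)\<close>] sp by simp
qed

lemma kernel_op_measurable [measurable]:
  "t \<ge> 0 \<Longrightarrow> f \<in> borel_measurable borel \<Longrightarrow> kernel_op (P t) f \<in> borel_measurable borel"
  unfolding kernel_op_def 
  by (rule measurable_compose[OF semigroup_kernel integral_measurable_subprob_algebra]) auto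

context
  fixes f :: "'a \<Rightarrow> real" and c :: real
  assumes f[measurable]: "f \<in> borel_measurable borel" and fc: "\<And>x. \<bar>f x\<bar> \<le> c"
begin

lemma kernel_integrable: "t \<ge> 0 \<Longrightarrow> integrable (P t x) f"
proof -
  assume t: "t \<ge> 0"
  interpret prob_space "P t x" by (rule semigroup_prob[OF t])
  show ?thesis by (rule integrable_const_bound[of _ c]) (auto simp: fc measurable_cong_sets[OF semigroup_prob(2)[OF t] refl])
qed

lemma kernel_op_bounded: "t \<ge> 0 \<Longrightarrow> \<bar>kernel_op (P t) f x\<bar> \<le> c"
proof -
  assume t: "t \<ge> 0"
  interpret prob_space "P t x" by (rule semigroup_prob[OF t])
  have "\<bar>kernel_op (P t) f x\<bar> \<le> (\<integral>y. \<bar>f y\<bar> \<partial>P t x)" unfolding kernel_op_def by (rule integral_abs_bound)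
  also have "\<dots> \<le> (\<integral>y. c \<partial>P t x)"
    by (intro integral_mono) (use kernel_integrable[OF t] fc in auto)
  finally show ?thesis by (simp add: prob_space)
qed

lemma kernel_op_semigroup:
  assumes "s \<ge> 0" "t \<ge> 0"
  shows "kernel_op (P (s + t)) f = kernel_op (P s) (kernel_op (P t) f)"
proof
  fix x
  have "P (s + t) x = P s x \<bind> P t" using P assms by (simp add: markov_semigroup_def)
  then have "kernel_op (P (s + t)) f x = (\<integral>y. f y \<partial>(P s x \<bind> P t))" by (simp add: kernel_op_def)
  also have "\<dots> = (\<integral>y. (\<integral>z. f z \<partial>P t y) \<partial>P s x)"
    by (rule integral_bind[where K=borel and B=c and B'=1])
       (use assms fc semigroup_prob in \<open>auto simp: measurable_cong_sets[OF semigroup_prob(2) refl] intro!: semigroup_kernel prob_space.finite_measure\<close>)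
  finally show "kernel_op (P (s + t)) f x = kernel_op (P s) (kernel_op (P t) f) x" by (simp add: kernel_op_def)
qed

lemma kernel_op_square_le:
  assumes "t \<ge> 0"
  shows "(kernel_op (P t) f x)\<^sup>2 \<le> kernel_op (P t) (\<lambda>y. (f y)\<^sup>2) x"
proof -
  interpret prob_space "P t x" by (rule semigroup_prob[OF assms])
  show ?thesis unfolding kernel_op_def
    by (rule square_expectation_le[of _ c]) (auto simp: fc measurable_cong_sets[OF semigroup_prob(2)[OF assms] refl])
qed

lemma kernel_op_diff_const:
  assumes "t \<ge> 0"
  shows "kernel_op (P t) (\<lambda>y. f y - a) x = kernel_op (P t) f x - a"
proof -
  interpret prob_space "P t x" by (rule semigroup_prob[OF assms])
  show ?thesis unfolding kernel_op_def using kernel_integrable[OF assms] by (simp add: prob_space)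
qed

lemma stationary_integral:
  assumes \<nu>: "stationary_distribution P \<nu>" and "t \<ge> 0"
  shows "(\<integral>x. kernel_op (P t) f x \<partial>\<nu>) = (\<integral>x. f x \<partial>\<nu>)"
proof -
  have "(\<integral>x. f x \<partial>\<nu>) = (\<integral>x. f x \<partial>(\<nu> \<bind> P t))" using \<nu> \<open>t \<ge> 0\<close> by (simp add: stationary_distribution_def)
  also have "\<dots> = (\<integral>y. (\<integral>z. f z \<partial>P t y) \<partial>\<nu>)"
  proof (rule integral_bind[where K=borel and B=c and B'=1])
    show "P t \<in> \<nu> \<rightarrow>\<^sub>M subprob_algebra borel" using \<nu> semigroup_kernel[OF \<open>t \<ge> 0\<close>]
      by (auto simp: stationary_distribution_def cong: measurable_cong_sets)
  qed (use assms fc semigroup_prob in \<open>auto simp: stationary_distribution_def intro!: prob_space.finite_measure\<close>)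
  finally show ?thesis by (simp add: kernel_op_def)
qed

end

lemma variance_wrt_bounded:
  fixes f :: "'a \<Rightarrow> real"
  assumes "prob_space \<nu>" "sets \<nu> = sets borel" and [measurable]: "f \<in> borel_measurable borel" and fc: "\<And>x. \<bar>f x\<bar> \<le> c"
  shows "variance_wrt \<nu> f = (\<integral>x. (f x)\<^sup>2 \<partial>\<nu>) - (\<integral>x. f x \<partial>\<nu>)\<^sup>2"
proof -
  interpret prob_space \<nu> by fact
  note [measurable_cong] = assms(2)
  have "integrable \<nu> f"
    by (rule integrable_const_bound[of _ c]) (use fc in auto)
  moreover have "integrable \<nu> (\<lambda>x. (f x)\<^sup>2)"
    by (rule integrable_const_bound[of _ "c\<^sup>2"]) (use fc in \<open>auto simp: abs_le_square_iff[symmetric] intro!: order_trans[OF _ abs_ge_self]\<close>)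
  ultimately show ?thesis unfolding variance_wrt_def by (rule variance_eq)
qed

lemma variance_contraction:
  assumes \<nu>: "stationary_distribution P \<nu>" and t: "t \<ge> 0"
    and f[measurable]: "f \<in> borel_measurable borel" and fc: "\<And>x. \<bar>f x\<bar> \<le> c"
  shows "variance_wrt \<nu> (kernel_op (P t) f) \<le> variance_wrt \<nu> f"
proof -
  have \<nu>': "prob_space \<nu>" and S[measurable_cong]: "sets \<nu> = sets borel" using \<nu> by (auto simp: stationary_distribution_def)
  interpret prob_space \<nu> by fact
  have f2: "\<bar>(f x)\<^sup>2\<bar> \<le> c\<^sup>2" for x using fc[of x] by (auto simp: abs_le_square_iff[symmetric] intro!: order_trans[OF _ abs_ge_self])
  have Pf2: "\<bar>(kernel_op (P t) f x)\<^sup>2\<bar> \<le> c\<^sup>2" for x using kernel_op_bounded[OF f fc t, of x] by (auto simp: abs_le_square_iff[symmetric] intro!: order_trans[OF _ abs_ge_self])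
  have m2: "(\<lambda>y. (f y)\<^sup>2) \<in> borel_measurable borel" by measurable
  have "(\<integral>x. (kernel_op (P t) f x)\<^sup>2 \<partial>\<nu>) \<le> (\<integral>x. kernel_op (P t) (\<lambda>y. (f y)\<^sup>2) x \<partial>\<nu>)"
  proof (rule integral_mono)
    show "integrable \<nu> (\<lambda>x. (kernel_op (P t) f x)\<^sup>2)"
      by (rule integrable_const_bound[of _ "c\<^sup>2"]) (use Pf2 kernel_op_measurable[OF t f] in \<open>auto cong: measurable_cong_sets\<close>)
    show "integrable \<nu> (\<lambda>x. kernel_op (P t) (\<lambda>y. (f y)\<^sup>2) x)"
      by (rule integrable_const_bound[of _ "c\<^sup>2"]) (use kernel_op_bounded[OF m2 f2 t] kernel_op_measurable[OF t m2] in \<open>auto cong: measurable_cong_sets\<close>)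
  qed (rule kernel_op_square_le[OF f fc t])
  also have "\<dots> = (\<integral>x. (f x)\<^sup>2 \<partial>\<nu>)" by (rule stationary_integral[OF m2 f2 \<nu> t])
  finally show ?thesis
    using variance_wrt_bounded[OF \<nu>' S f fc] variance_wrt_bounded[OF \<nu>' S kernel_op_measurable[OF t f] kernel_op_bounded[OF f fc t]]
      stationary_integral[OF f fc \<nu> t] by simp
qed

text \<open>An integrable \<open>e\<close> cannot stay above \<open>1/2\<close>, so at some time \<open>\<tau> > 0\<close> the variance is at least halved.
  The semigroup property iterates this, and \<open>variance_contraction\<close> handles the remaining
  time below \<open>\<tau>\<close>, at the price of the factor 2.\<close>

lemma variance_exponential_decay:
  assumes \<nu>: "stationary_distribution P \<nu>" and e: "e absolutely_integrable_on {0..}"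
    and dec: "\<And>t f. t \<ge> 0 \<Longrightarrow> f \<in> L2 \<nu> \<Longrightarrow> variance_wrt \<nu> (kernel_op (P t) f) \<le> e t * variance_wrt \<nu> f"
  obtains \<theta> :: real where "\<theta> > 0" "\<And>(f :: 'a \<Rightarrow> real) c t. f \<in> borel_measurable borel \<Longrightarrow> (\<And>x. \<bar>f x\<bar> \<le> c) \<Longrightarrow> t \<ge> 0 \<Longrightarrow> 
    variance_wrt \<nu> (kernel_op (P t) f) \<le> 2 * exp (- \<theta> * t) * variance_wrt \<nu> f"
proof -
  have \<nu>': "prob_space \<nu>" and S[measurable_cong]: "sets \<nu> = sets borel" using \<nu> by (auto simp: stationary_distribution_def)
  interpret prob_space \<nu> by fact
  have "\<exists>\<tau>>0. e \<tau> \<le> 1/2"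
  proof (rule ccontr)
    assume "\<not> (\<exists>\<tau>>0. e \<tau> \<le> 1/2)"
    then have big: "e \<tau> > 1/2" if "\<tau> > 0" for \<tau> using that by force
    have I: "(\<lambda>x. norm (e x)) integrable_on {0..}" using e by (simp add: absolutely_integrable_on_def)
    define J where "J = integral {0..} (\<lambda>x. norm (e x))"
    have "n / 2 \<le> J" for n :: nat
    proof -
      have i: "(\<lambda>x. norm (e x)) integrable_on {1..1 + real n}"
        by (rule integrable_on_subinterval[OF I]) auto
      have "n / 2 = integral {1..1 + real n} (\<lambda>x. 1/2)" by simp
      also have "\<dots> \<le> integral {1..1 + real n} (\<lambda>x. norm (e x))"
      proof (intro integral_le i)
        show "1 / 2 \<le> norm (e x)" if "x \<in> {1..1 + real n}" for x using big[of x] that by simp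
      qed auto
      also have "\<dots> \<le> J" unfolding J_def by (intro integral_subset_le i I) auto
      finally show ?thesis .
    qed
    moreover obtain n :: nat where "2 * J < n" using reals_Archimedean2 by blast
    ultimately show False by (smt (verit) field_sum_of_halves)
  qed
  then obtain \<tau> where \<tau>: "\<tau> > 0" "e \<tau> \<le> 1/2" by blast
  have V0: "variance_wrt \<nu> f \<ge> 0" for f unfolding variance_wrt_def by simp
  have step: "variance_wrt \<nu> (kernel_op (P (real n * \<tau> + r)) f) \<le> (1/2)^n * variance_wrt \<nu> f"
    if f[measurable]: "f \<in> borel_measurable borel" and fc: "\<And>x. \<bar>f x\<bar> \<le> c" and r: "r \<ge> 0" for f c r n
  proof (induction n)
    case 0
    then show ?case using variance_contraction[OF \<nu> r f fc] by simp
  next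
    case (Suc n)
    define s where "s = real n * \<tau> + r"
    have s: "s \<ge> 0" using \<tau> r by (simp add: s_def)
    let ?g = "kernel_op (P s) f"
    have "\<bar>(?g x)\<^sup>2\<bar> \<le> c\<^sup>2" for x using kernel_op_bounded[OF f fc s, of x] by (auto simp: abs_le_square_iff[symmetric] intro!: order_trans[OF _ abs_ge_self])
    then have "integrable \<nu> (\<lambda>x. (?g x)\<^sup>2)"
      using kernel_op_measurable[OF s f] by (intro integrable_const_bound[of _ "c\<^sup>2"]) (auto cong: measurable_cong_sets)
    then have "?g \<in> L2 \<nu>" using kernel_op_measurable[OF s f] by (auto simp: L2_def cong: measurable_cong_sets)
    have "real (Suc n) * \<tau> + r = \<tau> + s" by (simp add: s_def algebra_simps)
    then have "variance_wrt \<nu> (kernel_op (P (real (Suc n) * \<tau> + r)) f) = variance_wrt \<nu> (kernel_op (P \<tau>) ?g)"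
      using kernel_op_semigroup[OF f fc, of \<tau> s] \<tau> s by simp
    also have "\<dots> \<le> e \<tau> * variance_wrt \<nu> ?g" using \<tau> \<open>?g \<in> L2 \<nu>\<close> by (intro dec) auto
    also have "\<dots> \<le> 1/2 * variance_wrt \<nu> ?g" using \<tau> V0 by (intro mult_right_mono) auto
    also have "\<dots> \<le> 1/2 * ((1/2)^n * variance_wrt \<nu> f)" using Suc by (simp add: s_def)
    finally show ?case by simp
  qed
  define \<theta> where "\<theta> = ln 2 / \<tau>"
  show thesis
  proof (rule that[of \<theta>])
    show "\<theta> > 0" using \<tau> by (simp add: \<theta>_def)
    fix f :: "'a \<Rightarrow> real" and c t :: real assume f: "f \<in> borel_measurable borel" and fc: "\<And>x. \<bar>f x\<bar> \<le> c" and t: "(t::real) \<ge> 0"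
    define n where "n = nat \<lfloor>t / \<tau>\<rfloor>"
    have q0: "t / \<tau> \<ge> 0" using t \<tau> by simp
    have n: "real n \<le> t / \<tau>" "t / \<tau> - 1 \<le> real n" using q0 unfolding n_def by linarith+
    define r where "r = t - real n * \<tau>"
    have r: "r \<ge> 0" using n(1) \<tau> by (simp add: r_def field_simps)
    have "variance_wrt \<nu> (kernel_op (P t) f) \<le> (1/2)^n * variance_wrt \<nu> f"
      using step[OF f fc r, of n] by (simp add: r_def)
    also have "(1/2)^n = exp (- ln 2 * real n)"
    proof -
      have "exp (- ln 2 * real n) = exp (- ln 2) ^ n" by (subst mult.commute) (rule exp_of_nat_mult)
      then show ?thesis by (simp add: exp_minus inverse_eq_divide)
    qed
    also have "\<dots> \<le> exp (- ln 2 * (t / \<tau> - 1))" using n(2) by simp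
    also have "\<dots> = 2 * exp (- \<theta> * t)"
    proof -
      have "- ln 2 * (t / \<tau> - 1) = ln 2 + (- \<theta> * t)" by (simp add: \<theta>_def algebra_simps)
      then show ?thesis by (simp only: exp_add) simp
    qed
    finally show "variance_wrt \<nu> (kernel_op (P t) f) \<le> 2 * exp (- \<theta> * t) * variance_wrt \<nu> f"
      using V0[of f] by (simp add: mult_right_mono)
  qed
qed

end


text \<open>The Markov property in integrated form: \<open>g (X s)\<close> is measurable with respect to the past and
  may be taken out of the conditional expectation.\<close>

lemma markov_property_expectation:
  fixes P :: "real \<Rightarrow> 'a::euclidean_space \<Rightarrow> 'a measure"
  assumes P: "markov_semigroup P" and X: "markov_process M P X" and s: "s \<ge> 0"
    and f[measurable]: "f \<in> borel_measurable borel" and fc: "\<And>x. \<bar>f x\<bar> \<le> (c::real)"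
    and g[measurable]: "g \<in> borel_measurable borel" and gc: "\<And>x. \<bar>g x\<bar> \<le> (c'::real)"
    and u: "u \<ge> 0"
  shows "(\<integral>\<omega>. g (X s \<omega>) * f (X (s + u) \<omega>) \<partial>M) = (\<integral>\<omega>. g (X s \<omega>) * kernel_op (P u) f (X s \<omega>) \<partial>M)"
proof -
  interpret prob_space M using X by (simp add: markov_process_def)
  have Xm: "X t \<in> borel_measurable M" if "t \<ge> 0" for t using X that by (simp add: markov_process_def)
  note Xs_m[measurable] = Xm[OF s]
  let ?F = "natural_filtration M X s"
  let ?G = "{X v -` A \<inter> space M | v A. 0 \<le> v \<and> v \<le> s \<and> A \<in> sets borel}"
  have G: "?G \<subseteq> Pow (space M)" by auto
  have F: "space ?F = space M" "sets ?F = sigma_sets (space M) ?G"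
    unfolding natural_filtration_def by (rule space_measure_of[OF G], rule sets_measure_of[OF G])
  have "sigma_sets (space M) ?G \<subseteq> sets M"
    by (rule sets.sigma_sets_subset) (blast intro: measurable_sets[OF Xm])
  then have "subalgebra M ?F" by (simp add: subalgebra_def F)
  then interpret finite_measure_subalgebra M ?F by unfold_locales
  have Xs: "X s \<in> ?F \<rightarrow>\<^sub>M borel"
  proof (rule measurableI)
    fix A :: "'a set" assume "A \<in> sets borel"
    then show "X s -` A \<inter> space ?F \<in> sets ?F" unfolding F using s by (intro sigma_sets.Basic) blast
  qed simp
  have m: "(\<lambda>\<omega>. f (X (s + u) \<omega>)) \<in> borel_measurable M" "(\<lambda>\<omega>. g (X s \<omega>)) \<in> borel_measurable M"
    using measurable_compose[OF Xs_m g] measurable_compose[OF Xm[of "s + u"] f] s u by auto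
  have "\<bar>g x * f y\<bar> \<le> c' * c" for x y
    unfolding abs_mult using fc gc order_trans[OF abs_ge_zero gc] by (intro mult_mono) auto
  then have "integrable M (\<lambda>\<omega>. g (X s \<omega>) * f (X (s + u) \<omega>))"
    using m by (intro integrable_const_bound[of _ "c' * c"]) auto
  from real_cond_exp_intg(2)[OF this measurable_compose[OF Xs g] m(1)]
  have "(\<integral>\<omega>. g (X s \<omega>) * f (X (s + u) \<omega>) \<partial>M) = (\<integral>\<omega>. g (X s \<omega>) * real_cond_exp M ?F (\<lambda>\<omega>. f (X (s + u) \<omega>)) \<omega> \<partial>M)"
    by simp
  also have "\<dots> = (\<integral>\<omega>. g (X s \<omega>) * kernel_op (P u) f (X s \<omega>) \<partial>M)"
  proof (rule integral_cong_AE)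
    have "bounded (range f)" using fc by (auto simp: bounded_iff)
    then have "AE \<omega> in M. real_cond_exp M ?F (\<lambda>\<omega>'. f (X (s + u) \<omega>')) \<omega> = kernel_op (P u) f (X s \<omega>)"
      using X s u f by (simp add: markov_process_def)
    then show "AE \<omega> in M. g (X s \<omega>) * real_cond_exp M ?F (\<lambda>\<omega>. f (X (s + u) \<omega>)) \<omega> = g (X s \<omega>) * kernel_op (P u) f (X s \<omega>)"
      by eventually_elim simp
    have [measurable]: "kernel_op (P u) f \<in> borel_measurable borel" by (rule kernel_op_measurable[OF P u f])
    show "(\<lambda>\<omega>. g (X s \<omega>) * kernel_op (P u) f (X s \<omega>)) \<in> borel_measurable M" by measurable
    have [measurable]: "real_cond_exp M ?F (\<lambda>\<omega>. f (X (s + u) \<omega>)) \<in> borel_measurable M" by (rule borel_measurable_cond_exp2)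
    show "(\<lambda>\<omega>. g (X s \<omega>) * real_cond_exp M ?F (\<lambda>\<omega>. f (X (s + u) \<omega>)) \<omega>) \<in> borel_measurable M" by measurable
  qed
  finally show ?thesis .
qed

lemma stationary_regime:
  fixes P :: "real \<Rightarrow> 'a::euclidean_space \<Rightarrow> 'a measure"
  assumes P: "markov_semigroup P" and \<nu>: "stationary_distribution P \<nu>" and X: "markov_process M P X"
    and X0: "distr M borel (X 0) = \<nu>" and s: "s \<ge> 0"
  shows "distr M borel (X s) = \<nu>"
proof -
  interpret prob_space M using X by (simp add: markov_process_def)
  interpret \<nu>: prob_space \<nu> using \<nu> by (simp add: stationary_distribution_def)
  have Xm: "X t \<in> borel_measurable M" if "t \<ge> 0" for t using X that by (simp add: markov_process_def)
  note Xs_m[measurable] = Xm[OF s]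
  have S: "sets \<nu> = sets borel" using \<nu> by (simp add: stationary_distribution_def)
  show ?thesis
  proof (rule measure_eqI)
    show "sets (distr M borel (X s)) = sets \<nu>" by (simp add: S)
    fix A assume "A \<in> sets (distr M borel (X s))"
    then have A[measurable]: "A \<in> sets borel" by simp
    let ?f = "indicat_real A"
    have f: "?f \<in> borel_measurable borel" "\<And>x. \<bar>?f x\<bar> \<le> 1" by (auto simp: indicator_def)
    have "measure (distr M borel (X s)) A = (\<integral>x. ?f x \<partial>distr M borel (X s))" by simp
    also have "\<dots> = (\<integral>\<omega>. ?f (X s \<omega>) \<partial>M)" by (intro integral_distr) measurable
    also have "\<dots> = (\<integral>\<omega>. kernel_op (P s) ?f (X 0 \<omega>) \<partial>M)"
      using markov_property_expectation[OF P X order_refl f, of "\<lambda>_. 1" 1 s] s by simp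
    also have "\<dots> = (\<integral>x. kernel_op (P s) ?f x \<partial>distr M borel (X 0))"
      by (rule integral_distr[symmetric]) (use kernel_op_measurable[OF P s f(1)] Xm[of 0] in auto)
    also have "\<dots> = (\<integral>x. ?f x \<partial>\<nu>)" unfolding X0 by (rule stationary_integral[OF P f \<nu> s])
    also have "\<dots> = measure \<nu> A" using A S by simp
    finally show "emeasure (distr M borel (X s)) A = emeasure \<nu> A"
      using finite_measure.emeasure_eq_measure[OF finite_measure_distr[OF Xm[OF s]]] \<nu>.emeasure_eq_measure by simp
  qed
qed

lemma abs_le_if_square_le: "x\<^sup>2 \<le> y\<^sup>2 \<Longrightarrow> 0 \<le> y \<Longrightarrow> \<bar>x\<bar> \<le> (y::real)"
  by (metis abs_le_square_iff abs_of_nonneg)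

text \<open>The covariance is \<open>\<integral> g \<cdot> P\<^sub>u g d\<nu>\<close>; Cauchy--Schwarz bounds it by the geometric mean of \<open>Var f\<close> and
  \<open>Var (P\<^sub>u f)\<close>, which halves the exponent of decay.\<close>

lemma stationary_covariance_bound:
  fixes P :: "real \<Rightarrow> 'a::euclidean_space \<Rightarrow> 'a measure"
  assumes P: "markov_semigroup P" and \<nu>: "stationary_distribution P \<nu>" and X: "markov_process M P X"
    and X0: "distr M borel (X 0) = \<nu>" and s: "s \<ge> 0" and u: "u \<ge> 0"
    and f[measurable]: "f \<in> borel_measurable borel" and fc: "\<And>x. \<bar>f x\<bar> \<le> (c::real)"
    and decay: "variance_wrt \<nu> (kernel_op (P u) f) \<le> 2 * exp (- \<theta> * u) * variance_wrt \<nu> f"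
  defines "g \<equiv> \<lambda>x. f x - (\<integral>y. f y \<partial>\<nu>)"
  shows "\<bar>\<integral>\<omega>. g (X s \<omega>) * g (X (s + u) \<omega>) \<partial>M\<bar> \<le> sqrt 2 * exp (- (\<theta> / 2) * u) * variance_wrt \<nu> f"
proof -
  interpret prob_space M using X by (simp add: markov_process_def)
  interpret \<nu>: prob_space \<nu> using \<nu> by (simp add: stationary_distribution_def)
  have Xm: "X t \<in> borel_measurable M" if "t \<ge> 0" for t using X that by (simp add: markov_process_def)
  note Xs_m[measurable] = Xm[OF s]
  have S[measurable_cong]: "sets \<nu> = sets borel" using \<nu> by (simp add: stationary_distribution_def)
  define a where "a = (\<integral>y. f y \<partial>\<nu>)"
  have g[measurable]: "g \<in> borel_measurable borel" unfolding g_def by measurable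
  have gc: "\<bar>g x\<bar> \<le> c + \<bar>a\<bar>" for x using fc[of x] unfolding g_def a_def[symmetric] by linarith
  let ?h = "kernel_op (P u) g"
  have h[measurable]: "?h \<in> borel_measurable borel" by (rule kernel_op_measurable[OF P u g])
  have hc: "\<bar>?h x\<bar> \<le> c + \<bar>a\<bar>" for x by (rule kernel_op_bounded[OF P g gc u])
  have heq: "?h x = kernel_op (P u) f x - a" for x
    unfolding g_def a_def[symmetric] by (rule kernel_op_diff_const[OF P f fc u])
  have sq: "y\<^sup>2 \<le> (c + \<bar>a\<bar>)\<^sup>2" if "\<bar>y\<bar> \<le> c + \<bar>a\<bar>" for y :: real
    using that by (auto simp: abs_le_square_iff[symmetric] intro!: order_trans[OF _ abs_ge_self])
  have "(\<integral>\<omega>. g (X s \<omega>) * g (X (s + u) \<omega>) \<partial>M) = (\<integral>\<omega>. g (X s \<omega>) * ?h (X s \<omega>) \<partial>M)"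
    by (rule markov_property_expectation[OF P X s g gc g gc u])
  also have "\<dots> = (\<integral>x. g x * ?h x \<partial>distr M borel (X s))"
    by (rule integral_distr[symmetric]) measurable
  also have "\<dots> = (\<integral>x. g x * ?h x \<partial>\<nu>)"
    by (simp add: stationary_regime[OF P \<nu> X X0 s])
  finally have eq: "(\<integral>\<omega>. g (X s \<omega>) * g (X (s + u) \<omega>) \<partial>M) = (\<integral>x. g x * ?h x \<partial>\<nu>)" .
  have "(\<integral>x. g x * ?h x \<partial>\<nu>)\<^sup>2 \<le> (\<integral>x. (g x)\<^sup>2 \<partial>\<nu>) * (\<integral>x. (?h x)\<^sup>2 \<partial>\<nu>)"
  proof (rule square_integral_mult_le)
    show "integrable \<nu> (\<lambda>x. (g x)\<^sup>2)" "integrable \<nu> (\<lambda>x. (?h x)\<^sup>2)"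
      by (auto intro!: \<nu>.integrable_const_bound[of _ "(c + \<bar>a\<bar>)\<^sup>2"] AE_I2 simp: sq gc hc)
    show "integrable \<nu> (\<lambda>x. g x * ?h x)"
      using gc hc by (intro \<nu>.integrable_const_bound[of _ "(c + \<bar>a\<bar>) * (c + \<bar>a\<bar>)"] AE_I2)
         (auto simp: abs_mult intro!: mult_mono order_trans[OF abs_ge_zero gc])
  qed
  also have "(\<integral>x. (g x)\<^sup>2 \<partial>\<nu>) = variance_wrt \<nu> f" by (simp add: variance_wrt_def g_def)
  also have "(\<integral>x. (?h x)\<^sup>2 \<partial>\<nu>) = variance_wrt \<nu> (kernel_op (P u) f)"
    unfolding variance_wrt_def heq stationary_integral[OF P f fc \<nu> u] a_def ..
  also have "variance_wrt \<nu> f * \<dots> \<le> variance_wrt \<nu> f * (2 * exp (- \<theta> * u) * variance_wrt \<nu> f)"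
    by (intro mult_left_mono decay) (simp add: variance_wrt_def)
  also have "\<dots> = (sqrt 2 * exp (- (\<theta> / 2) * u) * variance_wrt \<nu> f)\<^sup>2"
    by (simp add: power_mult_distrib exp_double[symmetric] power2_eq_square[of "variance_wrt \<nu> f"])
  finally have "(\<integral>x. g x * ?h x \<partial>\<nu>)\<^sup>2 \<le> (sqrt 2 * exp (- (\<theta> / 2) * u) * variance_wrt \<nu> f)\<^sup>2" .
  moreover have "0 \<le> sqrt 2 * exp (- (\<theta> / 2) * u) * variance_wrt \<nu> f" by (simp add: variance_wrt_def)
  ultimately show ?thesis unfolding eq by (rule abs_le_if_square_le)
qed

section \<open>Occupation measures in the stationary regime\<close>

text \<open>Right-continuous paths are limits of the processes that are frozen on a grid of mesh \<open>1 / Suc n\<close> at the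
  next grid point strictly to the right, and these depend on time through countably many values. Negative times are
  mapped to 0, so that the process is defined on the whole line.\<close>

lemma right_continuous_jointly_measurable:
  fixes X :: "real \<Rightarrow> 'w \<Rightarrow> 'a::euclidean_space"
  assumes X: "\<And>t. t \<ge> 0 \<Longrightarrow> X t \<in> borel_measurable M" and rc: "right_continuous_paths M X"
  shows "(\<lambda>z :: 'w \<times> real. X (max 0 (snd z)) (fst z)) \<in> borel_measurable (M \<Otimes>\<^sub>M borel)"
proof (rule borel_measurable_LIMSEQ_metric)
  let ?Y = "\<lambda>n (z :: 'w \<times> real). X (real (Suc (nat \<lfloor>real (Suc n) * max 0 (snd z)\<rfloor>)) / real (Suc n)) (fst z)"
  show "?Y n \<in> borel_measurable (M \<Otimes>\<^sub>M borel)" for n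
  proof (rule measurable_compose_countable[of "\<lambda>i z. X (real (Suc i) / real (Suc n)) (fst z)"])
    show "(\<lambda>z. X (real (Suc i) / real (Suc n)) (fst z)) \<in> borel_measurable (M \<Otimes>\<^sub>M borel)" for i
      by (rule measurable_compose[OF measurable_fst X]) simp
    show "(\<lambda>z. nat \<lfloor>real (Suc n) * max 0 (snd z)\<rfloor>) \<in> M \<Otimes>\<^sub>M borel \<rightarrow>\<^sub>M count_space UNIV"
      by measurable
  qed
  fix z :: "'w \<times> real" assume "z \<in> space (M \<Otimes>\<^sub>M borel)"
  then have w: "fst z \<in> space M" by (auto simp: space_pair_measure)
  define s where "s = max 0 (snd z)"
  have s: "s \<ge> 0" by (simp add: s_def)
  define r where "r n = real (Suc (nat \<lfloor>real (Suc n) * s\<rfloor>)) / real (Suc n)" for n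
  have r: "s < r n" "r n \<le> s + 1 / real (Suc n)" for n
  proof -
    define N where "N = real (Suc n)"
    define k where "k = real (Suc (nat \<lfloor>N * s\<rfloor>))"
    have N: "N > 0" by (simp add: N_def)
    then have "0 \<le> N * s" using s by simp
    then have k: "N * s < k" "k \<le> N * s + 1" unfolding k_def by linarith+
    have rk: "r n = k / N" by (simp only: r_def k_def N_def)
    show "s < r n" "r n \<le> s + 1 / real (Suc n)"
      unfolding rk N_def[symmetric] using k N by (simp_all add: field_simps)
  qed
  have "r \<longlonglongrightarrow> s"
  proof (rule tendsto_sandwich[of "\<lambda>_. s" r sequentially "\<lambda>n. s + 1 / real (Suc n)"])
    show "(\<lambda>n. s + 1 / real (Suc n)) \<longlonglongrightarrow> s"
      using tendsto_add[OF tendsto_const[of s] LIMSEQ_inverse_real_of_nat] by (simp add: inverse_eq_divide)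
  qed (use r less_imp_le[OF r(1)] in auto)
  then have "filterlim r (at_right s) sequentially"
    using r(1) by (auto simp: filterlim_at less_imp_neq[THEN not_sym] intro!: always_eventually)
  moreover have "((\<lambda>u. X u (fst z)) \<longlongrightarrow> X s (fst z)) (at_right s)"
    using rc w s by (auto simp: right_continuous_paths_def continuous_within)
  ultimately have "(\<lambda>n. X (r n) (fst z)) \<longlonglongrightarrow> X s (fst z)"
    by (rule filterlim_compose[rotated])
  then show "(\<lambda>n. ?Y n z) \<longlonglongrightarrow> X (max 0 (snd z)) (fst z)" by (simp only: r_def s_def)
qed

lemma prob_space_uniform_Icc: "t > 0 \<Longrightarrow> prob_space (uniform_measure lborel {0..t::real})"
  by (rule prob_space_uniform_measure) auto

text \<open>The occupation measure is the law of the path at a uniformly chosen time, and is thus known to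
  be countably additive.\<close>

lemma occupation_measure_eq_distr:
  fixes X :: "real \<Rightarrow> 'w \<Rightarrow> 'a::euclidean_space"
  assumes m: "(\<lambda>s. X (max 0 s) \<omega>) \<in> borel_measurable borel" and t: "t > 0"
  shows "occupation_measure X t \<omega> = distr (uniform_measure lborel {0..t}) borel (\<lambda>s. X (max 0 s) \<omega>)"
    (is "_ = ?D")
proof -
  note m[measurable]
  have "occupation_measure X t \<omega> = measure_of UNIV (sets borel) (emeasure ?D)"
    unfolding occupation_measure_def
  proof (rule measure_of_eq)
    fix A :: "'a set" assume "A \<in> sigma_sets UNIV (sets borel)"
    then have A[measurable]: "A \<in> sets borel" using sets.sigma_sets_eq[of "borel :: 'a measure"] by simp
    have pre[measurable]: "(\<lambda>s. X (max 0 s) \<omega>) -` A \<in> sets borel" using measurable_sets[OF m A] by simp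
    have "emeasure ?D A = emeasure lborel ({0..t} \<inter> (\<lambda>s. X (max 0 s) \<omega>) -` A) / emeasure lborel {0..t}"
      by (subst emeasure_distr) auto
    also have "\<dots> = ennreal (1 / t) * emeasure lborel ({0..t} \<inter> (\<lambda>s. X (max 0 s) \<omega>) -` A)"
      using t by (simp add: divide_ennreal_def inverse_ennreal mult.commute inverse_eq_divide)
    also have "emeasure lborel ({0..t} \<inter> (\<lambda>s. X (max 0 s) \<omega>) -` A) = (\<integral>\<^sup>+s. indicator ({0..t} \<inter> (\<lambda>s. X (max 0 s) \<omega>) -` A) s \<partial>lborel)"
      by (rule nn_integral_indicator[symmetric]) simp
    also have "\<dots> = (\<integral>\<^sup>+s\<in>{0..t}. emeasure (return borel (X s \<omega>)) A \<partial>lborel)"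
      by (intro nn_integral_cong) (auto simp: indicator_def)
    finally show "ennreal (1 / t) * (\<integral>\<^sup>+s\<in>{0..t}. emeasure (return borel (X s \<omega>)) A \<partial>lborel) = emeasure ?D A" ..
  qed auto
  also have "\<dots> = ?D" using measure_of_of_measure[of ?D] by simp
  finally show ?thesis .
qed

lemma occupation_measure_time_average:
  fixes X :: "real \<Rightarrow> 'w \<Rightarrow> 'a::euclidean_space"
  assumes m: "(\<lambda>s. X (max 0 s) \<omega>) \<in> borel_measurable borel" and t: "t > 0" and A: "A \<in> sets borel"
  shows "measure (occupation_measure X t \<omega>) A =
    (\<integral>s. indicat_real A (X (max 0 s) \<omega>) \<partial>uniform_measure lborel {0..t})"
proof -
  have "measure (occupation_measure X t \<omega>) A =
      (\<integral>x. indicat_real A x \<partial>distr (uniform_measure lborel {0..t}) borel (\<lambda>s. X (max 0 s) \<omega>))"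
    using A by (simp add: occupation_measure_eq_distr[where X=X, OF m t])
  also have "\<dots> = (\<integral>s. indicat_real A (X (max 0 s) \<omega>) \<partial>uniform_measure lborel {0..t})"
    by (rule integral_distr) (use m A in \<open>auto cong: measurable_cong_sets\<close>)
  finally show ?thesis .
qed

lemma occupation_measure_random:
  fixes X :: "real \<Rightarrow> 'w \<Rightarrow> 'a::euclidean_space"
  assumes X: "\<And>t. t \<ge> 0 \<Longrightarrow> X t \<in> borel_measurable M" and rc: "right_continuous_paths M X" and t: "t > 0"
  shows "\<And>\<omega>. \<omega> \<in> space M \<Longrightarrow> prob_space (occupation_measure X t \<omega>)"
    and "\<And>\<omega>. \<omega> \<in> space M \<Longrightarrow> sets (occupation_measure X t \<omega>) = sets borel"
    and "\<And>A. A \<in> sets borel \<Longrightarrow> (\<lambda>\<omega>. measure (occupation_measure X t \<omega>) A) \<in> borel_measurable M"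
proof -
  let ?U = "uniform_measure lborel {0..t}"
  interpret U: prob_space ?U by (rule prob_space_uniform_Icc[OF t])
  have Z: "(\<lambda>z. X (max 0 (snd z)) (fst z)) \<in> borel_measurable (M \<Otimes>\<^sub>M borel)"
    by (rule right_continuous_jointly_measurable[OF X rc])
  have Zm[measurable]: "(\<lambda>z. X (max 0 (snd z)) (fst z)) \<in> borel_measurable (M \<Otimes>\<^sub>M ?U)"
    using Z by (simp cong: measurable_cong_sets sets_pair_measure_cong)
  have m: "(\<lambda>s. X (max 0 s) \<omega>) \<in> borel_measurable borel" if "\<omega> \<in> space M" for \<omega>
    using measurable_compose[OF measurable_Pair1'[OF that] Z] by simp
  have eq: "occupation_measure X t \<omega> = distr ?U borel (\<lambda>s. X (max 0 s) \<omega>)" if "\<omega> \<in> space M" for \<omega>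
    by (rule occupation_measure_eq_distr[where X=X, OF m[OF that] t])
  have m': "(\<lambda>s. X (max 0 s) \<omega>) \<in> ?U \<rightarrow>\<^sub>M borel" if "\<omega> \<in> space M" for \<omega>
    using m[OF that] by (simp cong: measurable_cong_sets)
  show "prob_space (occupation_measure X t \<omega>)" if "\<omega> \<in> space M" for \<omega>
    unfolding eq[OF that] by (rule U.prob_space_distr[OF m'[OF that]])
  show "sets (occupation_measure X t \<omega>) = sets borel" if "\<omega> \<in> space M" for \<omega>
    unfolding eq[OF that] by simp
  fix A :: "'a set" assume [measurable]: "A \<in> sets borel"
  have "(\<lambda>\<omega>. \<integral>s. indicat_real A (X (max 0 s) \<omega>) \<partial>?U) \<in> borel_measurable M" by measurable
  moreover have "measure (occupation_measure X t \<omega>) A = (\<integral>s. indicat_real A (X (max 0 s) \<omega>) \<partial>?U)" if "\<omega> \<in> space M" for \<omega>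
    by (rule occupation_measure_time_average[where X=X, OF m[OF that] t]) simp
  ultimately show "(\<lambda>\<omega>. measure (occupation_measure X t \<omega>) A) \<in> borel_measurable M"
    by (simp cong: measurable_cong)
qed

lemma nn_integral_exp_decay:
  fixes \<theta> :: real assumes "\<theta> > 0"
  shows "(\<integral>\<^sup>+x. ennreal (exp (- \<theta> * \<bar>x - u\<bar>)) \<partial>lborel) \<le> ennreal (2 / \<theta>)"
proof -
  have half: "(\<integral>\<^sup>+x. ennreal (exp (- \<theta> * x)) * indicator {0..} x \<partial>lborel) = ennreal (1 / \<theta>)"
  proof -
    have lim: "((\<lambda>x. - exp (- \<theta> * x) / \<theta>) \<longlongrightarrow> - 0 / \<theta>) at_top"
      using assms
      by (intro tendsto_intros filterlim_compose[OF exp_at_bot]) 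
         (auto simp: filterlim_uminus_at_top[symmetric] intro!: filterlim_tendsto_pos_mult_at_top[OF tendsto_const] filterlim_ident)
    have "(\<integral>\<^sup>+x. ennreal (exp (- \<theta> * x)) * indicator {0..} x \<partial>lborel) = ennreal (- 0 / \<theta> - (- exp (- \<theta> * 0) / \<theta>))"
      by (rule nn_integral_FTC_atLeast[OF _ _ _ lim]) (use assms in \<open>auto intro!: derivative_eq_intros\<close>)
    then show ?thesis by simp
  qed
  have "(\<integral>\<^sup>+x. ennreal (exp (- \<theta> * \<bar>x - u\<bar>)) \<partial>lborel) = (\<integral>\<^sup>+x. ennreal (exp (- \<theta> * \<bar>x\<bar>)) \<partial>lborel)"
    using nn_integral_real_affine[of "\<lambda>x. ennreal (exp (- \<theta> * \<bar>x - u\<bar>))" 1 u] by simp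
  also have "\<dots> \<le> (\<integral>\<^sup>+x. ennreal (exp (- \<theta> * x)) * indicator {0..} x + ennreal (exp (- \<theta> * (- x))) * indicator {0..} (- x) \<partial>lborel)"
    by (intro nn_integral_mono) (auto simp: indicator_def)
  also have "\<dots> = (\<integral>\<^sup>+x. ennreal (exp (- \<theta> * x)) * indicator {0..} x \<partial>lborel) + (\<integral>\<^sup>+x. ennreal (exp (- \<theta> * (- x))) * indicator {0..} (- x) \<partial>lborel)"
    by (rule nn_integral_add) auto
  also have "(\<integral>\<^sup>+x. ennreal (exp (- \<theta> * (- x))) * indicator {0..} (- x) \<partial>lborel) = (\<integral>\<^sup>+x. ennreal (exp (- \<theta> * x)) * indicator {0..} x \<partial>lborel)"
    using nn_integral_real_affine[of "\<lambda>x. ennreal (exp (- \<theta> * x)) * indicator {0..} x" "-1" 0] by simp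
  also have "(\<integral>\<^sup>+x. ennreal (exp (- \<theta> * x)) * indicator {0..} x \<partial>lborel) + (\<integral>\<^sup>+x. ennreal (exp (- \<theta> * x)) * indicator {0..} x \<partial>lborel) = ennreal (2 / \<theta>)"
    unfolding half using assms by (simp flip: ennreal_plus)
  finally show ?thesis .
qed

lemma uniform_integral_exp_decay:
  fixes \<theta> :: real assumes "\<theta> > 0" "t > 0"
  shows "(\<integral>x. exp (- \<theta> * \<bar>x - u\<bar>) \<partial>uniform_measure lborel {0..t}) \<le> 2 / (\<theta> * t)"
proof -
  interpret U: prob_space "uniform_measure lborel {0..t}" by (rule prob_space_uniform_Icc[OF assms(2)])
  have i: "integrable (uniform_measure lborel {0..t}) (\<lambda>x. exp (- \<theta> * \<bar>x - u\<bar>))"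
    by (rule U.integrable_const_bound[of _ 1]) (use assms in auto)
  have "ennreal (\<integral>x. exp (- \<theta> * \<bar>x - u\<bar>) \<partial>uniform_measure lborel {0..t}) = (\<integral>\<^sup>+x. ennreal (exp (- \<theta> * \<bar>x - u\<bar>)) \<partial>uniform_measure lborel {0..t})"
    by (rule nn_integral_eq_integral[OF i, symmetric]) simp
  also have "\<dots> = (\<integral>\<^sup>+x. ennreal (exp (- \<theta> * \<bar>x - u\<bar>)) * indicator {0..t} x \<partial>lborel) / ennreal t"
    using assms(2) by (subst nn_integral_uniform_measure) auto
  also have "\<dots> \<le> ennreal (2 / \<theta>) / ennreal t"
    by (intro divide_right_mono_ennreal order_trans[OF nn_integral_mono nn_integral_exp_decay[OF assms(1), of u]]) (auto simp: indicator_def)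
  also have "\<dots> = ennreal (2 / (\<theta> * t))" using assms by (simp add: divide_ennreal)
  finally show ?thesis using assms by (subst (asm) ennreal_le_iff) auto
qed

text \<open>The second moment of a time average is the double time average of the correlations: the square
  is written as \<open>\<integral> G (\<omega>, u) * Y \<omega> dU(u)\<close> and Fubini's theorem is applied once for each
  factor.\<close>

lemma double_time_average:
  fixes G :: "'w \<times> real \<Rightarrow> real"
  assumes "prob_space M" "prob_space U" and G[measurable]: "G \<in> borel_measurable (M \<Otimes>\<^sub>M U)"
    and Gc: "\<And>z. \<bar>G z\<bar> \<le> 1" and J[measurable]: "(\<lambda>(u, s). J u s) \<in> borel_measurable (U \<Otimes>\<^sub>M U)" 
    and J1: "\<And>u s. \<bar>J u s\<bar> \<le> (c::real)"
    and cov: "AE u in U. AE s in U. (\<integral>\<omega>. G (\<omega>, u) * G (\<omega>, s) \<partial>M) \<le> J u s"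
    and JB: "\<And>u. (\<integral>s. J u s \<partial>U) \<le> B"
  shows "(\<integral>\<omega>. (\<integral>s. G (\<omega>, s) \<partial>U)\<^sup>2 \<partial>M) \<le> B"
proof -
  interpret M: prob_space M by fact
  interpret U: prob_space U by fact
  interpret MU: pair_prob_space M U ..
  interpret UU: pair_prob_space U U ..
  define Y where "Y \<omega> = (\<integral>s. G (\<omega>, s) \<partial>U)" for \<omega>
  have Ym[measurable]: "Y \<in> borel_measurable M" unfolding Y_def by measurable
  have Yc: "\<bar>Y \<omega>\<bar> \<le> 1" for \<omega>
  proof -
    have "\<bar>Y \<omega>\<bar> \<le> (\<integral>s. \<bar>G (\<omega>, s)\<bar> \<partial>U)" unfolding Y_def by (rule integral_abs_bound)
    also have "\<dots> \<le> (\<integral>s. 1 \<partial>U)"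
    proof (rule integral_mono')
      show "integrable U (\<lambda>s. 1::real)" by simp
    qed (use Gc in auto)
    finally show ?thesis by (simp add: U.prob_space)
  qed
  have prod1: "\<bar>a * b\<bar> \<le> 1" if "\<bar>a\<bar> \<le> 1" "\<bar>b\<bar> \<le> (1::real)" for a b
    using mult_mono[OF that] by (simp add: abs_mult)
  define H where "H u s = (\<integral>\<omega>. G (\<omega>, u) * G (\<omega>, s) \<partial>M)" for u s
  have Hm[measurable]: "(\<lambda>z. H (fst z) (snd z)) \<in> borel_measurable (U \<Otimes>\<^sub>M U)"
    unfolding H_def by measurable
  have Hc: "\<bar>H u s\<bar> \<le> 1" for u s
  proof -
    have "\<bar>H u s\<bar> \<le> (\<integral>\<omega>. \<bar>G (\<omega>, u) * G (\<omega>, s)\<bar> \<partial>M)" unfolding H_def by (rule integral_abs_bound)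
    also have "\<dots> \<le> (\<integral>\<omega>. 1 \<partial>M)"
    proof (rule integral_mono')
      show "integrable M (\<lambda>s. 1::real)" by simp
    qed (use Gc prod1 in auto)
    finally show ?thesis by (simp add: M.prob_space)
  qed
  have "(\<integral>\<omega>. (Y \<omega>)\<^sup>2 \<partial>M) = (\<integral>\<omega>. (\<integral>u. G (\<omega>, u) * Y \<omega> \<partial>U) \<partial>M)"
    by (simp add: power2_eq_square Y_def)
  also have "\<dots> = (\<integral>u. (\<integral>\<omega>. G (\<omega>, u) * Y \<omega> \<partial>M) \<partial>U)"
  proof (rule MU.Fubini_integral[symmetric])
    show "integrable (M \<Otimes>\<^sub>M U) (\<lambda>(\<omega>, u). G (\<omega>, u) * Y \<omega>)"
      by (rule MU.P.integrable_const_bound[of _ 1]) (auto intro!: prod1 Gc Yc)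
  qed
  also have "\<dots> = (\<integral>u. (\<integral>s. H u s \<partial>U) \<partial>U)"
  proof (rule Bochner_Integration.integral_cong[OF refl])
    fix u assume u: "u \<in> space U"
    have "(\<integral>\<omega>. G (\<omega>, u) * Y \<omega> \<partial>M) = (\<integral>\<omega>. (\<integral>s. G (\<omega>, u) * G (\<omega>, s) \<partial>U) \<partial>M)"
      by (simp add: Y_def)
    also have "\<dots> = (\<integral>s. (\<integral>\<omega>. G (\<omega>, u) * G (\<omega>, s) \<partial>M) \<partial>U)"
    proof (rule MU.Fubini_integral[symmetric])
      have [measurable]: "(\<lambda>\<omega>. G (\<omega>, u)) \<in> borel_measurable M" using u by measurable
      show "integrable (M \<Otimes>\<^sub>M U) (\<lambda>(\<omega>, s). G (\<omega>, u) * G (\<omega>, s))"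
        by (rule MU.P.integrable_const_bound[of _ 1]) (auto intro!: prod1 Gc)
    qed
    finally show "(\<integral>\<omega>. G (\<omega>, u) * Y \<omega> \<partial>M) = (\<integral>s. H u s \<partial>U)" by (simp add: H_def)
  qed
  also have "\<dots> \<le> (\<integral>u. B \<partial>U)"
  proof (rule integral_mono_AE)
    have iH: "integrable (U \<Otimes>\<^sub>M U) (\<lambda>(u, s). H u s)"
      by (rule UU.P.integrable_const_bound[of _ 1]) (use Hc Hm in \<open>auto simp: case_prod_beta\<close>)
    show "integrable U (\<lambda>u. \<integral>s. H u s \<partial>U)" using UU.integrable_fst[OF iH] by simp
    show "AE u in U. (\<integral>s. H u s \<partial>U) \<le> B"
      using cov AE_space
    proof eventually_elim
      case (elim u)
      have [measurable]: "(\<lambda>s. J u s) \<in> borel_measurable U" "(\<lambda>s. H u s) \<in> borel_measurable U"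
        using measurable_compose[OF measurable_Pair1'[OF elim(2)] J] measurable_compose[OF measurable_Pair1'[OF elim(2)] Hm] by simp_all
      have "(\<integral>s. H u s \<partial>U) \<le> (\<integral>s. J u s \<partial>U)"
      proof (rule integral_mono_AE)
        show "integrable U (H u)" by (rule U.integrable_const_bound[of _ 1]) (use Hc in auto)
        show "integrable U (J u)" by (rule U.integrable_const_bound[of _ c]) (use J1 in auto)
        show "AE s in U. H u s \<le> J u s" using elim by (simp add: H_def)
      qed
      also have "\<dots> \<le> B" by (rule JB)
      finally show ?case .
    qed
  qed simp
  also have "\<dots> = B" by (simp add: U.prob_space)
  finally show ?thesis unfolding Y_def .
qed

text \<open>The bound by \<open>measure \<nu> A\<close> comes from \<open>|\<nu>\<^sub>t(A) - \<nu>(A)| \<le> \<nu>\<^sub>t(A) + \<nu>(A)\<close> and stationarity;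
  the bound by its square root comes from the second moment, since the exponentially decaying
  covariances have a double time average of order \<open>1 / t\<close>.\<close>

lemma occupation_property_A:
  fixes P :: "real \<Rightarrow> 'a::euclidean_space \<Rightarrow> 'a measure"
  assumes P: "markov_semigroup P" and \<nu>: "stationary_distribution P \<nu>" and X: "markov_process M P X"
    and X0: "distr M borel (X 0) = \<nu>" and rc: "right_continuous_paths M X"
    and e: "e absolutely_integrable_on {0..}"
    and dec: "\<And>t f. t \<ge> 0 \<Longrightarrow> f \<in> L2 \<nu> \<Longrightarrow> variance_wrt \<nu> (kernel_op (P t) f) \<le> e t * variance_wrt \<nu> f"
  shows "\<exists>C>0. \<forall>t>0. \<forall>A\<in>sets borel.
        (\<integral>\<^sup>+\<omega>. ennreal \<bar>measure (occupation_measure X t \<omega>) A - measure \<nu> A\<bar> \<partial>M)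
          \<le> ennreal (C * min (measure \<nu> A) (measure \<nu> A powr (1/2) * t powr (- (1/2))))"
proof -
  interpret prob_space M using X by (simp add: markov_process_def)
  interpret \<nu>: prob_space \<nu> using \<nu> by (simp add: stationary_distribution_def)
  have S[measurable_cong]: "sets \<nu> = sets borel" using \<nu> by (simp add: stationary_distribution_def)
  have Xm: "X t \<in> borel_measurable M" if "t \<ge> 0" for t using X that by (simp add: markov_process_def)
  have Z: "(\<lambda>z. X (max 0 (snd z)) (fst z)) \<in> borel_measurable (M \<Otimes>\<^sub>M borel)"
    by (rule right_continuous_jointly_measurable[OF Xm rc])
  obtain \<theta> where \<theta>: "\<theta> > 0" and decay: "\<And>f c t. f \<in> borel_measurable borel \<Longrightarrow> (\<And>x. \<bar>f x\<bar> \<le> c) \<Longrightarrow> t \<ge> 0 \<Longrightarrow> 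
    variance_wrt \<nu> (kernel_op (P t) f) \<le> 2 * exp (- \<theta> * t) * variance_wrt \<nu> f"
    using variance_exponential_decay[OF P \<nu> e dec] by blast
  define C where "C = max 2 (sqrt (sqrt 2 * 4 / \<theta>))"
  show ?thesis
  proof (intro exI[of _ C] conjI allI impI ballI)
    show "C > 0" by (simp add: C_def)
    fix t :: real and A :: "'a set" assume t: "t > 0" and A[measurable]: "A \<in> sets borel"
    let ?U = "uniform_measure lborel {0..t}"
    let ?f = "indicat_real A"
    interpret U: prob_space ?U by (rule prob_space_uniform_Icc[OF t])
    interpret MU: pair_prob_space M ?U ..
    have [simp]: "U.prob UNIV = 1" using U.prob_space by simp
    have f: "?f \<in> borel_measurable borel" "\<And>x. \<bar>?f x\<bar> \<le> 1" by (auto simp: indicator_def)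
    define a where "a = measure \<nu> A"
    have a: "0 \<le> a" "a \<le> 1" by (auto simp: a_def)
    have int: "(\<integral>x. ?f x \<partial>\<nu>) = a" using S by (simp add: a_def)
    have var: "0 \<le> variance_wrt \<nu> ?f" "variance_wrt \<nu> ?f \<le> a"
    proof -
      show "0 \<le> variance_wrt \<nu> ?f" by (simp add: variance_wrt_def)
      have "(\<lambda>x. (?f x)\<^sup>2) = ?f" by (auto simp: indicator_def)
      then have "variance_wrt \<nu> ?f = a - a\<^sup>2"
        using variance_wrt_bounded[OF P \<nu>.prob_space_axioms S f] int by simp
      then show "variance_wrt \<nu> ?f \<le> a" by simp
    qed
    define G where "G z = ?f (X (max 0 (snd z)) (fst z)) - a" for z
    have Zm[measurable]: "(\<lambda>z. X (max 0 (snd z)) (fst z)) \<in> borel_measurable (M \<Otimes>\<^sub>M ?U)"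
      using Z by (simp cong: measurable_cong_sets sets_pair_measure_cong)
    have Gm[measurable]: "G \<in> borel_measurable (M \<Otimes>\<^sub>M ?U)" unfolding G_def by measurable
    have Gc: "\<bar>G z\<bar> \<le> 1" for z using a by (auto simp: G_def indicator_def)
    define Y where "Y \<omega> = (\<integral>s. G (\<omega>, s) \<partial>?U)" for \<omega>
    have [measurable]: "Y \<in> borel_measurable M" unfolding Y_def by measurable
    have occ: "measure (occupation_measure X t \<omega>) A = (\<integral>s. ?f (X (max 0 s) \<omega>) \<partial>?U)" 
      and Yeq: "Y \<omega> = measure (occupation_measure X t \<omega>) A - a" if w: "\<omega> \<in> space M" for \<omega>
    proof -
      have m[measurable]: "(\<lambda>s. X (max 0 s) \<omega>) \<in> borel_measurable borel"
        using measurable_compose[OF measurable_Pair1'[OF w] Z] by simp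
      show "measure (occupation_measure X t \<omega>) A = (\<integral>s. ?f (X (max 0 s) \<omega>) \<partial>?U)"
        by (rule occupation_measure_time_average[where X=X, OF m t A])
      moreover have "integrable ?U (\<lambda>s. ?f (X (max 0 s) \<omega>))"
        by (rule U.integrable_const_bound[of _ 1]) (auto cong: measurable_cong_sets)
      ultimately show "Y \<omega> = measure (occupation_measure X t \<omega>) A - a"
        by (simp add: Y_def G_def U.prob_space)
    qed
    define J where "J u s = sqrt 2 * exp (- (\<theta> / 2) * \<bar>s - u\<bar>) * a" for u s :: real
    have cov: "(\<integral>\<omega>. G (\<omega>, u) * G (\<omega>, s) \<partial>M) \<le> J u s" if "0 \<le> u" "0 \<le> s" for u s
    proof -
      have *: "(\<integral>\<omega>. G (\<omega>, u) * G (\<omega>, s) \<partial>M) \<le> J u s" if us: "0 \<le> u" "u \<le> s" for u s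
      proof -
        have "\<bar>\<integral>\<omega>. (?f (X u \<omega>) - a) * (?f (X (u + (s - u)) \<omega>) - a) \<partial>M\<bar> \<le> sqrt 2 * exp (- (\<theta> / 2) * (s - u)) * variance_wrt \<nu> ?f"
          unfolding int[symmetric]
          by (rule stationary_covariance_bound[OF P \<nu> X X0 us(1) _ f decay[OF f]]) (use us in auto)
        also have "\<dots> \<le> sqrt 2 * exp (- (\<theta> / 2) * (s - u)) * a" using var by (intro mult_left_mono) auto
        finally show ?thesis using us by (simp add: G_def J_def)
      qed
      show ?thesis
      proof (cases "u \<le> s")
        case True then show ?thesis using * that by simp
      next
        case False 
        then have "(\<integral>\<omega>. G (\<omega>, s) * G (\<omega>, u) \<partial>M) \<le> J s u" using *[of s u] that by simp
        then show ?thesis by (simp add: mult.commute J_def abs_minus_commute)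
      qed
    qed
    have "(\<integral>\<omega>. (Y \<omega>)\<^sup>2 \<partial>M) \<le> sqrt 2 * a * (2 / ((\<theta> / 2) * t))"
      unfolding Y_def
    proof (rule double_time_average[OF prob_space_axioms U.prob_space_axioms Gm Gc, of J "sqrt 2"])
      show "(\<lambda>(u, s). J u s) \<in> borel_measurable (?U \<Otimes>\<^sub>M ?U)" unfolding J_def by measurable
      fix u s
      have "exp (- (\<theta> / 2) * \<bar>s - u\<bar>) * a \<le> 1 * 1" using a \<theta> by (intro mult_mono) auto
      then show "\<bar>J u s\<bar> \<le> sqrt 2" using a by (simp add: J_def abs_mult mult.assoc)
      have "(\<integral>s. J u s \<partial>?U) = sqrt 2 * a * (\<integral>s. exp (- (\<theta> / 2) * \<bar>s - u\<bar>) \<partial>?U)"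
        by (simp add: J_def mult.assoc mult.left_commute mult.commute[of _ a])
      also have "\<dots> \<le> sqrt 2 * a * (2 / ((\<theta> / 2) * t))"
        using a \<theta> t by (intro mult_left_mono uniform_integral_exp_decay) auto
      finally show "(\<integral>s. J u s \<partial>?U) \<le> sqrt 2 * a * (2 / ((\<theta> / 2) * t))" .
    next
      have "AE u in ?U. 0 \<le> u" by (rule AE_uniform_measureI) auto
      then show "AE u in ?U. AE s in ?U. (\<integral>\<omega>. G (\<omega>, u) * G (\<omega>, s) \<partial>M) \<le> J u s"
      proof eventually_elim
        case (elim u)
        have "AE s in ?U. 0 \<le> s" by (rule AE_uniform_measureI) auto
        then show ?case by eventually_elim (rule cov[OF elim])
      qed
    qed
    also have "sqrt 2 * a * (2 / ((\<theta> / 2) * t)) = (sqrt 2 * 4 / \<theta>) * (a / t)" by (simp add: field_simps)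
    finally have Y2: "(\<integral>\<omega>. (Y \<omega>)\<^sup>2 \<partial>M) \<le> (sqrt 2 * 4 / \<theta>) * (a / t)" .
    have Yc: "\<bar>Y \<omega>\<bar> \<le> 1" if "\<omega> \<in> space M" for \<omega>
    proof -
      have "measure (occupation_measure X t \<omega>) A = (\<integral>s. ?f (X (max 0 s) \<omega>) \<partial>?U)" by (rule occ[OF that])
      moreover have "(\<integral>s. ?f (X (max 0 s) \<omega>) \<partial>?U) \<le> (\<integral>s. 1 \<partial>?U)" by (rule integral_mono') (auto simp: indicator_def)
      then have "(\<integral>s. ?f (X (max 0 s) \<omega>) \<partial>?U) \<le> 1" by simp
      moreover have "0 \<le> (\<integral>s. ?f (X (max 0 s) \<omega>) \<partial>?U)" by simp
      ultimately show ?thesis using Yeq[OF that] a unfolding abs_le_iff by linarith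
    qed
    have iY: "integrable M (\<lambda>\<omega>. \<bar>Y \<omega>\<bar>)" by (rule integrable_const_bound[of _ 1]) (use Yc in auto)
    have "(\<integral>\<omega>. \<bar>Y \<omega>\<bar> \<partial>M)\<^sup>2 \<le> (\<integral>\<omega>. \<bar>Y \<omega>\<bar>\<^sup>2 \<partial>M)" by (rule square_expectation_le[of _ 1]) (use Yc in auto)
    also have "\<dots> \<le> (sqrt 2 * 4 / \<theta>) * (a / t)" using Y2 by simp
    finally have "(\<integral>\<omega>. \<bar>Y \<omega>\<bar> \<partial>M) \<le> sqrt ((sqrt 2 * 4 / \<theta>) * (a / t))" by (rule real_le_rsqrt)
    also have "\<dots> = sqrt (sqrt 2 * 4 / \<theta>) * (a powr (1/2) * t powr (- (1/2)))"
    proof -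
      have "a powr (1/2) = sqrt a" using a by (simp add: powr_half_sqrt)
      moreover have "t powr (- (1/2)) = 1 / sqrt t" using t by (simp only: powr_minus powr_half_sqrt less_imp_le inverse_eq_divide)
      moreover have "sqrt (K * (a / t)) = sqrt K * (sqrt a * (1 / sqrt t))" for K by (simp add: real_sqrt_mult real_sqrt_divide)
      ultimately show ?thesis by (simp only:)
    qed
    also have "\<dots> \<le> C * (a powr (1/2) * t powr (- (1/2)))" by (intro mult_right_mono) (auto simp: C_def)
    finally have b1: "(\<integral>\<omega>. \<bar>Y \<omega>\<bar> \<partial>M) \<le> C * (a powr (1/2) * t powr (- (1/2)))" .
    have b2: "(\<integral>\<omega>. \<bar>Y \<omega>\<bar> \<partial>M) \<le> C * a"
    proof -
      let ?h = "\<lambda>\<omega> s. ?f (X (max 0 s) \<omega>)"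
      have hm: "(\<lambda>(\<omega>, s). ?h \<omega> s) \<in> borel_measurable (M \<Otimes>\<^sub>M ?U)" by measurable
      have ih: "integrable (M \<Otimes>\<^sub>M ?U) (\<lambda>(\<omega>, s). ?h \<omega> s)"
        by (rule MU.P.integrable_const_bound[of _ 1]) (use hm in \<open>auto simp: indicator_def\<close>)
      have io: "integrable M (\<lambda>\<omega>. (\<integral>s. ?h \<omega> s \<partial>?U))" using MU.integrable_fst[OF ih] .
      have "(\<integral>\<omega>. \<bar>Y \<omega>\<bar> \<partial>M) \<le> (\<integral>\<omega>. (\<integral>s. ?h \<omega> s \<partial>?U) + a \<partial>M)"
      proof (rule integral_mono[OF iY])
        show "integrable M (\<lambda>\<omega>. (\<integral>s. ?h \<omega> s \<partial>?U) + a)" using io by simp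
        fix \<omega> assume w: "\<omega> \<in> space M"
        show "\<bar>Y \<omega>\<bar> \<le> (\<integral>s. ?h \<omega> s \<partial>?U) + a"
          unfolding Yeq[OF w] occ[OF w, symmetric] using a by (simp add: abs_le_iff)
      qed
      also have "\<dots> = (\<integral>\<omega>. (\<integral>s. ?h \<omega> s \<partial>?U) \<partial>M) + a" using io by (simp add: prob_space)
      also have "(\<integral>\<omega>. (\<integral>s. ?h \<omega> s \<partial>?U) \<partial>M) = (\<integral>s. (\<integral>\<omega>. ?h \<omega> s \<partial>M) \<partial>?U)"
        by (rule MU.Fubini_integral[OF ih, symmetric])
      also have "\<dots> = (\<integral>s. a \<partial>?U)"
      proof (rule Bochner_Integration.integral_cong[OF refl])
        fix s :: real
        have [measurable]: "X (max 0 s) \<in> borel_measurable M" by (rule Xm) simp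
        have "(\<integral>\<omega>. ?h \<omega> s \<partial>M) = (\<integral>x. ?f x \<partial>distr M borel (X (max 0 s)))"
          by (rule integral_distr[symmetric]) measurable
        also have "\<dots> = a" unfolding stationary_regime[OF P \<nu> X X0 max.cobounded1] by (rule int)
        finally show "(\<integral>\<omega>. ?h \<omega> s \<partial>M) = a" .
      qed
      also have "\<dots> + a = 2 * a" by (simp add: U.prob_space)
      also have "\<dots> \<le> C * a" using a by (intro mult_right_mono) (auto simp: C_def)
      finally show ?thesis .
    qed
    have "(\<integral>\<^sup>+\<omega>. ennreal \<bar>measure (occupation_measure X t \<omega>) A - measure \<nu> A\<bar> \<partial>M) = (\<integral>\<^sup>+\<omega>. ennreal \<bar>Y \<omega>\<bar> \<partial>M)"
      by (intro nn_integral_cong) (simp add: Yeq a_def)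
    also have "\<dots> = ennreal (\<integral>\<omega>. \<bar>Y \<omega>\<bar> \<partial>M)" by (rule nn_integral_eq_integral[OF iY]) simp
    also have "\<dots> \<le> ennreal (C * min a (a powr (1/2) * t powr (- (1/2))))"
      using b1 b2 by (intro ennreal_leI) (auto simp: min_def)
    finally show "(\<integral>\<^sup>+\<omega>. ennreal \<bar>measure (occupation_measure X t \<omega>) A - measure \<nu> A\<bar> \<partial>M)
          \<le> ennreal (C * min (measure \<nu> A) (measure \<nu> A powr (1/2) * t powr (- (1/2))))" unfolding a_def .
  qed
qed

section \<open>Dyadic cells and the expected Wasserstein cost\<close>

definition shell :: "'a::euclidean_space \<Rightarrow> nat" where
  "shell x = nat \<lceil>log 2 (max 1 (norm x))\<rceil>"

lemma shell_measurable [measurable]: "shell \<in> borel \<rightarrow>\<^sub>M count_space UNIV"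
  unfolding shell_def by measurable

lemma norm_le_shell: "norm x \<le> 2 powr real (shell x)"
proof -
  have "0 \<le> log 2 (max 1 (norm x))" by simp
  then have "log 2 (max 1 (norm x)) \<le> real (shell x)" unfolding shell_def by linarith
  then have "2 powr log 2 (max 1 (norm x)) \<le> 2 powr real (shell x)" by (intro powr_mono) auto
  then show ?thesis by simp
qed

lemma shell_less_norm: 
  assumes "shell x \<noteq> 0" shows "2 powr (real (shell x) - 1) \<le> norm x"
proof -
  have 0: "0 \<le> log 2 (max 1 (norm x))" by simp
  then have le: "real (shell x) - 1 \<le> log 2 (max 1 (norm x))"
    using assms unfolding shell_def by linarith
  have "log 2 (max 1 (norm x)) \<noteq> 0"
  proof
    assume "log 2 (max 1 (norm x)) = 0"
    then have "shell x = 0" unfolding shell_def by (simp only: ceiling_zero nat_0)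
    then show False using assms by simp
  qed
  then have "max 1 (norm x) \<noteq> 1" by (metis log_one)
  then have eq: "max 1 (norm x) = norm x" by auto
  have "2 powr (real (shell x) - 1) \<le> 2 powr log 2 (max 1 (norm x))" using le by (intro powr_mono) auto
  also have "\<dots> = max 1 (norm x)" by simp
  finally show ?thesis by (simp only: eq)
qed

text \<open>Markov's inequality: on shell \<open>n > 0\<close> the norm is at least \<open>2 powr (n - 1)\<close>.\<close>

lemma shell_mass_le:
  fixes \<nu> :: "'a::euclidean_space measure"
  assumes "prob_space \<nu>" and S[measurable_cong]: "sets \<nu> = sets borel" and "moment \<nu> q < \<infinity>" "q > 0"
  shows "\<exists>B\<ge>1. \<forall>n. measure \<nu> {x. shell x = n} \<le> B * 2 powr (- q * real n)"
proof -
  interpret prob_space \<nu> by fact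
  have [simp]: "space \<nu> = UNIV" using sets_eq_imp_space_eq[OF S] by simp
  define m where "m = enn2real (moment \<nu> q)"
  have m: "moment \<nu> q = ennreal m" "m \<ge> 0" using assms(3) by (auto simp: m_def less_top)
  define B where "B = 2 powr q * max 1 m"
  have "1 * 1 \<le> B" unfolding B_def using assms(4) by (intro mult_mono) (auto intro!: ge_one_powr_ge_zero)
  then have B1: "B \<ge> 1" by simp
  moreover have "measure \<nu> {x. shell x = n} \<le> B * 2 powr (- q * real n)" for n
  proof (cases "n = 0")
    case True
    then show ?thesis using B1 prob_le_1[of "{x. shell x = n}"] by (simp del: prob_le_1)
  next
    case False
    let ?F = "{x::'a. shell x = n}"
    have F[measurable]: "?F \<in> sets borel" by measurable
    have "ennreal (2 powr (q * (real n - 1)) * measure \<nu> ?F) = (\<integral>\<^sup>+x. ennreal (2 powr (q * (real n - 1))) * indicator ?F x \<partial>\<nu>)"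
      by (subst nn_integral_cmult_indicator) (auto simp: S emeasure_eq_measure ennreal_mult)
    also have "\<dots> \<le> moment \<nu> q" unfolding moment_def
    proof (rule nn_integral_mono)
      fix x :: 'a
      show "ennreal (2 powr (q * (real n - 1))) * indicator ?F x \<le> ennreal (norm x powr q)"
      proof (cases "shell x = n")
        case True
        then have "2 powr (real n - 1) \<le> norm x" using shell_less_norm[of x] False by simp
        then have "(2 powr (real n - 1)) powr q \<le> norm x powr q" using assms(4) by (intro powr_mono2) auto
        then show ?thesis by (auto simp: powr_powr mult.commute indicator_def intro!: ennreal_leI)
      qed simp
    qed
    finally have "2 powr (q * (real n - 1)) * measure \<nu> ?F \<le> m" unfolding m using m(2) by (subst (asm) ennreal_le_iff) auto
    also have "\<dots> \<le> max 1 m" by simp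
    finally have "2 powr (- (q * (real n - 1))) * (2 powr (q * (real n - 1)) * measure \<nu> ?F) \<le> 2 powr (- (q * (real n - 1))) * max 1 m"
      by (intro mult_left_mono) auto
    also have "2 powr (- (q * (real n - 1))) * (2 powr (q * (real n - 1)) * measure \<nu> ?F) = measure \<nu> ?F"
      by (simp add: mult.assoc[symmetric] powr_add[symmetric])
    also have "2 powr (- (q * (real n - 1))) = 2 powr q * 2 powr (- q * real n)"
      by (simp add: powr_add[symmetric] algebra_simps)
    finally show ?thesis by (simp add: B_def ac_simps)
  qed
  ultimately show ?thesis by blast
qed

text \<open>A label of the box containing \<open>x\<close>: its shell and the position on the grid of mesh
  \<open>2 powr (shell x - l)\<close>, as a list along an enumeration \<open>bs\<close> of the basis, so that labels form a
  countable type.\<close>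

definition cell :: "'a::euclidean_space list \<Rightarrow> nat \<Rightarrow> 'a \<Rightarrow> nat \<times> int list" where
  "cell bs l x = (shell x, map (\<lambda>b. \<lfloor>2 powr (real l - real (shell x)) * (x \<bullet> b)\<rfloor>) bs)"

definition cell_labels :: "nat \<Rightarrow> nat \<Rightarrow> int list set" where
  "cell_labels d l = {ks. set ks \<subseteq> {- (2 ^ l)..2 ^ l} \<and> length ks = d}"

lemma cell_eq_iff:
  "cell bs l x = (n, ks) \<longleftrightarrow> shell x = n \<and> length ks = length bs \<and> 
     (\<forall>i<length bs. \<lfloor>2 powr (real l - real n) * (x \<bullet> bs ! i)\<rfloor> = ks ! i)"
  unfolding cell_def by (auto simp: list_eq_iff_nth_eq)

lemma cell_measurable [measurable]: "cell bs l \<in> borel \<rightarrow>\<^sub>M count_space UNIV"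
proof (subst measurable_count_space_eq_countable, simp, intro conjI ballI)
  fix i :: "nat \<times> int list"
  obtain n ks where i: "i = (n, ks)" by (cases i)
  have "cell bs l -` {i} \<inter> space borel = {x \<in> space borel. shell x = n \<and> length ks = length bs \<and> 
     (\<forall>i\<in>{..<length bs}. \<lfloor>2 powr (real l - real n) * (x \<bullet> bs ! i)\<rfloor> = ks ! i)}"
    by (auto simp: i cell_eq_iff)
  also have "\<dots> \<in> sets borel" by measurable
  finally show "cell bs l -` {i} \<inter> space borel \<in> sets borel" .
qed auto

text \<open>The meshes are consecutive powers of two, and the integer part of a number is determined by that of its double.\<close>

lemma cell_refines: "cell bs (Suc l) x = cell bs (Suc l) y \<Longrightarrow> cell bs l x = cell bs l y"
proof -
  assume eq: "cell bs (Suc l) x = cell bs (Suc l) y"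
  then have n: "shell x = shell y" by (simp add: cell_def)
  have half: "\<lfloor>z\<rfloor> = \<lfloor>2 * z\<rfloor> div 2" for z :: real by linarith
  have dbl: "2 powr (real (Suc l) - m) * z = 2 * (2 powr (real l - m) * z)" for m z
  proof -
    have "real (Suc l) - m = 1 + (real l - m)" by simp
    then show ?thesis by (simp only: powr_add powr_one mult.assoc)
  qed
  have "\<lfloor>2 powr (real l - real (shell x)) * (x \<bullet> b)\<rfloor> = \<lfloor>2 powr (real l - real (shell y)) * (y \<bullet> b)\<rfloor>" if "b \<in> set bs" for b
  proof -
    have "\<lfloor>2 powr (real (Suc l) - real (shell x)) * (x \<bullet> b)\<rfloor> = \<lfloor>2 powr (real (Suc l) - real (shell y)) * (y \<bullet> b)\<rfloor>"
      using eq that by (auto simp: cell_def)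
    then show ?thesis unfolding dbl by (simp only: half[of "2 powr (real l - _) * _"])
  qed
  with n show ?thesis by (simp add: cell_def)
qed

lemma cell_label_range:
  assumes bs: "set bs \<subseteq> Basis" and c: "cell bs l x = (n, ks)"
  shows "ks \<in> cell_labels (length bs) l"
proof -
  have n: "shell x = n" and ks: "ks = map (\<lambda>b. \<lfloor>2 powr (real l - real n) * (x \<bullet> b)\<rfloor>) bs"
    using c by (auto simp: cell_def)
  have "\<lfloor>2 powr (real l - real n) * (x \<bullet> b)\<rfloor> \<in> {- (2 ^ l)..2 ^ l}" if "b \<in> set bs" for b
  proof -
    have "\<bar>x \<bullet> b\<bar> \<le> norm x" using bs that by (intro Basis_le_norm) auto
    also have "\<dots> \<le> 2 powr real n" using norm_le_shell[of x] n by simp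
    finally have "2 powr (real l - real n) * \<bar>x \<bullet> b\<bar> \<le> 2 powr (real l - real n) * 2 powr real n" by (intro mult_left_mono) auto
    also have "\<dots> = 2 ^ l" unfolding powr_add[symmetric] by (simp add: powr_realpow)
    finally have "\<bar>2 powr (real l - real n) * (x \<bullet> b)\<bar> \<le> 2 ^ l" by (simp add: abs_mult)
    then have "- (2 ^ l) \<le> 2 powr (real l - real n) * (x \<bullet> b)" "2 powr (real l - real n) * (x \<bullet> b) \<le> 2 ^ l" by linarith+
    then show ?thesis by (auto simp: le_floor_iff floor_le_iff)
  qed
  then show ?thesis unfolding cell_labels_def ks by auto
qed

lemma finite_cell_labels [simp]: "finite (cell_labels d l)"
  unfolding cell_labels_def by (rule finite_lists_length_eq) simp

lemma card_cell_labels_le: "real (card (cell_labels d l)) \<le> 3 ^ d * 2 powr (real d * real l)"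
proof -
  have "card (cell_labels d l) = card {- (2 ^ l)..2 ^ l :: int} ^ d"
    unfolding cell_labels_def by (rule card_lists_length_eq) simp
  also have "real \<dots> = (2 * 2 ^ l + 1) ^ d" by simp
  also have "\<dots> \<le> (3 * 2 ^ l) ^ d" by (intro power_mono) auto
  also have "\<dots> = 3 ^ d * 2 powr (real d * real l)" 
  proof -
    have "(2::real) powr (real d * real l) = 2 ^ (l * d)"
      using powr_realpow[of "2::real" "l * d"] by (simp add: mult.commute)
    then show ?thesis by (simp add: power_mult_distrib power_mult)
  qed
  finally show ?thesis .
qed

lemma cell_diameter:
  fixes x y :: "'a::euclidean_space"
  assumes bs: "set bs = Basis" and c: "cell bs l x = cell bs l y"
  shows "norm (x - y) \<le> real DIM('a) * 2 powr (real (shell x) - real l)"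
proof -
  have n: "shell y = shell x" using c by (simp add: cell_def)
  let ?r = "2 powr (real l - real (shell x))"
  have r: "?r > 0" "2 powr (real (shell x) - real l) = 1 / ?r" by (simp_all add: powr_diff)
  have "\<bar>(x - y) \<bullet> b\<bar> \<le> 2 powr (real (shell x) - real l)" if "b \<in> Basis" for b
  proof -
    have "\<lfloor>?r * (x \<bullet> b)\<rfloor> = \<lfloor>?r * (y \<bullet> b)\<rfloor>" using c bs that n by (auto simp: cell_def)
    then have "\<bar>?r * (x \<bullet> b) - ?r * (y \<bullet> b)\<bar> \<le> 1" by linarith
    then have "?r * \<bar>(x - y) \<bullet> b\<bar> \<le> 1" by (simp add: inner_diff_left abs_mult right_diff_distrib[symmetric])
    then show ?thesis unfolding r(2) using r(1) by (simp only: pos_le_divide_eq mult.commute)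
  qed
  then have "(\<Sum>b\<in>Basis. \<bar>(x - y) \<bullet> b\<bar>) \<le> (\<Sum>b\<in>(Basis::'a set). 2 powr (real (shell x) - real l))" by (intro sum_mono)
  then show ?thesis using norm_le_l1[of "x - y"] by simp
qed

text \<open>The tree of cells, with one cell above all the shells, where masses from different shells are
  matched.\<close>

definition tree_cell :: "'a::euclidean_space list \<Rightarrow> nat \<Rightarrow> 'a \<Rightarrow> nat \<times> int list" where
  "tree_cell bs l x = (case l of 0 \<Rightarrow> (0, []) | Suc j \<Rightarrow> cell bs j x)"

text \<open>In a common box the distance is at most the diameter. At the root it is at most twice the radius of the
  outer one of the two shells, which is why both points have to be charged.\<close>

lemma tree_cell_cost:
  fixes x y :: "'a::euclidean_space"
  assumes bs: "set bs = Basis" and p: "p > 0" and c: "tree_cell bs l x = tree_cell bs l y"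
  defines "a \<equiv> \<lambda>x. (2 * real DIM('a)) powr p * 2 powr (p * (real (shell x) - real l))"
  shows "norm (x - y) powr p \<le> a x + a y"
proof -
  have d: "real DIM('a) \<ge> 1" using DIM_positive[where 'a='a] by simp
  have a0: "a z \<ge> 0" for z by (simp add: a_def)
  have main: "norm (x - y) powr p \<le> a z" if "norm (x - y) \<le> 2 * real DIM('a) * 2 powr (real (shell z) - real l)" for z
  proof -
    have "norm (x - y) powr p \<le> (2 * real DIM('a) * 2 powr (real (shell z) - real l)) powr p"
      using that p by (intro powr_mono2) auto
    also have "\<dots> = a z" using d by (simp add: a_def powr_mult powr_powr mult.commute)
    finally show ?thesis .
  qed
  show ?thesis
  proof (cases l)
    case 0
    define z where "z = (if shell x \<le> shell y then y else x)"
    have z: "real (shell x) \<le> real (shell z)" "real (shell y) \<le> real (shell z)" by (auto simp: z_def)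
    have "norm (x - y) \<le> norm x + norm y" by (rule norm_triangle_ineq4)
    also have "\<dots> \<le> 2 powr real (shell z) + 2 powr real (shell z)"
      by (intro add_mono order_trans[OF norm_le_shell] powr_mono z) auto
    also have "\<dots> \<le> 2 * real DIM('a) * 2 powr (real (shell z) - real l)" using d 0 by simp
    finally have "norm (x - y) powr p \<le> a z" by (rule main)
    then show ?thesis using a0[of x] a0[of y] unfolding z_def by (auto split: if_splits)
  next
    case (Suc j)
    then have "cell bs j x = cell bs j y" using c by (simp add: tree_cell_def)
    from cell_diameter[OF bs this]
    have "norm (x - y) \<le> 2 * real DIM('a) * 2 powr (real (shell x) - real l)"
      using Suc by (simp add: powr_diff powr_add)
    then show ?thesis using main[of x] a0[of y] by simp
  qed
qed

lemma cell_sum: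
  fixes \<psi> :: "nat \<times> int list \<Rightarrow> real"
  assumes \<psi>0: "\<And>i. \<psi> i \<ge> 0" and off: "\<And>n k. k \<notin> cell_labels d l \<Longrightarrow> \<psi> (n, k) = 0" and a0: "\<And>n. a n \<ge> 0"
  shows "(\<integral>\<^sup>+i. ennreal (a (fst i)) * ennreal (\<psi> i) \<partial>count_space UNIV) =
     (\<Sum>n. ennreal (a n * (\<Sum>k\<in>cell_labels d l. \<psi> (n, k))))"
proof -
  have "(\<integral>\<^sup>+i. ennreal (a (fst i)) * ennreal (\<psi> i) \<partial>count_space UNIV) =
     (\<integral>\<^sup>+n. \<integral>\<^sup>+k. ennreal (a n) * ennreal (\<psi> (n, k)) \<partial>count_space UNIV \<partial>count_space UNIV)"
    by (subst nn_integral_fst_count_space[symmetric]) simp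
  also have "\<dots> = (\<integral>\<^sup>+n. ennreal (a n * (\<Sum>k\<in>cell_labels d l. \<psi> (n, k))) \<partial>count_space UNIV)"
  proof (rule nn_integral_cong)
    fix n
    have "(\<integral>\<^sup>+k. ennreal (a n) * ennreal (\<psi> (n, k)) \<partial>count_space UNIV) = (\<Sum>k\<in>cell_labels d l. ennreal (a n) * ennreal (\<psi> (n, k)))"
      by (rule nn_integral_count_space') (use off in auto)
    also have "\<dots> = ennreal (a n * (\<Sum>k\<in>cell_labels d l. \<psi> (n, k)))"
      using \<psi>0 a0 by (simp add: sum_distrib_left ennreal_mult sum_nonneg flip: ennreal_mult)
    finally show "(\<integral>\<^sup>+k. ennreal (a n) * ennreal (\<psi> (n, k)) \<partial>count_space UNIV) = ennreal (a n * (\<Sum>k\<in>cell_labels d l. \<psi> (n, k)))" .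
  qed
  finally show ?thesis by (simp add: nn_integral_count_space_nat)
qed

lemma borel_measurable_nn_integral_countable:
  fixes f :: "'w \<Rightarrow> 'i::countable \<Rightarrow> ennreal"
  assumes "\<And>i. (\<lambda>\<omega>. f \<omega> i) \<in> borel_measurable M"
  shows "(\<lambda>\<omega>. \<integral>\<^sup>+i. f \<omega> i \<partial>count_space UNIV) \<in> borel_measurable M"
proof -
  interpret sigma_finite_measure "count_space (UNIV::'i set)"
    by (rule sigma_finite_measure_count_space_countable) auto
  have "(\<lambda>(i, \<omega>). f \<omega> i) \<in> borel_measurable (count_space UNIV \<Otimes>\<^sub>M M)"
    by (rule measurable_pair_measure_countable1) (auto simp: assms)
  from measurable_compose[OF measurable_pair_swap' this]
  have "(\<lambda>(\<omega>, i). f \<omega> i) \<in> borel_measurable (M \<Otimes>\<^sub>M count_space UNIV)" by (simp add: case_prod_beta)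
  then show ?thesis by (rule borel_measurable_nn_integral)
qed

lemma suminf_ennreal_le:
  assumes "\<And>n. f n \<ge> 0" "\<And>N. (\<Sum>n<N. f n) \<le> (B::real)"
  shows "(\<Sum>n. ennreal (f n)) \<le> ennreal B"
  unfolding suminf_eq_SUP using assms by (intro SUP_least) (auto simp: sum_ennreal intro!: ennreal_leI)

lemma sum_powr_half_le:
  fixes w :: "'b \<Rightarrow> real" assumes "finite K" "\<And>k. w k \<ge> 0"
  shows "(\<Sum>k\<in>K. w k powr (1/2)) \<le> sqrt (card K) * sqrt (\<Sum>k\<in>K. w k)"
proof -
  have "(\<Sum>k\<in>K. 1 * sqrt (w k))\<^sup>2 \<le> (\<Sum>k\<in>K. 1\<^sup>2) * (\<Sum>k\<in>K. (sqrt (w k))\<^sup>2)"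
    by (rule Cauchy_Schwarz_ineq_sum)
  then have "(\<Sum>k\<in>K. sqrt (w k))\<^sup>2 \<le> card K * (\<Sum>k\<in>K. w k)" using assms by simp
  then have "(\<Sum>k\<in>K. sqrt (w k)) \<le> sqrt (card K * (\<Sum>k\<in>K. w k))" by (rule real_le_rsqrt)
  then show ?thesis using assms by (simp add: powr_half_sqrt real_sqrt_mult)
qed

lemma cell_mass_sum:
  fixes \<nu> :: "'a::euclidean_space measure"
  assumes "prob_space \<nu>" and S[measurable_cong]: "sets \<nu> = sets borel"
  shows "(\<Sum>k\<in>cell_labels d l. measure \<nu> {x. cell bs l x = (n, k)}) \<le> measure \<nu> {x. shell x = n}"
proof -
  interpret prob_space \<nu> by fact
  have m: "{x. cell bs l x = i} \<in> sets \<nu>" for i unfolding S by measurable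
  have "(\<Sum>k\<in>cell_labels d l. measure \<nu> {x. cell bs l x = (n, k)}) = measure \<nu> (\<Union>k\<in>cell_labels d l. {x. cell bs l x = (n, k)})"
    by (rule finite_measure_finite_Union[symmetric]) (use m in \<open>auto simp: disjoint_family_on_def\<close>)
  also have "\<dots> \<le> measure \<nu> {x. shell x = n}"
    by (rule finite_measure_mono) (auto simp: cell_def S)
  finally show ?thesis .
qed

text \<open>Cutting the tree at depth \<open>L\<close> costs the diameter of the finest boxes for all the mass; it is
  summable over the shells since \<open>p < q\<close>. The coarser levels are charged for the mass differences,
  where the linear bound is summed over the boxes of a shell directly and the square root bound with
  Cauchy--Schwarz. The constant depends neither on the random measure nor on \<open>s\<close> and \<open>L\<close>, so that it serves for
  all times at once.\<close>

lemma expected_wasserstein_dyadic: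
  fixes \<nu> :: "'a::euclidean_space measure"
  assumes M: "prob_space M" and \<nu>: "prob_space \<nu>" and S[measurable_cong]: "sets \<nu> = sets borel" 
    and mom: "moment \<nu> q < \<infinity>" and p: "0 < p" "p < q" and C: "C > 0"
  shows "\<exists>K>0. \<forall>N s L B. 
     (\<forall>\<omega>\<in>space M. prob_space (N \<omega>) \<and> sets (N \<omega>) = sets borel) \<longrightarrow>
     (\<forall>A\<in>sets borel. (\<lambda>\<omega>. measure (N \<omega>) A) \<in> borel_measurable M) \<longrightarrow>
     (\<forall>A\<in>sets borel. (\<integral>\<^sup>+\<omega>. ennreal \<bar>measure (N \<omega>) A - measure \<nu> A\<bar> \<partial>M) \<le> ennreal (C * min (measure \<nu> A) (measure \<nu> A powr (1/2) * s))) \<longrightarrow>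
     s > 0 \<longrightarrow> (\<forall>n. dyadic_sum p q (real DIM('a)) L n s \<le> B) \<longrightarrow>
     (\<integral>\<^sup>+\<omega>. epowr (wasserstein p (N \<omega>) \<nu>) p \<partial>M) \<le> ennreal (K * (2 powr (- p * real L) + B))"
proof -
  interpret M: prob_space M by fact
  interpret \<nu>: prob_space \<nu> by fact
  let ?d = "DIM('a)"
  have q: "q > 0" using p by simp
  obtain bs where bs: "set bs = (Basis :: 'a set)" "distinct bs" using finite_distinct_list[of "Basis::'a set"] by auto
  have len: "length bs = ?d" using bs distinct_card by fastforce
  obtain B0 where B0: "B0 \<ge> 1" "\<And>n. measure \<nu> {x. shell x = n} \<le> B0 * 2 powr (- q * real n)"
    using shell_mass_le[OF \<nu> S mom q] by blast
  define \<kappa> where "\<kappa> = (2 * real ?d) powr p"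
  have \<kappa>: "\<kappa> > 0" by (simp add: \<kappa>_def)
  define \<alpha> where "\<alpha> l n = \<kappa> * 2 powr (p * (real n - real l))" for l n :: nat
  have \<alpha>0: "\<alpha> l n \<ge> 0" for l n using \<kappa> by (simp add: \<alpha>_def)
  define F where "F l i = {x. cell bs l x = i}" for l i
  have Fm[measurable]: "F l i \<in> sets borel" for l i unfolding F_def by measurable
  define w where "w l i = measure \<nu> (F l i)" for l i
  have w0: "w l i \<ge> 0" for l i by (simp add: w_def)
  have off: "w l (n, k) = 0" if "k \<notin> cell_labels ?d l" for l n k
  proof -
    have "F l (n, k) = {}" using cell_label_range[of bs l _ n k] bs(1) that by (auto simp: F_def len)
    then show ?thesis by (simp add: w_def)
  qed
  have wsum: "(\<Sum>k\<in>cell_labels ?d l. w l (n, k)) \<le> B0 * 2 powr (- q * real n)" for l n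
    unfolding w_def F_def by (rule order_trans[OF cell_mass_sum[OF \<nu> S] B0(2)])
  define D where "D = max B0 (sqrt (3 ^ ?d) * sqrt B0)"
  have D: "D > 0" using B0 by (simp add: D_def)
  define g where "g = 1 / (1 - 2 powr (p - q))"
  have g1: "2 powr (p - q) < (1::real)" using p by (intro two_powr_less_one) simp
  then have g: "g > 0" by (simp add: g_def)
  define K where "K = max ((2 + C) * \<kappa> * B0 * g) (C * \<kappa> * D)"
  have K0: "K > 0" using C \<kappa> D by (simp add: K_def less_max_iff_disj)
  show ?thesis
  proof (intro exI[of _ K] conjI allI impI K0)
    fix N :: "_ \<Rightarrow> 'a measure" and s B :: real and L :: nat
    assume N: "\<forall>\<omega>\<in>space M. prob_space (N \<omega>) \<and> sets (N \<omega>) = sets borel"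
      and Nm: "\<forall>A\<in>sets borel. (\<lambda>\<omega>. measure (N \<omega>) A) \<in> borel_measurable M"
      and dev: "\<forall>A\<in>sets borel. (\<integral>\<^sup>+\<omega>. ennreal \<bar>measure (N \<omega>) A - measure \<nu> A\<bar> \<partial>M) \<le> ennreal (C * min (measure \<nu> A) (measure \<nu> A powr (1/2) * s))"
      and s: "s > 0" and B: "\<forall>n. dyadic_sum p q (real ?d) L n s \<le> B"
    have Nm'[measurable]: "(\<lambda>\<omega>. measure (N \<omega>) (F l i)) \<in> borel_measurable M" for l i using Nm by simp
    define \<phi> where "\<phi> l i = min (w l i) (w l i powr (1/2) * s)" for l i
    have \<phi>0: "\<phi> l i \<ge> 0" for l i using w0 s by (simp add: \<phi>_def)
    have dev': "(\<integral>\<^sup>+\<omega>. ennreal \<bar>measure (N \<omega>) (F l i) - w l i\<bar> \<partial>M) \<le> ennreal (C * \<phi> l i)" for l i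
      using dev Fm[of l i] unfolding w_def \<phi>_def by blast
    let ?R1 = "\<lambda>\<omega>. \<integral>\<^sup>+i. ennreal (\<alpha> L (fst i)) * (2 * ennreal (w L i) + ennreal \<bar>measure (N \<omega>) (F L i) - w L i\<bar>) \<partial>count_space UNIV"
    let ?R2 = "\<lambda>\<omega> j. \<integral>\<^sup>+i. ennreal (\<alpha> j (fst i)) * ennreal \<bar>measure (N \<omega>) (F j i) - w j i\<bar> \<partial>count_space UNIV"
    have [measurable]: "(\<lambda>\<omega>. ?R2 \<omega> j) \<in> borel_measurable M" for j
      by (rule borel_measurable_nn_integral_countable) measurable
    have [measurable]: "?R1 \<in> borel_measurable M"
      by (rule borel_measurable_nn_integral_countable) measurable
    \<comment> \<open>The root shifts the levels: boxes of level \<open>j\<close> are the cells of level \<open>Suc j\<close> of the tree. In \<open>?R1\<close> the mass of the random measure is bounded through its deviation from \<open>\<nu>\<close>, so that the assumed deviation bound covers both terms.\<close>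
    have W: "epowr (wasserstein p (N \<omega>) \<nu>) p \<le> ?R1 \<omega> + (\<Sum>j<L. ?R2 \<omega> j)" if \<omega>: "\<omega> \<in> space M" for \<omega>
    proof -
      have N\<omega>: "prob_space (N \<omega>)" "sets (N \<omega>) = sets borel" using N \<omega> by auto
      interpret N: prob_space "N \<omega>" by fact
      have tm: "tree_cell bs l \<in> borel \<rightarrow>\<^sub>M count_space UNIV" for l
        unfolding tree_cell_def by (cases l) (auto simp: cell_measurable)
      have nested: "tree_cell bs l x = tree_cell bs l y" if "tree_cell bs (Suc l) x = tree_cell bs (Suc l) y" for l x y
        using that by (cases l) (auto simp: tree_cell_def intro: cell_refines)
      have cost: "ennreal (norm (x - y) powr p) \<le> ennreal (\<alpha> l (fst (tree_cell bs (Suc l) x))) + ennreal (\<alpha> l (fst (tree_cell bs (Suc l) y)))"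
        if "tree_cell bs l x = tree_cell bs l y" for l x y
        using tree_cell_cost[OF bs(1) p(1) that] \<kappa>
        by (simp add: \<alpha>_def \<kappa>_def tree_cell_def cell_def ennreal_leI flip: ennreal_plus)
      have "epowr (wasserstein p (N \<omega>) \<nu>) p \<le>
        (\<integral>\<^sup>+i. ennreal (\<alpha> L (fst i)) * (emeasure (N \<omega>) {x. tree_cell bs (Suc L) x = i} + emeasure \<nu> {x. tree_cell bs (Suc L) x = i}) \<partial>count_space UNIV) +
        (\<Sum>j<L. \<integral>\<^sup>+i. ennreal (\<alpha> j (fst i)) * ennreal \<bar>measure (N \<omega>) {x. tree_cell bs (Suc j) x = i} - measure \<nu> {x. tree_cell bs (Suc j) x = i}\<bar> \<partial>count_space UNIV)"
        by (rule wasserstein_le_multilevel[where \<alpha>="\<lambda>l i. ennreal (\<alpha> l (fst i))" and c="tree_cell bs", OF N\<omega>(1) \<nu> N\<omega>(2) S tm nested _ p(1) cost])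
           (auto simp: tree_cell_def)
      also have "\<dots> \<le> ?R1 \<omega> + (\<Sum>j<L. ?R2 \<omega> j)"
      proof (rule add_mono)
        have "emeasure (N \<omega>) (F L i) + emeasure \<nu> (F L i) \<le> 2 * ennreal (w L i) + ennreal \<bar>measure (N \<omega>) (F L i) - w L i\<bar>" for i
        proof -
          have "emeasure (N \<omega>) (F L i) + emeasure \<nu> (F L i) = ennreal (measure (N \<omega>) (F L i) + w L i)"
            by (simp add: N.emeasure_eq_measure \<nu>.emeasure_eq_measure w_def)
          also have "\<dots> \<le> ennreal (2 * w L i + \<bar>measure (N \<omega>) (F L i) - w L i\<bar>)" by (intro ennreal_leI) linarith
          also have "\<dots> = 2 * ennreal (w L i) + ennreal \<bar>measure (N \<omega>) (F L i) - w L i\<bar>"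
            using w0 by (simp add: ennreal_plus ennreal_mult)
          finally show ?thesis .
        qed
        then show "(\<integral>\<^sup>+i. ennreal (\<alpha> L (fst i)) * (emeasure (N \<omega>) {x. tree_cell bs (Suc L) x = i} + emeasure \<nu> {x. tree_cell bs (Suc L) x = i}) \<partial>count_space UNIV) \<le> ?R1 \<omega>"
          unfolding tree_cell_def by (auto simp: F_def intro!: nn_integral_mono mult_left_mono)
      qed (simp add: tree_cell_def F_def w_def)
      finally show ?thesis .
    qed
    have "(\<integral>\<^sup>+\<omega>. epowr (wasserstein p (N \<omega>) \<nu>) p \<partial>M) \<le> (\<integral>\<^sup>+\<omega>. ?R1 \<omega> + (\<Sum>j<L. ?R2 \<omega> j) \<partial>M)"
      by (rule nn_integral_mono) (rule W)
    also have "\<dots> = (\<integral>\<^sup>+\<omega>. ?R1 \<omega> \<partial>M) + (\<Sum>j<L. \<integral>\<^sup>+\<omega>. ?R2 \<omega> j \<partial>M)"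
      by (simp add: nn_integral_add nn_integral_sum)
    also have "(\<integral>\<^sup>+\<omega>. ?R1 \<omega> \<partial>M) \<le> ennreal (K * 2 powr (- p * real L))"
    proof -
      have "(\<integral>\<^sup>+\<omega>. ?R1 \<omega> \<partial>M) = (\<integral>\<^sup>+i. \<integral>\<^sup>+\<omega>. ennreal (\<alpha> L (fst i)) * (2 * ennreal (w L i) + ennreal \<bar>measure (N \<omega>) (F L i) - w L i\<bar>) \<partial>M \<partial>count_space UNIV)"
        by (rule nn_integral_count_space_nn_integral) (auto, measurable)
      also have "\<dots> = (\<integral>\<^sup>+i. ennreal (\<alpha> L (fst i)) * (2 * ennreal (w L i) + (\<integral>\<^sup>+\<omega>. ennreal \<bar>measure (N \<omega>) (F L i) - w L i\<bar> \<partial>M)) \<partial>count_space UNIV)"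
        by (intro nn_integral_cong) (simp add: nn_integral_cmult nn_integral_add M.emeasure_space_1)
      also have "\<dots> \<le> (\<integral>\<^sup>+i. ennreal (\<alpha> L (fst i)) * ennreal ((2 + C) * w L i) \<partial>count_space UNIV)"
      proof (intro nn_integral_mono mult_left_mono)
        fix i
        have "2 * ennreal (w L i) + (\<integral>\<^sup>+\<omega>. ennreal \<bar>measure (N \<omega>) (F L i) - w L i\<bar> \<partial>M) \<le> 2 * ennreal (w L i) + ennreal (C * w L i)"
          using C by (intro add_left_mono order_trans[OF dev'] ennreal_leI mult_left_mono) (auto simp: \<phi>_def)
        also have "\<dots> = ennreal ((2 + C) * w L i)" using w0 C by (simp add: distrib_right ennreal_plus ennreal_mult)
        finally show "2 * ennreal (w L i) + (\<integral>\<^sup>+\<omega>. ennreal \<bar>measure (N \<omega>) (F L i) - w L i\<bar> \<partial>M) \<le> ennreal ((2 + C) * w L i)" .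
      qed simp
      also have "\<dots> = (\<Sum>n. ennreal (\<alpha> L n * (\<Sum>k\<in>cell_labels ?d L. (2 + C) * w L (n, k))))"
        by (rule cell_sum) (use w0 C off \<alpha>0 in auto)
      also have "\<dots> \<le> ennreal (K * 2 powr (- p * real L))"
      proof (rule suminf_ennreal_le)
        show "0 \<le> \<alpha> L n * (\<Sum>k\<in>cell_labels ?d L. (2 + C) * w L (n, k))" for n
          using \<alpha>0 w0 C by (intro mult_nonneg_nonneg sum_nonneg) auto
        fix m
        have "(\<Sum>n<m. \<alpha> L n * (\<Sum>k\<in>cell_labels ?d L. (2 + C) * w L (n, k))) \<le> (\<Sum>n<m. \<alpha> L n * ((2 + C) * (B0 * 2 powr (- q * real n))))"
          unfolding sum_distrib_left[symmetric] using \<alpha>0 C wsum by (intro sum_mono mult_left_mono) auto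
        also have "\<dots> = (\<Sum>n<m. (2 powr (p - q)) ^ n) * ((2 + C) * \<kappa> * B0 * 2 powr (- p * real L))"
        proof -
          have "\<alpha> L n * ((2 + C) * (B0 * 2 powr (- q * real n))) = (2 powr (p - q)) ^ n * ((2 + C) * \<kappa> * B0 * 2 powr (- p * real L))" for n
          proof -
            have "2 powr (p * (real n - real L)) * 2 powr (- q * real n) = (2 powr (p - q)) ^ n * 2 powr (- p * real L)"
              by (simp add: powr_power powr_add[symmetric] algebra_simps)
            then show ?thesis by (simp add: \<alpha>_def ac_simps)
          qed
          then show ?thesis by (simp only: sum_distrib_right)
        qed
        also have "\<dots> \<le> g * ((2 + C) * \<kappa> * B0 * 2 powr (- p * real L))"
          unfolding g_def using C \<kappa> B0(1) g1 by (intro mult_right_mono geometric_sum_le) auto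
        also have "\<dots> = ((2 + C) * \<kappa> * B0 * g) * 2 powr (- p * real L)" by simp
        also have "\<dots> \<le> K * 2 powr (- p * real L)" by (intro mult_right_mono) (auto simp: K_def)
        finally show "(\<Sum>n<m. \<alpha> L n * (\<Sum>k\<in>cell_labels ?d L. (2 + C) * w L (n, k))) \<le> K * 2 powr (- p * real L)" .
      qed
      finally show ?thesis .
    qed
    also have "(\<Sum>j<L. \<integral>\<^sup>+\<omega>. ?R2 \<omega> j \<partial>M) \<le> ennreal (K * B)"
    proof -
      define T where "T j n = C * \<kappa> * D * ((2 powr (- (q - p))) ^ n * ((2 powr (- p)) ^ j * min 1 ((2 powr (real ?d / 2)) ^ j * ((2 powr (q / 2)) ^ n * s))))" for j n
      have T0: "T j n \<ge> 0" for j n using C \<kappa> D s by (simp add: T_def)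
      have "(\<integral>\<^sup>+\<omega>. ?R2 \<omega> j \<partial>M) \<le> (\<Sum>n. ennreal (T j n))" for j
      proof -
        have "(\<integral>\<^sup>+\<omega>. ?R2 \<omega> j \<partial>M) = (\<integral>\<^sup>+i. \<integral>\<^sup>+\<omega>. ennreal (\<alpha> j (fst i)) * ennreal \<bar>measure (N \<omega>) (F j i) - w j i\<bar> \<partial>M \<partial>count_space UNIV)"
          by (rule nn_integral_count_space_nn_integral) (auto, measurable)
        also have "\<dots> \<le> (\<integral>\<^sup>+i. ennreal (\<alpha> j (fst i)) * ennreal (C * \<phi> j i) \<partial>count_space UNIV)"
          using dev' by (intro nn_integral_mono) (simp add: nn_integral_cmult mult_left_mono)
        also have "\<dots> = (\<Sum>n. ennreal (\<alpha> j n * (\<Sum>k\<in>cell_labels ?d j. C * \<phi> j (n, k))))"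
          by (rule cell_sum) (use \<phi>0 C off \<alpha>0 in \<open>auto simp: \<phi>_def\<close>)
        also have "\<dots> \<le> (\<Sum>n. ennreal (T j n))"
        proof (intro suminf_le ennreal_leI)
          fix n
          let ?x = "2 powr (- q * real n)" and ?y = "2 powr (real ?d / 2 * real j) * 2 powr (- q * real n / 2) * s"
          have 1: "(\<Sum>k\<in>cell_labels ?d j. \<phi> j (n, k)) \<le> B0 * ?x"
            by (rule order_trans[OF sum_mono wsum]) (simp add: \<phi>_def)
          have "(\<Sum>k\<in>cell_labels ?d j. \<phi> j (n, k)) \<le> (\<Sum>k\<in>cell_labels ?d j. w j (n, k) powr (1/2)) * s"
            unfolding sum_distrib_right by (rule sum_mono) (simp add: \<phi>_def)
          also have "\<dots> \<le> sqrt (card (cell_labels ?d j)) * sqrt (\<Sum>k\<in>cell_labels ?d j. w j (n, k)) * s"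
            using s w0 by (intro mult_right_mono sum_powr_half_le) auto
          also have "\<dots> \<le> sqrt (3 ^ ?d * 2 powr (real ?d * real j)) * sqrt (B0 * ?x) * s"
            using s w0 wsum card_cell_labels_le by (intro mult_right_mono mult_mono real_sqrt_le_mono) (auto intro!: sum_nonneg)
          also have "\<dots> = (sqrt (3 ^ ?d) * sqrt B0) * ?y"
          proof -
            have sq: "sqrt (2 powr z) = 2 powr (z / 2)" for z :: real
              by (simp add: powr_half_sqrt[symmetric] powr_powr)
            have "sqrt (2 powr (real ?d * real j)) = 2 powr (real ?d / 2 * real j)" "sqrt ?x = 2 powr (- q * real n / 2)"
              unfolding sq by simp_all
            then show ?thesis by (simp add: real_sqrt_mult)
          qed
          finally have 2: "(\<Sum>k\<in>cell_labels ?d j. \<phi> j (n, k)) \<le> (sqrt (3 ^ ?d) * sqrt B0) * ?y" .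
          have "(\<Sum>k\<in>cell_labels ?d j. \<phi> j (n, k)) \<le> D * min ?x ?y"
          proof -
            have "B0 * ?x \<le> D * ?x" by (intro mult_right_mono) (auto simp: D_def)
            moreover have "(sqrt (3 ^ ?d) * sqrt B0) * ?y \<le> D * ?y" using s by (intro mult_right_mono) (auto simp: D_def)
            ultimately have "(\<Sum>k\<in>cell_labels ?d j. \<phi> j (n, k)) \<le> D * ?x" "(\<Sum>k\<in>cell_labels ?d j. \<phi> j (n, k)) \<le> D * ?y"
              using order_trans[OF 1] order_trans[OF 2] by blast+
            then show ?thesis unfolding min_def by presburger
          qed
          also have "min ?x ?y = ?x * min 1 ((2 powr (real ?d / 2)) ^ j * ((2 powr (q / 2)) ^ n * s))"
          proof -
            have "?y = ?x * ((2 powr (real ?d / 2)) ^ j * ((2 powr (q / 2)) ^ n * s))"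
            proof -
              have "2 powr (- q * real n / 2) = ?x * (2 powr (q / 2)) ^ n"
                by (simp add: powr_power powr_add[symmetric] algebra_simps)
              then show ?thesis by (simp add: powr_power ac_simps)
            qed
            moreover have "min x (x * z) = x * min 1 z" if "x > 0" for x z :: real
              using that by (auto simp: min_def)
            ultimately show ?thesis by (simp only: powr_gt_zero)
          qed
          finally have "C * (\<Sum>k\<in>cell_labels ?d j. \<phi> j (n, k)) \<le> C * (D * (?x * min 1 ((2 powr (real ?d / 2)) ^ j * ((2 powr (q / 2)) ^ n * s))))"
            using C by (intro mult_left_mono) auto
          then have "\<alpha> j n * (\<Sum>k\<in>cell_labels ?d j. C * \<phi> j (n, k)) \<le> \<alpha> j n * (C * (D * (?x * min 1 ((2 powr (real ?d / 2)) ^ j * ((2 powr (q / 2)) ^ n * s)))))"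
            unfolding sum_distrib_left[symmetric] by (rule mult_left_mono[OF _ \<alpha>0])
          also have "\<dots> = T j n"
          proof -
            have e: "2 powr (p * (real n - real j)) * ?x = (2 powr (- (q - p))) ^ n * (2 powr (- p)) ^ j"
              by (simp add: powr_power powr_add[symmetric] algebra_simps)
            have "\<alpha> j n * (C * (D * (?x * Z))) = C * \<kappa> * D * ((2 powr (p * (real n - real j)) * ?x) * Z)" for Z
              unfolding \<alpha>_def by (simp only: ac_simps)
            then show ?thesis unfolding T_def e by (simp only: mult.assoc)
          qed
          finally show "\<alpha> j n * (\<Sum>k\<in>cell_labels ?d j. C * \<phi> j (n, k)) \<le> T j n" .
        qed auto
        finally show ?thesis .
      qed
      then have "(\<Sum>j<L. \<integral>\<^sup>+\<omega>. ?R2 \<omega> j \<partial>M) \<le> (\<Sum>j<L. \<Sum>n. ennreal (T j n))" by (rule sum_mono)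
      also have "\<dots> = (\<Sum>n. \<Sum>j<L. ennreal (T j n))" by (rule suminf_sum[symmetric]) simp
      also have "\<dots> = (\<Sum>n. ennreal (\<Sum>j<L. T j n))" using T0 by simp
      also have "\<dots> \<le> ennreal (K * B)"
      proof (rule suminf_ennreal_le)
        fix m
        have "(\<Sum>n<m. \<Sum>j<L. T j n) = C * \<kappa> * D * dyadic_sum p q (real ?d) L m s"
          by (simp add: T_def dyadic_sum_def sum_distrib_left)
        also have "\<dots> \<le> K * B"
        proof (rule mult_mono)
          show "0 \<le> dyadic_sum p q (real ?d) L m s" using s by (auto simp: dyadic_sum_def intro!: sum_nonneg mult_nonneg_nonneg)
        qed (use B K0 in \<open>auto simp: K_def\<close>)
        finally show "(\<Sum>n<m. \<Sum>j<L. T j n) \<le> K * B" .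
      qed (use T0 in \<open>auto intro!: sum_nonneg\<close>)
      finally show ?thesis .
    qed
    also have "ennreal (K * 2 powr (- p * real L)) + ennreal (K * B) = ennreal (K * (2 powr (- p * real L) + B))"
    proof -
      have "0 \<le> B" using B[rule_format, of 0] by (simp add: dyadic_sum_def)
      then show ?thesis using K0 by (simp add: distrib_left ennreal_plus)
    qed
    finally show "(\<integral>\<^sup>+\<omega>. epowr (wasserstein p (N \<omega>) \<nu>) p \<partial>M) \<le> ennreal (K * (2 powr (- p * real L) + B))"
      by (simp add: add_mono)
  qed
qed

section \<open>Convergence rates of the occupation measure\<close>

theorem proposition2p4:
  fixes P :: "real \<Rightarrow> 'a::euclidean_space \<Rightarrow> 'a measure"
    and \<nu> :: "'a measure"
    and M :: "'w measure"
    and X :: "real \<Rightarrow> 'w \<Rightarrow> 'a"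
    and e :: "real \<Rightarrow> real"
    and q d :: real
  defines "d \<equiv> real DIM('a)"
  assumes "markov_semigroup P"
    and "stationary_distribution P \<nu>"
    and "\<And>\<mu>. stationary_distribution P \<mu> \<Longrightarrow> \<mu> = \<nu>"
    and "q > 1"
    and "moment \<nu> q < \<infinity>"
    and "e absolutely_integrable_on {0..}"
    and "\<And>t f. t \<ge> 0 \<Longrightarrow> f \<in> L2 \<nu> \<Longrightarrow>
           variance_wrt \<nu> (kernel_op (P t) f) \<le> e t * variance_wrt \<nu> f"
    and "markov_process M P X"
    and "right_continuous_paths M X"
    and "distr M borel (X 0) = \<nu>"
  shows "(\<forall>t\<^sub>0>0. property_A M (occupation_measure X) \<nu> t\<^sub>0 (\<lambda>_. \<nu>) (1/2) q (1/2) \<and>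
                   sup_moment t\<^sub>0 (\<lambda>_. \<nu>) q = max 1 (moment \<nu> q)) \<and>
         (\<forall>p t\<^sub>0. 0 < p \<and> p < q \<and> 0 < t\<^sub>0 \<longrightarrow>
           (\<exists>K>0. \<forall>t\<ge>t\<^sub>0. \<forall>r.
              (p < d/2 \<and> p/q < d/(d+q) \<and> r = t powr (- (p/d))) \<or>
              (p < d/2 \<and> d/(d+q) < p/q \<and> p/q < 1 \<and> r = t powr (- (1 - p/q))) \<or>
              (p = d/2 \<and> p/q < 1/2 \<and> r = t powr (- (1/2)) * ln (1 + t)) \<or>
              (p = d/2 \<and> 1/2 < p/q \<and> p/q < 1 \<and> r = t powr (- (1 - p/q))) \<or>
              (p > d/2 \<and> p/q < 1/2 \<and> r = t powr (- (1/2))) \<or>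
              (p > d/2 \<and> 1/2 < p/q \<and> p/q < 1 \<and> r = t powr (- (1 - p/q)))
              \<longrightarrow> (\<integral>\<^sup>+\<omega>. epowr (wasserstein p (occupation_measure X t \<omega>) \<nu>) p \<partial>M)
                    \<le> ennreal (K * r)))"
proof -
  note P = assms(2) and \<nu> = assms(3) and dec = assms(8) and X = assms(9) and rc = assms(10) and X0 = assms(11)
  have M: "prob_space M" and Xm: "\<And>t. t \<ge> 0 \<Longrightarrow> X t \<in> borel_measurable M"
    using X by (auto simp: markov_process_def)
  have \<nu>': "prob_space \<nu>" and S: "sets \<nu> = sets borel" using \<nu> by (auto simp: stationary_distribution_def)
  obtain C where C: "C > 0" and dev: "\<And>t A. t > 0 \<Longrightarrow> A \<in> sets borel \<Longrightarrow>
      (\<integral>\<^sup>+\<omega>. ennreal \<bar>measure (occupation_measure X t \<omega>) A - measure \<nu> A\<bar> \<partial>M)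
        \<le> ennreal (C * min (measure \<nu> A) (measure \<nu> A powr (1/2) * t powr (- (1/2))))"
    using occupation_property_A[OF P \<nu> X X0 rc assms(7) dec] by blast
  have sup: "sup_moment t0 (\<lambda>_. \<nu>) q = max 1 (moment \<nu> q)" for t0
    unfolding sup_moment_def by simp
  have A: "property_A M (occupation_measure X) \<nu> t0 (\<lambda>_. \<nu>) (1/2) q (1/2)" if "t0 > 0" for t0
    unfolding property_A_def
  proof (intro conjI exI[of _ C] allI impI ballI)
    show "sup_moment t0 (\<lambda>_. \<nu>) q < \<infinity>" unfolding sup using assms(6) by (simp add: max_def)
  qed (use \<nu>' S C dev that in auto)
  have W: "\<exists>K>0. \<forall>t\<ge>t0. \<forall>r. rate_regime p q d t r \<longrightarrow>
      (\<integral>\<^sup>+\<omega>. epowr (wasserstein p (occupation_measure X t \<omega>) \<nu>) p \<partial>M) \<le> ennreal (K * r)"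
    if p: "0 < p" "p < q" and t0: "0 < t0" for p t0
  proof -
    from expected_wasserstein_dyadic[OF M \<nu>' S assms(6) p C]
    obtain K1 where K1: "K1 > 0" and E: "\<And>N s L B. \<lbrakk>
       \<forall>\<omega>\<in>space M. prob_space (N \<omega>) \<and> sets (N \<omega>) = sets borel;
       \<forall>A\<in>sets borel. (\<lambda>\<omega>. measure (N \<omega>) A) \<in> borel_measurable M;
       \<forall>A\<in>sets borel. (\<integral>\<^sup>+\<omega>. ennreal \<bar>measure (N \<omega>) A - measure \<nu> A\<bar> \<partial>M) \<le> ennreal (C * min (measure \<nu> A) (measure \<nu> A powr (1/2) * s));
       s > 0; \<forall>n. dyadic_sum p q d L n s \<le> B\<rbrakk> \<Longrightarrow>
       (\<integral>\<^sup>+\<omega>. epowr (wasserstein p (N \<omega>) \<nu>) p \<partial>M) \<le> ennreal (K1 * (2 powr (- p * real L) + B))"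
      unfolding d_def by blast
    have "d > 0" by (simp add: d_def)
    from dyadic_sum_rate[OF p this t0] obtain K2 where K2: "K2 > 0" and R: "\<And>t r. t \<ge> t0 \<Longrightarrow> rate_regime p q d t r \<Longrightarrow>
      \<exists>L. 2 powr (- p * real L) \<le> K2 * r \<and> (\<forall>N. dyadic_sum p q d L N (t powr (-(1/2))) \<le> K2 * r)"
      by blast
    show ?thesis
    proof (intro exI[of _ "K1 * (2 * K2)"] conjI allI impI)
      show "K1 * (2 * K2) > 0" using K1 K2 by simp
      fix t r assume t: "t0 \<le> t" and r: "rate_regime p q d t r"
      have tpos: "t > 0" using t t0 by simp
      from R[OF t r] obtain L where L: "2 powr (- p * real L) \<le> K2 * r"
        and B: "\<forall>N. dyadic_sum p q d L N (t powr (-(1/2))) \<le> K2 * r" by blast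
      have "(\<integral>\<^sup>+\<omega>. epowr (wasserstein p (occupation_measure X t \<omega>) \<nu>) p \<partial>M) \<le> ennreal (K1 * (2 powr (- p * real L) + K2 * r))"
        by (rule E[OF _ _ _ _ B]) (use occupation_measure_random[OF Xm rc tpos] dev[OF tpos] tpos in auto)
      also have "\<dots> \<le> ennreal (K1 * (2 * K2) * r)"
      proof (rule ennreal_leI)
        have "K1 * (2 powr (- p * real L) + K2 * r) \<le> K1 * (K2 * r + K2 * r)" using K1 L by (intro mult_left_mono) auto
        then show "K1 * (2 powr (- p * real L) + K2 * r) \<le> K1 * (2 * K2) * r" by (simp add: algebra_simps)
      qed
      finally show "(\<integral>\<^sup>+\<omega>. epowr (wasserstein p (occupation_measure X t \<omega>) \<nu>) p \<partial>M) \<le> ennreal (K1 * (2 * K2) * r)" .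
    qed
  qed
  show ?thesis
    by (intro conjI allI impI A sup) (use W in \<open>auto simp only: rate_regime_def\<close>)
qed

end
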